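(* Let $\alpha>-2$ and let $\beta\le\beta_0$ (so $u_\beta$ is an entire radial solution of $\Delta^2u=|x|^\alpha e^u$ in $\mathbb{R}^N$). (i) If $N=3$ or $N=4$, then $u_\beta$ is unstable but stable at infinity for every $\beta\le\beta_0$. (ii) If $5\le N<N_\alpha$, then $u_\beta$ is stable at infinity for every $\beta<\beta_0$, while $u_{\beta_0}$ is not stable on $\mathbb{R}^N\setminus K$ for any compact set $K$. Moreover, there exists $\beta_1<\beta_0$ such that $u_\beta$ is stable if and only if $\beta\le\beta_1$. (iii) If $N\ge N_\alpha$, then $u_\beta$ is stable for every $\beta\le\beta_0$.
   Context: Fix an integer $N\ge3$ and $\alpha>-2$. For $\beta\in\mathbb{R}$, $u_\beta$ denotes the radial function $u_\beta(x)=u_\beta(r)$, $r=|x|$, solving the initial value problem $\Delta^2u=|x|^\alpha e^u$ for $r\in[0,R_\beta)$, $u'(0)=u'''(0)=0$, $u(0)=0$, $\Delta u(0)=\beta$, where $\Delta u=u''+\frac{N-1}{r}u'$ is the radial Laplacian in $\mathbb{R}^N$ and $[0,R_\beta)$ is the maximal interval of existence. $u_\beta$ is called an entire solution if $R_\beta=\infty$. $\beta_0:=\sup\{\beta\in\mathbb{R}:R_\beta=\infty\}$; it is known that $\beta_0$ is a finite negative number and that $R_\beta=\infty$ if and only if $\beta\le\beta_0$. A solution $u$ of $\Delta^2u=|x|^\alpha e^u$ is stable on a domain $\Omega\subset\mathbb{R}^N$ if $\int_\Omega|\Delta\phi|^2dx-\int_\Omega|x|^\alpha e^u\phi^2dx\ge0$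 for all $\phi\in C^2_c(\Omega)$; it is stable if stable on $\mathbb{R}^N$, and stable at infinity if stable on $\mathbb{R}^N\setminus K$ for some compact set $K$; unstable means not stable. $N_\alpha$ denotes the unique root in $(5,\infty)$ of the equation $\frac{N^2(N-4)^2}{16}=2(4+\alpha)(N-2)(N-4)$ (in the variable $N$).
   Formalization: The radial problem is taken in integrated form (u and Δu continuous up to r=0, u(0)=0, Δu(0)=β), without requiring u'''(0)=0; for α>-1 this is the stated problem, while for -2<α≤-1 no solution has u'''(0)=0. *)

theory Defs
  imports "HOL-Analysis.Analysis"
begin

text \<open>Radial IVP for \<Delta>^2 u = r^alpha e^u in R^N, written as the system
  v'' + (N-1)/r v' = w,  w'' + (N-1)/r w' = r^alpha e^v,
  v(0) = 0, w(0) = beta, v'(0) = w'(0) = 0, in its standard integrated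
  (Volterra) form on the interval I (I = [0,R) or I = [0,\<infinity>)).
  Here v is the radial profile of u and w = \<Delta>u.\<close>

definition radial_sol ::
  "nat \<Rightarrow> real \<Rightarrow> real \<Rightarrow> real set \<Rightarrow> (real \<Rightarrow> real) \<Rightarrow> (real \<Rightarrow> real) \<Rightarrow> bool" where
  "radial_sol N \<alpha> \<beta> I v w \<longleftrightarrow>
     continuous_on I v \<and> continuous_on I w \<and>
     (\<forall>r\<in>I. v r =
        (LBINT s=0..r. s powr (1 - real N) * (LBINT t=0..s. t powr (real N - 1) * w t))) \<and>
     (\<forall>r\<in>I. w r = \<beta> +
        (LBINT s=0..r. s powr (1 - real N) *
           (LBINT t=0..s. t powr (real N - 1 + \<alpha>) * exp (v t))))"

definition R_max :: "nat \<Rightarrow> real \<Rightarrow> real \<Rightarrow> ereal" where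
  "R_max N \<alpha> \<beta> = Sup {ereal R | R. 0 < R \<and> (\<exists>v w. radial_sol N \<alpha> \<beta> {0..<R} v w)}"

text \<open>The radial profile of u_beta (meaningful for entire solutions).\<close>
definition u_prof :: "nat \<Rightarrow> real \<Rightarrow> real \<Rightarrow> real \<Rightarrow> real" where
  "u_prof N \<alpha> \<beta> = (SOME v. \<exists>w. radial_sol N \<alpha> \<beta> {0..} v w)"

definition u_beta :: "real \<Rightarrow> real \<Rightarrow> 'a::euclidean_space \<Rightarrow> real" where
  "u_beta \<alpha> \<beta> = (\<lambda>x. u_prof DIM('a) \<alpha> \<beta> (norm x))"

definition beta0 :: "nat \<Rightarrow> real \<Rightarrow> real" where
  "beta0 N \<alpha> = Sup {\<beta>. R_max N \<alpha> \<beta> = \<infinity>}"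

definition N_alpha :: "real \<Rightarrow> real" where
  "N_alpha \<alpha> = (THE x. 5 < x \<and> x^2 * (x - 4)^2 / 16 = 2 * (4 + \<alpha>) * (x - 2) * (x - 4))"

definition C2 :: "('a::euclidean_space \<Rightarrow> real) \<Rightarrow> bool" where
  "C2 \<phi> \<longleftrightarrow> (\<exists>D D2.
      (\<forall>x. (\<phi> has_derivative blinfun_apply (D x)) (at x)) \<and>
      (\<forall>x. (D has_derivative blinfun_apply (D2 x)) (at x)) \<and>
      continuous_on UNIV D2)"

definition C2c :: "('a::euclidean_space \<Rightarrow> real) \<Rightarrow> 'a set \<Rightarrow> bool" where
  "C2c \<phi> \<Omega> \<longleftrightarrow> C2 \<phi> \<and> compact (closure {x. \<phi> x \<noteq> 0}) \<and> closure {x. \<phi> x \<noteq> 0} \<subseteq> \<Omega>"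

definition laplacian :: "('a::euclidean_space \<Rightarrow> real) \<Rightarrow> 'a \<Rightarrow> real" where
  "laplacian \<phi> x = (\<Sum>b\<in>Basis. deriv (\<lambda>t. deriv (\<lambda>s. \<phi> (x + s *\<^sub>R b)) t) 0)"

definition stable_on :: "real \<Rightarrow> ('a::euclidean_space \<Rightarrow> real) \<Rightarrow> 'a set \<Rightarrow> bool" where
  "stable_on \<alpha> u \<Omega> \<longleftrightarrow> (\<forall>\<phi>. C2c \<phi> \<Omega> \<longrightarrow>
     (LINT x:\<Omega>|lborel. (laplacian \<phi> x)^2)
       - (LINT x:\<Omega>|lborel. norm x powr \<alpha> * exp (u x) * (\<phi> x)^2) \<ge> 0)"

definition stable_sol :: "real \<Rightarrow> ('a::euclidean_space \<Rightarrow> real) \<Rightarrow> bool" where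
  "stable_sol \<alpha> u \<longleftrightarrow> stable_on \<alpha> u UNIV"

definition stable_at_infinity :: "real \<Rightarrow> ('a::euclidean_space \<Rightarrow> real) \<Rightarrow> bool" where
  "stable_at_infinity \<alpha> u \<longleftrightarrow> (\<exists>K. compact K \<and> stable_on \<alpha> u (UNIV - K))"

end

theory Submission
  imports Defs "HOL-Real_Asymp.Real_Asymp"
begin

text \<open>Stability follows from two Rellich type inequalities: \<open>\<integral>(\<Delta>\<phi>)\<^sup>2\<close> dominates
  \<open>(N(N-4)/4)\<^sup>2 \<integral>\<phi>\<^sup>2/r^4\<close> if \<open>N \<ge> 5\<close>, and \<open>\<epsilon>\<^sup>2 \<integral>\<phi>\<^sup>2 r powr (-4-\<epsilon>)\<close> for \<open>\<phi>\<close> supported in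
  \<open>r > 1\<close> in every dimension.  Both are pointwise inequalities up to a divergence.

  An entire radial solution has \<open>w = \<Delta>u < 0\<close> everywhere, since otherwise \<open>u\<close> blows up.  With
  \<open>t = ln r\<close> and \<open>z = u + (4+\<alpha>) t\<close> the equation becomes an autonomous fourth order equation
  \<open>P(d/dt) z = e\<^sup>z - lam\<close> with \<open>lam = 2(4+\<alpha>)(N-2)(N-4)\<close>, and \<open>r\<^sup>\<alpha> e\<^sup>u = e\<^sup>z / r^4\<close>.
  If \<open>lam \<le> (N(N-4)/4)\<^sup>2\<close>, that is \<open>N \<ge> N_alpha\<close>, then \<open>P - lam\<close> splits into real linear factors, and
  integrating them one after the other with \<open>e\<^sup>y - 1 \<ge> y\<close> gives \<open>e\<^sup>z \<le> lam\<close>, hence stability.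
  If \<open>\<beta> < \<beta>\<^sub>0\<close>, then \<open>w\<close> stays below a negative constant and \<open>e\<^sup>u\<close> has Gaussian decay; for \<open>N = 3, 4\<close> the
  slope of \<open>z\<close> becomes negative even at \<open>\<beta>\<^sub>0\<close>.  So the exterior inequality applies.
  At \<open>\<beta>\<^sub>0\<close> one has \<open>w \<rightarrow> 0\<close>, because a solution with \<open>w\<close> bounded away from 0 can be perturbed to a
  larger \<open>\<beta>\<close>; for \<open>N \<ge> 5\<close> it follows that the mean of \<open>e\<^sup>z\<close> over \<open>[T, T+L]\<close> is at least
  \<open>lam - O(1/L)\<close>, and radial test functions that are
  \<open>r powr (-(N-4)/2)\<close> on long annuli show instability outside every compact set if \<open>N < N_alpha\<close>.
  Monotonicity and left continuity in \<open>\<beta>\<close> then give the threshold \<open>\<beta>\<^sub>1\<close>.\<close>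

section \<open>Integration by parts for compactly supported functions\<close>


text \<open>Why the stability and instability thresholds meet: with D = d/dt the operator is P(D) =
  D (D-2) (D+N-2) (D+N-4). In s = D + m with m = (N-4)/2 it is even, namely (s^2 - m^2) (s^2 -
  (m+2)^2). Its value at s = 0 is (N(N-4)/4)^2, the Rellich constant, and the profile r^(-m) of the
  test functions belongs to the same s = 0. For N at least 5, P - lam as a quadratic in s^2 has
  positive discriminant, and its smaller root is nonnegative exactly if lam does not exceed P at the
  centre. So one comparison decides both whether the linear factors are real and whether the Rellich
  inequality absorbs lam / r^4.

  Existence is obtained by monotone iteration below supersolutions instead of continuation of local
  solutions. The only global upper bound available is w < 0; it closes the limit of increasing
  parameters and drives the estimates in the logarithmic variables.\<close>

lemma derivative_zero_off_support:
  fixes X :: "'a::euclidean_space \<Rightarrow> 'b::real_normed_vector"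
  assumes "compact K" "\<And>x. x \<notin> K \<Longrightarrow> X x = 0" "x \<notin> K"
  shows "(X has_derivative (\<lambda>h. 0)) (at x)"
proof -
  have "open (- K)" using assms(1) compact_imp_closed by blast
  moreover have "((\<lambda>x. 0 :: 'b) has_derivative (\<lambda>h. 0)) (at x)" by simp
  ultimately show ?thesis
    using has_derivative_transform_within_open[of "\<lambda>x. 0 :: 'b" "\<lambda>h. 0" x UNIV "- K" X] assms
    by force
qed

lemma integrable_compact_support:
  fixes f :: "'a::euclidean_space \<Rightarrow> real"
  assumes "continuous_on UNIV f" "compact C" "\<And>x. x \<notin> C \<Longrightarrow> f x = 0"
  shows "integrable lborel f"
proof -
  have "integrable lborel (\<lambda>x. indicator C x *\<^sub>R f x)"
    using assms by (intro borel_integrable_compact) (auto intro: continuous_on_subset)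
  moreover have "(\<lambda>x. indicator C x *\<^sub>R f x) = f"
    using assms(3) by (force simp: indicator_def)
  ultimately show ?thesis by simp
qed

lemma has_real_derivative_along_line:
  fixes F :: "'a::real_normed_vector \<Rightarrow> real"
  assumes "(F has_derivative F') (at (x + t *\<^sub>R b))"
  shows "((\<lambda>t. F (x + t *\<^sub>R b)) has_real_derivative F' b) (at t)"
proof -
  have "((\<lambda>t. F (x + t *\<^sub>R b)) has_derivative (\<lambda>h. F' (h *\<^sub>R b))) (at t)"
    by (rule has_derivative_compose[where f = "\<lambda>t. x + t *\<^sub>R b" and g = F, OF _ assms])
      (auto intro!: derivative_eq_intros)
  moreover have "(\<lambda>h. F' (h *\<^sub>R b)) = (*) (F' b)"
    using linear_scale[OF has_derivative_linear[OF assms]] by (auto simp: fun_eq_iff)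
  ultimately show ?thesis by (simp add: has_field_derivative_def)
qed

text \<open>By translation invariance the difference quotients of \<open>F\<close> along
  \<open>b\<close> have integral 0. They converge to the derivative and are dominated, by the mean
  value theorem, on one fixed compact set.\<close>

lemma integral_directional_derivative_eq_0:
  fixes F :: "'a::euclidean_space \<Rightarrow> real"
  assumes der: "\<And>x. (F has_derivative F' x) (at x)"
    and cont: "continuous_on UNIV (\<lambda>x. F' x b)"
    and K: "compact K" and supp: "\<And>x. x \<notin> K \<Longrightarrow> F x = 0"
  shows "integrable lborel (\<lambda>x. F' x b)" "(LINT x|lborel. F' x b) = 0"
proof -
  have F'0: "F' x b = 0" if "x \<notin> K" for x
    using has_derivative_unique[OF der derivative_zero_off_support[OF K supp that]] by simp
  have contF: "continuous_on UNIV F"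
    using der has_derivative_continuous continuous_at_imp_continuous_on by blast
  show "integrable lborel (\<lambda>x. F' x b)" using integrable_compact_support[OF cont K] F'0 by blast
  have "bounded ((\<lambda>x. F' x b) ` K)"
    using K cont by (meson compact_continuous_image compact_imp_bounded continuous_on_subset subset_UNIV)
  then obtain M where M0: "\<And>x. x \<in> K \<Longrightarrow> \<bar>F' x b\<bar> \<le> M" by (auto simp: bounded_iff)
  define M' where "M' = max 0 M"
  have M: "\<bar>F' x b\<bar> \<le> M'" for x
    using M0[of x] F'0[of x] unfolding M'_def by (cases "x \<in> K") auto
  \<comment> \<open>\<open>K'\<close> contains every point from which a step of length at most
    \<open>norm b\<close> can reach \<open>K\<close>, so outside it all difference quotients with
    step size at most 1 vanish.\<close>
  define K' where "K' = {x - y | x y. x \<in> K \<and> y \<in> cball 0 (norm b)}"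
  have K': "compact K'" unfolding K'_def by (rule compact_differences[OF K compact_cball])
  define q where "q n x = (F (x + inverse (real (Suc n)) *\<^sub>R b) - F x) * real (Suc n)" for n x
  have q_bound: "\<bar>q n x\<bar> \<le> M' * indicator K' x" for n x
  proof -
    let ?e = "inverse (real (Suc n))"
    have e: "0 < ?e" "?e \<le> 1" by (auto simp: field_simps)
    show ?thesis
    proof (cases "x \<in> K'")
      case True
      have d: "((\<lambda>t. F (x + t *\<^sub>R b)) has_real_derivative F' (x + t *\<^sub>R b) b) (at t)" for t
        by (rule has_real_derivative_along_line[OF der])
      obtain \<xi> where "F (x + ?e *\<^sub>R b) - F (x + 0 *\<^sub>R b) = (?e - 0) * F' (x + \<xi> *\<^sub>R b) b"
        using MVT2[OF e(1), of "\<lambda>t. F (x + t *\<^sub>R b)" "\<lambda>t. F' (x + t *\<^sub>R b) b"] d by blast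
      then have "q n x = F' (x + \<xi> *\<^sub>R b) b" unfolding q_def by (simp add: field_simps)
      then show ?thesis using M True by simp
    next
      case False
      have "y \<in> cball 0 (norm b) \<Longrightarrow> x + y \<notin> K" for y
        using False unfolding K'_def by force
      from this[of "?e *\<^sub>R b"] this[of 0] have "x + ?e *\<^sub>R b \<notin> K" "x \<notin> K"
        using e by (auto simp: mult_left_le_one_le field_simps)
      then show ?thesis using False supp by (simp add: q_def)
    qed
  qed
  have q_lim: "(\<lambda>n. q n x) \<longlonglongrightarrow> F' x b" for x
  proof -
    have "((\<lambda>t. F (x + t *\<^sub>R b)) has_real_derivative F' x b) (at 0)"
      using has_real_derivative_along_line[of F "F' x" x 0 b] der by simp
    then have "((\<lambda>h. (F (x + h *\<^sub>R b) - F x) / h) \<longlongrightarrow> F' x b) (at 0)"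
      by (simp add: DERIV_def)
    moreover have "filterlim (\<lambda>n. inverse (real (Suc n))) (at 0) sequentially"
      using LIMSEQ_inverse_real_of_nat by (intro filterlim_atI) auto
    ultimately have "((\<lambda>n. (F (x + inverse (real (Suc n)) *\<^sub>R b) - F x) / inverse (real (Suc n))) \<longlongrightarrow> F' x b) sequentially"
      by (rule filterlim_compose)
    then show ?thesis unfolding q_def by (simp add: divide_inverse)
  qed
  have Fint: "integrable lborel F" using integrable_compact_support[OF contF K supp] .
  have shift: "has_bochner_integral lborel (\<lambda>x. F (x + c)) (LINT x|lborel. F x)" for c
  proof -
    have d: "lborel = distr lborel borel ((+) c)" by (simp add: lborel_distr_plus)
    have "integrable (distr lborel borel ((+) c)) F" using Fint d by metis
    then have "integrable lborel (\<lambda>x. F (c + x))"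
      using borel_measurable_continuous_onI[OF contF] by (subst (asm) integrable_distr_eq) auto
    moreover have "(LINT x|lborel. F (c + x)) = (LINT x|lborel. F x)"
    proof -
      have "(LINT x|distr lborel borel ((+) c). F x) = (LINT x|lborel. F (c + x))"
        using borel_measurable_continuous_onI[OF contF] by (intro integral_distr) auto
      then show ?thesis using d by metis
    qed
    ultimately show ?thesis by (simp add: has_bochner_integral_iff add.commute)
  qed
  have q_int: "(LINT x|lborel. q n x) = 0" for n
    unfolding q_def using shift[of "inverse (real (Suc n)) *\<^sub>R b"] shift[of 0]
    by (simp add: has_bochner_integral_iff)
  have "(\<lambda>n. LINT x|lborel. q n x) \<longlonglongrightarrow> (LINT x|lborel. F' x b)"
  proof (rule integral_dominated_convergence[where w = "\<lambda>x. M' * indicator K' x"])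
    show "(\<lambda>x. F' x b) \<in> borel_measurable lborel"
      using cont borel_measurable_continuous_onI by simp
    show "q n \<in> borel_measurable lborel" for n
      unfolding q_def using shift[of "inverse (real (Suc n)) *\<^sub>R b"] shift[of 0]
      by (auto simp: has_bochner_integral_iff intro!: borel_measurable_times borel_measurable_diff)
    show "integrable lborel (\<lambda>x. M' * indicator K' x)"
      using K' by (intro integrable_mult_right integrable_real_indicator)
        (use emeasure_bounded_finite[OF compact_imp_bounded[OF K']] in \<open>auto simp: borel_compact\<close>)
    show "AE x in lborel. (\<lambda>n. q n x) \<longlonglongrightarrow> F' x b" using q_lim by simp
    show "AE x in lborel. norm (q n x) \<le> M' * indicator K' x" for n using q_bound by simp
  qed
  then have "(\<lambda>n. 0) \<longlonglongrightarrow> (LINT x|lborel. F' x b)" by (simp add: q_int)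
  then show "(LINT x|lborel. F' x b) = 0" by (simp add: LIMSEQ_const_iff)
qed

text \<open>Differentiability is asked only on an open \<open>U\<close> around the support, which
  admits weights singular at the origin. Off \<open>K\<close> the derivative is 0, and continuity is
  glued over the open cover by \<open>U\<close> and the complement of \<open>K\<close>.\<close>

lemma divergence_theorem_compact_support:
  fixes X :: "'a::euclidean_space \<Rightarrow> 'a"
  assumes "open U" "compact K" "K \<subseteq> U"
    and der: "\<And>x. x \<in> U \<Longrightarrow> (X has_derivative X' x) (at x)"
    and cont: "\<And>b. b \<in> Basis \<Longrightarrow> continuous_on U (\<lambda>x. X' x b)"
    and supp: "\<And>x. x \<notin> K \<Longrightarrow> X x = 0"
    and d: "\<And>x. x \<in> K \<Longrightarrow> d x = (\<Sum>b\<in>Basis. X' x b \<bullet> b)" "\<And>x. x \<notin> K \<Longrightarrow> d x = 0"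
  shows "integrable lborel d" "(LINT x|lborel. d x) = 0"
proof -
  define Z where "Z x = (if x \<in> K then X' x else (\<lambda>h. 0))" for x
  have derZ: "(X has_derivative Z x) (at x)" for x
    using der[of x] derivative_zero_off_support[OF assms(2) supp] assms(3) by (auto simp: Z_def)
  have ZU: "Z x = X' x" if "x \<in> U" for x
    using has_derivative_unique[OF derZ der[OF that]] .
  have contZ: "continuous_on UNIV (\<lambda>x. Z x b)" if "b \<in> Basis" for b
  proof -
    have "open (- K)" using assms(2) compact_imp_closed by blast
    moreover have "continuous_on U (\<lambda>x. Z x b)"
      using cont[OF that] ZU by (simp cong: continuous_on_cong)
    moreover have "continuous_on (-K) (\<lambda>x. Z x b)"
      by (rule continuous_on_eq[OF continuous_on_const[of _ 0]]) (auto simp: Z_def)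
    ultimately have "continuous_on (U \<union> - K) (\<lambda>x. Z x b)"
      using assms(1) by (intro continuous_on_open_Un)
    moreover have "U \<union> - K = UNIV" using assms(3) by auto
    ultimately show ?thesis by simp
  qed
  have deq: "d = (\<lambda>x. \<Sum>b\<in>Basis. Z x b \<bullet> b)"
    using d by (auto simp: Z_def fun_eq_iff)
  have *: "integrable lborel (\<lambda>x. Z x b \<bullet> b)" "(LINT x|lborel. Z x b \<bullet> b) = 0" if b: "b \<in> Basis" for b
  proof -
    have d: "((\<lambda>x. X x \<bullet> b) has_derivative (\<lambda>h. Z x h \<bullet> b)) (at x)" for x
      by (rule has_derivative_inner_left[OF derZ])
    have c: "continuous_on UNIV (\<lambda>x. Z x b \<bullet> b)" using contZ[OF b] by (intro continuous_intros)
    show "integrable lborel (\<lambda>x. Z x b \<bullet> b)" "(LINT x|lborel. Z x b \<bullet> b) = 0"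
      using integral_directional_derivative_eq_0[OF d c assms(2)] supp by auto
  qed
  show "integrable lborel d" "(LINT x|lborel. d x) = 0"
    unfolding deq using * by (auto simp: Bochner_Integration.integral_sum)
qed

text \<open>The second difference over a small parallelogram is symmetric in the two directions. Two
  applications of the mean value theorem, in either order, express it through \<open>D2\<close> at
  nearby points, and continuity of \<open>D2\<close> passes to the limit.\<close>

lemma symmetric_second_derivative:
  fixes \<phi> :: "'a::euclidean_space \<Rightarrow> real"
  assumes D: "\<And>x. (\<phi> has_derivative blinfun_apply (D x)) (at x)"
    and D2: "\<And>x. (D has_derivative blinfun_apply (D2 x)) (at x)"
    and cont: "continuous_on UNIV D2"
  shows "D2 x h k = D2 x k h"
proof -
  have line: "((\<lambda>t. \<phi> (y + t *\<^sub>R e)) has_real_derivative D (y + t *\<^sub>R e) e) (at t)" for y e t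
    by (rule has_real_derivative_along_line[OF D])
  have line2: "((\<lambda>t. D (y + t *\<^sub>R e) f) has_real_derivative D2 (y + t *\<^sub>R e) e f) (at t)" for y e f t
  proof -
    have "((\<lambda>y. D y f) has_derivative (\<lambda>h. D2 (y + t *\<^sub>R e) h f)) (at (y + t *\<^sub>R e))"
      using D2 by (auto intro!: derivative_eq_intros simp: blinfun.zero_right)
    then show ?thesis by (rule has_real_derivative_along_line)
  qed
  have key: "\<exists>\<xi> \<eta>. 0 < \<xi> \<and> \<xi> < s \<and> 0 < \<eta> \<and> \<eta> < s \<and>
      \<phi> (x + s *\<^sub>R h + s *\<^sub>R k) - \<phi> (x + s *\<^sub>R h) - \<phi> (x + s *\<^sub>R k) + \<phi> x = s * s * D2 (x + \<xi> *\<^sub>R h + \<eta> *\<^sub>R k) k h"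
    if s: "s > 0" for s h k
  proof -
    let ?f = "\<lambda>t. \<phi> ((x + s *\<^sub>R k) + t *\<^sub>R h) - \<phi> (x + t *\<^sub>R h)"
    have "(?f has_real_derivative (D ((x + s *\<^sub>R k) + t *\<^sub>R h) h - D (x + t *\<^sub>R h) h)) (at t)" for t
      by (intro DERIV_diff line)
    then obtain \<xi> where \<xi>: "0 < \<xi>" "\<xi> < s"
      "?f s - ?f 0 = (s - 0) * (D ((x + s *\<^sub>R k) + \<xi> *\<^sub>R h) h - D (x + \<xi> *\<^sub>R h) h)"
      using MVT2[OF s, of ?f "\<lambda>t. D ((x + s *\<^sub>R k) + t *\<^sub>R h) h - D (x + t *\<^sub>R h) h"] by blast
    obtain \<eta> where \<eta>: "0 < \<eta>" "\<eta> < s"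
      "D ((x + \<xi> *\<^sub>R h) + s *\<^sub>R k) h - D ((x + \<xi> *\<^sub>R h) + 0 *\<^sub>R k) h = (s - 0) * D2 ((x + \<xi> *\<^sub>R h) + \<eta> *\<^sub>R k) k h"
      using MVT2[OF s, of "\<lambda>t. D ((x + \<xi> *\<^sub>R h) + t *\<^sub>R k) h" "\<lambda>t. D2 ((x + \<xi> *\<^sub>R h) + t *\<^sub>R k) k h"] line2 by blast
    show ?thesis
      using \<xi> \<eta> by (intro exI[of _ \<xi>] exI[of _ \<eta>]) (simp add: algebra_simps)
  qed
  let ?s = "\<lambda>n. inverse (real (Suc n))"
  have s0: "?s n > 0" for n by simp
  define Q where "Q h k n \<xi> \<eta> \<longleftrightarrow> 0 < \<xi> \<and> \<xi> < ?s n \<and> 0 < \<eta> \<and> \<eta> < ?s n \<and>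
      \<phi> (x + ?s n *\<^sub>R h + ?s n *\<^sub>R k) - \<phi> (x + ?s n *\<^sub>R h) - \<phi> (x + ?s n *\<^sub>R k) + \<phi> x
      = ?s n * ?s n * D2 (x + \<xi> *\<^sub>R h + \<eta> *\<^sub>R k) k h" for h k n \<xi> \<eta>
  have Q: "\<exists>\<xi> \<eta>. Q h k n \<xi> \<eta>" for h k n
    unfolding Q_def by (rule key[OF s0])
  obtain a b where ab0: "\<And>n. Q h k n (a n) (b n)" using Q[of h k] by metis
  obtain a' b' where ab0': "\<And>n. Q k h n (a' n) (b' n)" using Q[of k h] by metis
  note ab = ab0[unfolded Q_def] and ab' = ab0'[unfolded Q_def]
  have eq: "D2 (x + a n *\<^sub>R h + b n *\<^sub>R k) k h = D2 (x + a' n *\<^sub>R k + b' n *\<^sub>R h) h k" for n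
  proof -
    have "?s n * ?s n * D2 (x + a n *\<^sub>R h + b n *\<^sub>R k) k h = ?s n * ?s n * D2 (x + a' n *\<^sub>R k + b' n *\<^sub>R h) h k"
      using ab[of n] ab'[of n] by (simp add: algebra_simps)
    then show ?thesis using s0[of n] by (metis mult_cancel_left less_irrefl mult_eq_0_iff)
  qed
  have lim0: "c \<longlonglongrightarrow> 0" if "\<And>n. 0 < c n \<and> c n < ?s n" for c
    by (rule tendsto_sandwich[OF _ _ tendsto_const LIMSEQ_inverse_real_of_nat])
      (use that in \<open>auto intro!: always_eventually less_imp_le simp del: of_nat_Suc\<close>)
  have contx: "isCont (\<lambda>y. D2 y u w) x" for u w
    using cont by (auto simp: continuous_on_eq_continuous_at intro!: continuous_intros)
  have l1: "(\<lambda>n. D2 (x + a n *\<^sub>R h + b n *\<^sub>R k) k h) \<longlonglongrightarrow> D2 x k h"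
  proof (rule isCont_tendsto_compose[OF contx])
    have "(\<lambda>n. x + a n *\<^sub>R h + b n *\<^sub>R k) \<longlonglongrightarrow> x + 0 *\<^sub>R h + 0 *\<^sub>R k"
      using ab by (intro tendsto_intros lim0) auto
    then show "(\<lambda>n. x + a n *\<^sub>R h + b n *\<^sub>R k) \<longlonglongrightarrow> x" by simp
  qed
  have l2: "(\<lambda>n. D2 (x + a' n *\<^sub>R k + b' n *\<^sub>R h) h k) \<longlonglongrightarrow> D2 x h k"
  proof (rule isCont_tendsto_compose[OF contx])
    have "(\<lambda>n. x + a' n *\<^sub>R k + b' n *\<^sub>R h) \<longlonglongrightarrow> x + 0 *\<^sub>R k + 0 *\<^sub>R h"
      using ab' by (intro tendsto_intros lim0) auto
    then show "(\<lambda>n. x + a' n *\<^sub>R k + b' n *\<^sub>R h) \<longlonglongrightarrow> x" by simp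
  qed
  show ?thesis using LIMSEQ_unique[OF l1] l2 eq by simp
qed

text \<open>Trades the operator-valued derivatives of \<open>C2\<close> for a gradient vector and a
  Hessian map. The symmetry of \<open>H\<close> is what later turns the derivatives of x . g and g .
  g into gradients.\<close>

lemma C2_gradient_hessian:
  fixes \<phi> :: "'a::euclidean_space \<Rightarrow> real"
  assumes "C2 \<phi>"
  obtains g H where "\<And>x. (\<phi> has_derivative (\<lambda>h. g x \<bullet> h)) (at x)"
    "\<And>x. (g has_derivative H x) (at x)" "\<And>h. continuous_on UNIV (\<lambda>x. H x h)"
    "\<And>x h k. H x h \<bullet> k = H x k \<bullet> h" "\<And>x. laplacian \<phi> x = (\<Sum>b\<in>Basis. H x b \<bullet> b)"
proof -
  obtain D D2 where D: "\<And>x. (\<phi> has_derivative blinfun_apply (D x)) (at x)"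
    and D2: "\<And>x. (D has_derivative blinfun_apply (D2 x)) (at x)" and c: "continuous_on UNIV D2"
    using assms unfolding C2_def by blast
  define g where "g x = (\<Sum>b\<in>Basis. D x b *\<^sub>R b)" for x
  define H where "H x h = (\<Sum>b\<in>Basis. D2 x h b *\<^sub>R b)" for x h
  have blin: "(\<Sum>b\<in>Basis. f b *\<^sub>R b) \<bullet> h = f h" for f :: "'a \<Rightarrow>\<^sub>L real" and h
  proof -
    have "f h = f (\<Sum>b\<in>Basis. (h \<bullet> b) *\<^sub>R b)" by (simp add: euclidean_representation)
    also have "\<dots> = (\<Sum>b\<in>Basis. (h \<bullet> b) * f b)" by (simp add: blinfun.sum_right blinfun.scaleR_right)
    finally show ?thesis by (simp add: inner_sum_left inner_commute[of h] mult.commute)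
  qed
  show ?thesis
  proof (rule that[of g H])
    show "(\<phi> has_derivative (\<lambda>h. g x \<bullet> h)) (at x)" for x
      using D[of x] by (simp add: g_def blin)
    have *: "((\<lambda>y. D y b) has_derivative (\<lambda>h. D2 x h b)) (at x)" for x b
      using D2 by (auto intro!: derivative_eq_intros simp: blinfun.zero_right)
    show "(g has_derivative H x) (at x)" for x
      unfolding g_def H_def by (intro has_derivative_sum has_derivative_scaleR_left *)
    show "continuous_on UNIV (\<lambda>x. H x h)" for h
      unfolding H_def using c by (intro continuous_intros)
    show "H x h \<bullet> k = H x k \<bullet> h" for x h k
      unfolding H_def blin using symmetric_second_derivative[OF D D2 c] .
    show "laplacian \<phi> x = (\<Sum>b\<in>Basis. H x b \<bullet> b)" for x
    proof -
      have 1: "deriv (\<lambda>s. \<phi> (x + s *\<^sub>R b)) = (\<lambda>t. D (x + t *\<^sub>R b) b)" for b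
        by (rule ext, rule DERIV_imp_deriv, rule has_real_derivative_along_line[OF D])
      have 2: "deriv (\<lambda>t. D (x + t *\<^sub>R b) b) 0 = D2 x b b" for b
        using has_real_derivative_along_line[of "\<lambda>y. D y b" "\<lambda>h. D2 x h b" x 0 b] *[of b x]
        by (simp add: DERIV_imp_deriv)
      show ?thesis
        unfolding laplacian_def 1 2 H_def blin ..
    qed
  qed
qed

text \<open>\<open>d\<close> is the divergence of the field a g + e x; both Rellich inequalities are
  pointwise estimates modulo such a divergence.\<close>

lemma integral_div_eq_0:
  fixes g :: "'a::euclidean_space \<Rightarrow> 'a" and a e :: "'a \<Rightarrow> real"
  assumes U: "open U" "compact K" "K \<subseteq> U"
    and g: "\<And>x. (g has_derivative H x) (at x)" "\<And>h. continuous_on UNIV (\<lambda>x. H x h)"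
    and a: "\<And>x. x \<in> U \<Longrightarrow> (a has_derivative (\<lambda>h. ga x \<bullet> h)) (at x)" "continuous_on U ga"
    and e: "\<And>x. x \<in> U \<Longrightarrow> (e has_derivative (\<lambda>h. ge x \<bullet> h)) (at x)" "continuous_on U ge"
    and supp: "\<And>x. x \<notin> K \<Longrightarrow> a x = 0" "\<And>x. x \<notin> K \<Longrightarrow> e x = 0"
    and d: "\<And>x. x \<in> K \<Longrightarrow>
      d x = a x * (\<Sum>b\<in>Basis. H x b \<bullet> b) + ga x \<bullet> g x + e x * DIM('a) + ge x \<bullet> x"
      "\<And>x. x \<notin> K \<Longrightarrow> d x = 0"
  shows "integrable lborel d" "(LINT x|lborel. d x) = 0"
proof -
  let ?X = "\<lambda>x. a x *\<^sub>R g x + e x *\<^sub>R x"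
  let ?X' = "\<lambda>x h. a x *\<^sub>R H x h + (ga x \<bullet> h) *\<^sub>R g x + (e x *\<^sub>R h + (ge x \<bullet> h) *\<^sub>R x)"
  have der: "(?X has_derivative ?X' x) (at x)" if "x \<in> U" for x
    using a(1)[OF that] e(1)[OF that] g(1)[of x]
    by (intro has_derivative_add has_derivative_scaleR has_derivative_ident)
  have contg: "continuous_on U g"
    by (intro continuous_at_imp_continuous_on ballI has_derivative_continuous[OF g(1)])
  have contH: "continuous_on U (\<lambda>x. H x h)" for h using g(2) continuous_on_subset by blast
  have ca: "continuous_on U a"
    by (intro continuous_at_imp_continuous_on ballI has_derivative_continuous[OF a(1)])
  have ce: "continuous_on U e"
    by (intro continuous_at_imp_continuous_on ballI has_derivative_continuous[OF e(1)])
  have cont: "continuous_on U (\<lambda>x. ?X' x b)" for b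
    using ca ce a(2) e(2) contg contH by (intro continuous_intros) auto
  have sm: "(\<Sum>b\<in>Basis. (u \<bullet> b) * (w \<bullet> b)) = u \<bullet> w" for u w :: 'a
    using euclidean_inner[of u w] by simp
  have dd: "d x = (\<Sum>b\<in>Basis. ?X' x b \<bullet> b)" if "x \<in> K" for x
  proof -
    have "(\<Sum>b\<in>Basis. ?X' x b \<bullet> b) = (\<Sum>b\<in>Basis. a x * (H x b \<bullet> b) + (ga x \<bullet> b) * (g x \<bullet> b)
        + (e x + (ge x \<bullet> b) * (x \<bullet> b)))"
      by (intro sum.cong) (auto simp: inner_add_left)
    also have "\<dots> = d x"
      unfolding d(1)[OF that] by (simp add: sum.distrib sum_distrib_left sm)
    finally show ?thesis by (rule sym)
  qed
  have s: "?X x = 0" if "x \<notin> K" for x using supp that by simp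
  show "integrable lborel d" "(LINT x|lborel. d x) = 0"
    by (rule divergence_theorem_compact_support[OF U der cont s dd d(2)]; assumption)+
qed

section \<open>Rellich inequalities\<close>


lemma has_gradient_mult:
  fixes f k :: "'a::real_inner \<Rightarrow> real"
  assumes "(f has_derivative (\<lambda>h. gf \<bullet> h)) (at x)" "(k has_derivative (\<lambda>h. gk \<bullet> h)) (at x)"
  shows "((\<lambda>x. f x * k x) has_derivative (\<lambda>h. (f x *\<^sub>R gk + k x *\<^sub>R gf) \<bullet> h)) (at x)"
  by (rule has_derivative_eq_rhs[OF has_derivative_mult[OF assms]])
    (auto simp: inner_add_left algebra_simps)

lemma has_gradient_add:
  fixes f k :: "'a::real_inner \<Rightarrow> real"
  assumes "(f has_derivative (\<lambda>h. gf \<bullet> h)) (at x)" "(k has_derivative (\<lambda>h. gk \<bullet> h)) (at x)"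
  shows "((\<lambda>x. f x + k x) has_derivative (\<lambda>h. (gf + gk) \<bullet> h)) (at x)"
  by (rule has_derivative_eq_rhs[OF has_derivative_add[OF assms]]) (auto simp: inner_add_left)

lemma has_gradient_cmult:
  fixes f :: "'a::real_inner \<Rightarrow> real"
  assumes "(f has_derivative (\<lambda>h. gf \<bullet> h)) (at x)"
  shows "((\<lambda>x. c * f x) has_derivative (\<lambda>h. (c *\<^sub>R gf) \<bullet> h)) (at x)"
  by (rule has_derivative_eq_rhs[OF has_derivative_mult_right[OF assms]]) auto

lemma has_gradient_chain:
  fixes f :: "'a::real_inner \<Rightarrow> real"
  assumes "(f has_derivative (\<lambda>h. gf \<bullet> h)) (at x)" "(p has_real_derivative p') (at (f x))"
  shows "((\<lambda>x. p (f x)) has_derivative (\<lambda>h. (p' *\<^sub>R gf) \<bullet> h)) (at x)"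
proof -
  have "((\<lambda>x. p (f x)) has_derivative (\<lambda>h. (gf \<bullet> h) * p')) (at x)"
    using has_derivative_compose[OF assms(1) assms(2)[unfolded has_field_derivative_def]]
    by (simp add: mult.commute)
  then show ?thesis by (rule has_derivative_eq_rhs) (auto simp: mult.commute)
qed

lemma has_gradient_norm_sq:
  "((\<lambda>x. x \<bullet> x) has_derivative (\<lambda>h. (2 *\<^sub>R x) \<bullet> h)) (at (x::'a::real_inner))"
  by (auto intro!: derivative_eq_intros simp: inner_commute)

lemma laplacian_sq_integrable:
  fixes \<phi> :: "'a::euclidean_space \<Rightarrow> real"
  assumes "C2 \<phi>" "compact (closure {x. \<phi> x \<noteq> 0})"
  shows "continuous_on UNIV (laplacian \<phi>)" "x \<notin> closure {x. \<phi> x \<noteq> 0} \<Longrightarrow> laplacian \<phi> x = 0"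
    "integrable lborel (\<lambda>x. (laplacian \<phi> x)\<^sup>2)"
proof -
  obtain g H where g: "\<And>x. (\<phi> has_derivative (\<lambda>h. g x \<bullet> h)) (at x)"
    "\<And>x. (g has_derivative H x) (at x)" "\<And>h. continuous_on UNIV (\<lambda>x. H x h)"
    "\<And>x h k. H x h \<bullet> k = H x k \<bullet> h" "\<And>x. laplacian \<phi> x = (\<Sum>b\<in>Basis. H x b \<bullet> b)"
    using C2_gradient_hessian[OF assms(1)] by blast
  let ?K = "closure {x. \<phi> x \<noteq> 0}"
  have p0: "\<phi> x = 0" if "x \<notin> ?K" for x using that closure_subset[of "{x. \<phi> x \<noteq> 0}"] by auto
  have g0: "g x = 0" if "x \<notin> ?K" for x
    using has_derivative_unique[OF g(1) derivative_zero_off_support[OF assms(2) p0 that]]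
    by (metis inner_eq_zero_iff)
  have H0: "H x = (\<lambda>h. 0)" if "x \<notin> ?K" for x
    using has_derivative_unique[OF g(2) derivative_zero_off_support[OF assms(2) g0 that]] .
  show c: "continuous_on UNIV (laplacian \<phi>)"
    unfolding g(5)[abs_def] by (intro continuous_intros g(3))
  show z: "x \<notin> ?K \<Longrightarrow> laplacian \<phi> x = 0" for x using H0 g(5) by simp
  show "integrable lborel (\<lambda>x. (laplacian \<phi> x)\<^sup>2)"
    by (rule integrable_compact_support[OF _ assms(2)]) (auto intro!: continuous_intros c z)
qed

text \<open>The difference of the two sides is controlled by two squares, (L + c f i)^2 and i |g + k
  f i x|^2. For i = 1/|x|^2 both vanish on f = |x|^(-k), which is where \<open>k\<close> and
  \<open>c\<close> come from. The proof uses \<open>i\<close> only through i |x|^2 at most 1, so a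
  regularised weight is allowed.\<close>

lemma rellich_pointwise:
  fixes x g :: "'a::real_inner" and f i L k c n :: real
  assumes i: "i \<ge> 0" "i * (x \<bullet> x) \<le> 1" and k: "k \<ge> 0" "n = 2 * k + 4" "c = k * (k + 2)"
  shows "c\<^sup>2 * f\<^sup>2 * i\<^sup>2 \<le> L\<^sup>2 + 2 * c *
    (f * i * L + (i *\<^sub>R g - (2 * f * i\<^sup>2) *\<^sub>R x) \<bullet> g + (k + 1) * (f * i)\<^sup>2 * n
      + ((2 * (k + 1) * (f * i)) *\<^sub>R (i *\<^sub>R g - (2 * f * i\<^sup>2) *\<^sub>R x)) \<bullet> x)"
proof -
  define G P q where "G = g \<bullet> g" and "P = x \<bullet> g" and "q = x \<bullet> x"
  have "0 \<le> (g + (k * f * i) *\<^sub>R x) \<bullet> (g + (k * f * i) *\<^sub>R x)" by simp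
  also have "\<dots> = G + 2 * (k * f * i) * P + (k * f * i)\<^sup>2 * q"
    unfolding G_def P_def q_def
    by (simp add: inner_add_left inner_add_right inner_commute power2_eq_square algebra_simps)
  finally have "0 \<le> i * (G + 2 * (k * f * i) * P + (k * f * i)\<^sup>2 * q)" using i by simp
  then have 1: "i * G + 2 * k * f * i\<^sup>2 * P \<ge> - (k\<^sup>2 * f\<^sup>2 * i\<^sup>2 * (i * q))"
    by (simp add: algebra_simps power2_eq_square)
  have 2: "f\<^sup>2 * i\<^sup>2 * c \<le> f\<^sup>2 * i\<^sup>2 * ((k + 1) * (n - 4 * (i * q)) - k\<^sup>2 * (i * q))"
  proof (rule mult_left_mono)
    have "(4 * (k + 1) + k\<^sup>2) * (i * q) \<le> 4 * (k + 1) + k\<^sup>2"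
      using i k unfolding q_def by (intro mult_left_le) auto
    then show "c \<le> (k + 1) * (n - 4 * (i * q)) - k\<^sup>2 * (i * q)"
      unfolding k by (simp add: algebra_simps power2_eq_square)
  qed simp
  let ?R = "i * G - 2 * f * i\<^sup>2 * P + (k + 1) * (f * i)\<^sup>2 * n
      + 2 * (k + 1) * (f * i) * (i * P - 2 * f * i\<^sup>2 * q)"
  have R: "?R = (i * G + 2 * k * f * i\<^sup>2 * P) + f\<^sup>2 * i\<^sup>2 * ((k + 1) * (n - 4 * (i * q)))"
    by (simp add: algebra_simps power2_eq_square)
  have "f\<^sup>2 * i\<^sup>2 * c \<le> ?R" unfolding R using 1 2 by (simp add: algebra_simps)
  moreover have "c \<ge> 0" using k by simp
  ultimately have 3: "2 * c * (f\<^sup>2 * i\<^sup>2 * c) \<le> 2 * c * ?R" by (intro mult_left_mono) auto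
  have 4: "L\<^sup>2 + 2 * c * (f * i * L) + c\<^sup>2 * f\<^sup>2 * i\<^sup>2 \<ge> 0"
    using zero_le_power2[of "L + c * f * i"] by (simp add: power2_eq_square algebra_simps)
  have E: "f * i * L + (i *\<^sub>R g - (2 * f * i\<^sup>2) *\<^sub>R x) \<bullet> g + (k + 1) * (f * i)\<^sup>2 * n
      + ((2 * (k + 1) * (f * i)) *\<^sub>R (i *\<^sub>R g - (2 * f * i\<^sup>2) *\<^sub>R x)) \<bullet> x = f * i * L + ?R"
    unfolding G_def P_def q_def by (simp add: inner_diff_left inner_diff_right inner_commute)
  show ?thesis unfolding E using 3 4 by (simp add: algebra_simps power2_eq_square)
qed

text \<open>For positive \<open>\<epsilon>\<close> the weight is smooth at the origin, so the field
  needs no cutoff there and its divergence integrates to 0. The bound does not depend on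
  \<open>\<epsilon>\<close>.\<close>

lemma rellich_regularized:
  fixes \<phi> :: "'a::euclidean_space \<Rightarrow> real"
  assumes C2: "C2 \<phi>" and K: "compact (closure {x. \<phi> x \<noteq> 0})" and N: "DIM('a) \<ge> 4" and \<epsilon>: "\<epsilon> > 0"
    and c: "c = real DIM('a) * (real DIM('a) - 4) / 4"
  shows "integrable lborel (\<lambda>x. c\<^sup>2 * (\<phi> x)\<^sup>2 / (x \<bullet> x + \<epsilon>)\<^sup>2)"
    "(LINT x|lborel. c\<^sup>2 * (\<phi> x)\<^sup>2 / (x \<bullet> x + \<epsilon>)\<^sup>2) \<le> (LINT x|lborel. (laplacian \<phi> x)\<^sup>2)"
proof -
  obtain g H where g: "\<And>x. (\<phi> has_derivative (\<lambda>h. g x \<bullet> h)) (at x)"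
    "\<And>x. (g has_derivative H x) (at x)" "\<And>h. continuous_on UNIV (\<lambda>x. H x h)"
    "\<And>x h k. H x h \<bullet> k = H x k \<bullet> h" "\<And>x. laplacian \<phi> x = (\<Sum>b\<in>Basis. H x b \<bullet> b)"
    using C2_gradient_hessian[OF C2] by blast
  define k where "k = (real DIM('a) - 4) / 2"
  have k: "k \<ge> 0" "real DIM('a) = 2 * k + 4" "c = k * (k + 2)"
    using N by (auto simp: k_def c field_simps)
  let ?K = "closure {x. \<phi> x \<noteq> 0}"
  have p0: "\<phi> x = 0" if "x \<notin> ?K" for x using that closure_subset[of "{x. \<phi> x \<noteq> 0}"] by auto
  define i where "i x = inverse (x \<bullet> x + \<epsilon>)" for x :: 'a
  have s0: "x \<bullet> x + \<epsilon> > 0" for x :: 'a using \<epsilon> by (simp add: add_nonneg_pos)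
  have i: "i x > 0" "i x * (x \<bullet> x) \<le> 1" for x
    using s0[of x] \<epsilon> by (auto simp: i_def field_simps)
  have di: "(i has_derivative (\<lambda>h. (- 2 * (i x)\<^sup>2) *\<^sub>R x \<bullet> h)) (at x)" for x
  proof -
    have "((\<lambda>t. inverse (t + \<epsilon>)) has_real_derivative - (i x)\<^sup>2) (at (x \<bullet> x))"
      using s0[of x] by (auto intro!: derivative_eq_intros simp: i_def power2_eq_square divide_inverse)
    from has_gradient_chain[OF has_gradient_norm_sq this]
    show ?thesis by (simp add: i_def[abs_def] mult.commute)
  qed
  have ci: "continuous_on UNIV i" using di by (intro continuous_at_imp_continuous_on ballI has_derivative_continuous)
  have cp: "continuous_on UNIV \<phi>" using g(1) by (intro continuous_at_imp_continuous_on ballI has_derivative_continuous)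
  have cg: "continuous_on UNIV g" using g(2) by (intro continuous_at_imp_continuous_on ballI has_derivative_continuous)
  define a where "a x = \<phi> x * i x" for x
  define ga where "ga x = i x *\<^sub>R g x - (2 * \<phi> x * (i x)\<^sup>2) *\<^sub>R x" for x
  have da: "(a has_derivative (\<lambda>h. ga x \<bullet> h)) (at x)" for x
    using has_gradient_mult[OF g(1) di, of x] by (simp add: a_def[abs_def] ga_def algebra_simps)
  have ca: "continuous_on UNIV a" "continuous_on UNIV ga"
    unfolding a_def ga_def by (intro continuous_intros ci cp cg)+
  define e where "e x = (k + 1) * (a x)\<^sup>2" for x
  have de: "(e has_derivative (\<lambda>h. ((2 * (k + 1) * a x) *\<^sub>R ga x) \<bullet> h)) (at x)" for x
    using has_gradient_cmult[OF has_gradient_mult[OF da da], of "k + 1" x]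
    by (simp add: e_def[abs_def] power2_eq_square algebra_simps inner_add_left)
  define d where "d x = a x * (\<Sum>b\<in>Basis. H x b \<bullet> b) + ga x \<bullet> g x + e x * DIM('a) + ((2 * (k + 1) * a x) *\<^sub>R ga x) \<bullet> x" for x
  have g0: "g x = 0" if "x \<notin> ?K" for x
    using has_derivative_unique[OF g(1) derivative_zero_off_support[OF K p0 that]]
    by (metis inner_eq_zero_iff)
  have d0: "d x = 0" if "x \<notin> ?K" for x
    using p0[OF that] g0[OF that] by (simp add: d_def a_def e_def)
  have ce: "continuous_on UNIV e" "continuous_on UNIV (\<lambda>x. (2 * (k + 1) * a x) *\<^sub>R ga x)"
    unfolding e_def by (intro continuous_intros ca)+
  have supp: "a x = 0" "e x = 0" if "x \<notin> ?K" for x using p0[OF that] by (auto simp: a_def e_def)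
  have int_d: "integrable lborel d" "(LINT x|lborel. d x) = 0"
    by (rule integral_div_eq_0[OF open_UNIV K subset_UNIV g(2,3) da ca(2) de ce(2) supp d_def d0]; assumption)+
  let ?f = "\<lambda>x. c\<^sup>2 * (\<phi> x)\<^sup>2 / (x \<bullet> x + \<epsilon>)\<^sup>2"
  have fi: "?f x = c\<^sup>2 * (\<phi> x)\<^sup>2 * (i x)\<^sup>2" for x by (simp add: i_def field_simps)
  show int_f: "integrable lborel ?f"
    unfolding fi by (rule integrable_compact_support[OF _ K]) (auto intro!: continuous_intros cp ci p0)
  have "?f x \<le> (laplacian \<phi> x)\<^sup>2 + 2 * c * d x" for x
    unfolding fi d_def g(5)[symmetric] e_def ga_def a_def
    using rellich_pointwise[of "i x" x k "real DIM('a)" c "\<phi> x" "laplacian \<phi> x" "g x"] i[of x] k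
    by (simp add: mult.assoc)
  then have "(LINT x|lborel. ?f x) \<le> (LINT x|lborel. (laplacian \<phi> x)\<^sup>2 + 2 * c * d x)"
    using int_f int_d laplacian_sq_integrable(3)[OF C2 K] by (intro integral_mono) auto
  also have "\<dots> = (LINT x|lborel. (laplacian \<phi> x)\<^sup>2)"
    using int_d laplacian_sq_integrable(3)[OF C2 K] by simp
  finally show "(LINT x|lborel. ?f x) \<le> (LINT x|lborel. (laplacian \<phi> x)\<^sup>2)" .
qed


section \<open>The weighted Rellich inequality outside the unit ball\<close>

text \<open>The multiplier \<open>M\<close> is the radial derivative of r^k f up to a power of r.
  Symmetry of the Hessian cancels the second order terms of the divergence, and the factor -1/2 in
  \<open>e\<close> cancels |g|^2. What remains is quadratic in \<open>L\<close>, \<open>M\<close>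
  and \<open>f\<close>, and two squares are completed. The leftover 2 \<tau> - \<tau>^2 is at least
  \<tau> because \<tau> is at most 1. No sign of \<open>k\<close> is needed, hence no restriction on
  the dimension.\<close>

lemma exterior_rellich_pointwise:
  fixes x g Hx Hg :: "'a::real_inner" and f J \<tau> L k \<epsilon> n :: real
  assumes sym: "Hx \<bullet> g = Hg \<bullet> x" and J: "J * (x \<bullet> x) = 1" and \<tau>: "0 \<le> \<tau>" "\<tau> \<le> 1" and n: "n = 2 * k + 4"
    and M: "M = x \<bullet> g + k * f"
    and \<psi>: "\<psi> = J\<^sup>2 * (\<epsilon> / 2 * \<tau> - k)" "\<psi>' = J^3 * (2 * k - \<epsilon> / 2 * (2 + \<epsilon> / 2) * \<tau>)"
    and ga: "ga = M *\<^sub>R ((- 2 * J\<^sup>2) *\<^sub>R x) + J *\<^sub>R (g + Hx + k *\<^sub>R g)"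
    and e: "e = (- 1 / 2) * ((g \<bullet> g) * J) + f\<^sup>2 * \<psi>"
    and ge: "ge = (- 1 / 2) *\<^sub>R ((g \<bullet> g) *\<^sub>R ((- 2 * J\<^sup>2) *\<^sub>R x) + J *\<^sub>R (2 *\<^sub>R Hg))
      + (f\<^sup>2 *\<^sub>R ((2 * \<psi>') *\<^sub>R x) + \<psi> *\<^sub>R ((2 * f) *\<^sub>R g))"
  shows "\<epsilon>\<^sup>2 * (J\<^sup>2 * \<tau>) * f\<^sup>2 \<le> L\<^sup>2 - 4 * (M * J * L + ga \<bullet> g + e * n + ge \<bullet> x)"
proof -
  define G P q C where "G = g \<bullet> g" and "P = x \<bullet> g" and "q = x \<bullet> x" and "C = Hg \<bullet> x"
  have Jq: "J * q = 1" using J by (simp add: q_def)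
  have gag: "ga \<bullet> g = - 2 * M * J\<^sup>2 * P + J * ((1 + k) * G + C)"
    unfolding ga G_def P_def C_def by (simp add: inner_add_left sym algebra_simps)
  have gex: "ge \<bullet> x = G * J\<^sup>2 * q - J * C + 2 * f\<^sup>2 * \<psi>' * q + 2 * f * \<psi> * P"
    unfolding ge G_def P_def C_def q_def by (simp add: inner_add_left inner_commute algebra_simps)
  have M': "M = P + k * f" by (simp add: M P_def)
  have J3: "J^3 * q = J\<^sup>2" "J\<^sup>2 * q = J" using Jq by (simp_all add: power3_eq_cube power2_eq_square mult.assoc)
  have p': "\<psi>' * q = J\<^sup>2 * (2 * k - \<epsilon> / 2 * (2 + \<epsilon> / 2) * \<tau>)"
    unfolding \<psi>(2) using J3(1) by (simp add: algebra_simps)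
  have "ga \<bullet> g + e * n + ge \<bullet> x = - 2 * M * J\<^sup>2 * P + J * ((1 + k) * G + C) + ((- 1 / 2) * (G * J) + f\<^sup>2 * \<psi>) * n
     + (G * (J\<^sup>2 * q) - J * C + 2 * f\<^sup>2 * (\<psi>' * q) + 2 * f * \<psi> * P)"
    unfolding gag gex e G_def by (simp add: algebra_simps)
  also have "\<dots> = J\<^sup>2 * (- 2 * M\<^sup>2 + \<epsilon> * \<tau> * f * M - \<epsilon>\<^sup>2 / 2 * \<tau> * f\<^sup>2)"
    unfolding p' J3 \<psi>(1) n M' by (simp add: algebra_simps power2_eq_square)
  finally have d: "ga \<bullet> g + e * n + ge \<bullet> x = J\<^sup>2 * (- 2 * M\<^sup>2 + \<epsilon> * \<tau> * f * M - \<epsilon>\<^sup>2 / 2 * \<tau> * f\<^sup>2)" .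
  have "\<epsilon>\<^sup>2 * \<tau> * f\<^sup>2 * (1 - \<tau>) \<ge> 0" using \<tau> by (intro mult_nonneg_nonneg) auto
  then have t: "\<epsilon>\<^sup>2 * \<tau> * f\<^sup>2 \<le> (2 * M - \<epsilon> * \<tau> * f)\<^sup>2 - \<epsilon>\<^sup>2 * \<tau>\<^sup>2 * f\<^sup>2 + 2 * \<epsilon>\<^sup>2 * \<tau> * f\<^sup>2"
    using zero_le_power2[of "2 * M - \<epsilon> * \<tau> * f"] by (simp add: algebra_simps power2_eq_square)
  have "L\<^sup>2 - 4 * (M * J * L + (ga \<bullet> g + e * n + ge \<bullet> x))
     = (L - 2 * (J * M))\<^sup>2 + J\<^sup>2 * ((2 * M - \<epsilon> * \<tau> * f)\<^sup>2 - \<epsilon>\<^sup>2 * \<tau>\<^sup>2 * f\<^sup>2 + 2 * \<epsilon>\<^sup>2 * \<tau> * f\<^sup>2)"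
    unfolding d by (simp add: algebra_simps power2_eq_square)
  moreover have "J\<^sup>2 * (\<epsilon>\<^sup>2 * \<tau> * f\<^sup>2) \<le> J\<^sup>2 * ((2 * M - \<epsilon> * \<tau> * f)\<^sup>2 - \<epsilon>\<^sup>2 * \<tau>\<^sup>2 * f\<^sup>2 + 2 * \<epsilon>\<^sup>2 * \<tau> * f\<^sup>2)"
    using t by (intro mult_left_mono) auto
  ultimately have "J\<^sup>2 * (\<epsilon>\<^sup>2 * \<tau> * f\<^sup>2) \<le> L\<^sup>2 - 4 * (M * J * L + (ga \<bullet> g + e * n + ge \<bullet> x))"
    using zero_le_power2[of "L - 2 * (J * M)"] by linarith
  moreover have "\<epsilon>\<^sup>2 * (J\<^sup>2 * \<tau>) * f\<^sup>2 = J\<^sup>2 * (\<epsilon>\<^sup>2 * \<tau> * f\<^sup>2)" by simp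
  moreover have "M * J * L + ga \<bullet> g + e * n + ge \<bullet> x = M * J * L + (ga \<bullet> g + e * n + ge \<bullet> x)" by simp
  ultimately show ?thesis by metis
qed

lemma exterior_rellich:
  fixes \<phi> :: "'a::euclidean_space \<Rightarrow> real"
  assumes C2: "C2 \<phi>" and K: "compact (closure {x. \<phi> x \<noteq> 0})"
    and ext: "closure {x. \<phi> x \<noteq> 0} \<subseteq> {x. 1 < norm x}" and \<epsilon>: "\<epsilon> > 0"
  shows "integrable lborel (\<lambda>x. \<epsilon>\<^sup>2 * norm x powr (- 4 - \<epsilon>) * (\<phi> x)\<^sup>2)"
    "(LINT x|lborel. \<epsilon>\<^sup>2 * norm x powr (- 4 - \<epsilon>) * (\<phi> x)\<^sup>2) \<le> (LINT x|lborel. (laplacian \<phi> x)\<^sup>2)"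
proof -
  obtain g H where g: "\<And>x. (\<phi> has_derivative (\<lambda>h. g x \<bullet> h)) (at x)"
    "\<And>x. (g has_derivative H x) (at x)" "\<And>h. continuous_on UNIV (\<lambda>x. H x h)"
    "\<And>x h k. H x h \<bullet> k = H x k \<bullet> h" "\<And>x. laplacian \<phi> x = (\<Sum>b\<in>Basis. H x b \<bullet> b)"
    using C2_gradient_hessian[OF C2] by blast
  define k where "k = (real DIM('a) - 4) / 2"
  have k: "real DIM('a) = 2 * k + 4" by (auto simp: k_def field_simps)
  let ?K = "closure {x. \<phi> x \<noteq> 0}"
  let ?U = "{x::'a. 1 < norm x}"
  have U: "open ?U" by (intro open_Collect_less continuous_intros)
  have p0: "\<phi> x = 0" if "x \<notin> ?K" for x using that closure_subset[of "{x. \<phi> x \<noteq> 0}"] by auto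
  have g0: "g x = 0" if "x \<notin> ?K" for x
    using has_derivative_unique[OF g(1) derivative_zero_off_support[OF K p0 that]]
    by (metis inner_eq_zero_iff)
  have q1: "x \<bullet> x > 1" if "x \<in> ?U" for x
    using that by (simp add: dot_square_norm one_less_power)
  have q0: "x \<noteq> 0" "x \<bullet> x > 0" "x \<bullet> x \<noteq> 0" if "x \<in> ?U" for x using that by auto
  have cp: "continuous_on S \<phi>" for S using g(1) by (intro continuous_at_imp_continuous_on ballI has_derivative_continuous)
  have cg: "continuous_on S g" for S using g(2) by (intro continuous_at_imp_continuous_on ballI has_derivative_continuous)
  have linH: "linear (H x)" for x using has_derivative_linear[OF g(2)] .
  have cH: "continuous_on S (\<lambda>x. H x (u x))" if "continuous_on S u" for S and u :: "'a \<Rightarrow> 'a"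
  proof -
    have "H x (u x) = (\<Sum>b\<in>Basis. (u x \<bullet> b) *\<^sub>R H x b)" for x
    proof -
      have "H x (u x) = H x (\<Sum>b\<in>Basis. (u x \<bullet> b) *\<^sub>R b)" by (simp add: euclidean_representation)
      then show ?thesis by (simp add: linear_sum[OF linH] linear_scale[OF linH])
    qed
    moreover have "continuous_on S (\<lambda>x. H x b)" for b using g(3) continuous_on_subset by blast
    ultimately show ?thesis using that by (auto intro!: continuous_intros)
  qed
  define J where "J x = inverse (x \<bullet> x)" for x :: 'a
  define \<tau> where "\<tau> x = (x \<bullet> x) powr (- \<epsilon> / 2)" for x :: 'a
  define M where "M x = x \<bullet> g x + k * \<phi> x" for x
  \<comment> \<open>On r > 1 the function \<open>\<psi>\<close> is \<open>p\<close> evaluated at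
    |x|^2, so its gradient reduces to a one-variable derivative, whose value is
    \<open>\<psi>'\<close>.\<close>
  define p where "p t = \<epsilon> / 2 * t powr (- 2 - \<epsilon> / 2) - k * t powr (- 2)" for t
  define \<psi> where "\<psi> x = (J x)\<^sup>2 * (\<epsilon> / 2 * \<tau> x - k)" for x
  define \<psi>' where "\<psi>' x = (J x)^3 * (2 * k - \<epsilon> / 2 * (2 + \<epsilon> / 2) * \<tau> x)" for x
  define a where "a x = M x * J x" for x
  define ga where "ga x = M x *\<^sub>R ((- 2 * (J x)\<^sup>2) *\<^sub>R x) + J x *\<^sub>R (g x + H x x + k *\<^sub>R g x)" for x
  define e where "e x = (- 1 / 2) * ((g x \<bullet> g x) * J x) + (\<phi> x)\<^sup>2 * \<psi> x" for x
  define ge where "ge x = (- 1 / 2) *\<^sub>R ((g x \<bullet> g x) *\<^sub>R ((- 2 * (J x)\<^sup>2) *\<^sub>R x) + J x *\<^sub>R (2 *\<^sub>R H x (g x)))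
      + ((\<phi> x)\<^sup>2 *\<^sub>R ((2 * \<psi>' x) *\<^sub>R x) + \<psi> x *\<^sub>R ((2 * \<phi> x) *\<^sub>R g x))" for x
  have J1: "J x * (x \<bullet> x) = 1" "J x > 0" if "x \<in> ?U" for x
  proof -
    have "x \<bullet> x \<noteq> 0" "x \<bullet> x > 0" using q1[OF that] by linarith+
    then show "J x * (x \<bullet> x) = 1" "J x > 0" unfolding J_def by (metis left_inverse, metis positive_imp_inverse_positive)
  qed
  have t1: "0 \<le> \<tau> x" "\<tau> x \<le> 1" if "x \<in> ?U" for x
    using q1[OF that] \<epsilon> powr_mono[of "- \<epsilon> / 2" 0 "x \<bullet> x"] by (auto simp: \<tau>_def split: if_splits)
  have dJ: "(J has_derivative (\<lambda>h. (- 2 * (J x)\<^sup>2) *\<^sub>R x \<bullet> h)) (at x)" if "x \<in> ?U" for x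
  proof -
    have "(inverse has_real_derivative - (J x)\<^sup>2) (at (x \<bullet> x))"
      using q0[OF that] by (auto intro!: derivative_eq_intros simp: J_def power2_eq_square divide_inverse)
    from has_gradient_chain[OF has_gradient_norm_sq this]
    show ?thesis by (simp add: J_def[abs_def] mult.commute)
  qed
  have dM: "(M has_derivative (\<lambda>h. (g x + H x x + k *\<^sub>R g x) \<bullet> h)) (at x)" for x
  proof -
    have "((\<lambda>x. x \<bullet> g x) has_derivative (\<lambda>h. x \<bullet> H x h + h \<bullet> g x)) (at x)"
      by (rule has_derivative_inner[OF has_derivative_ident g(2)])
    moreover have "x \<bullet> H x h + h \<bullet> g x = (g x + H x x) \<bullet> h" for h
      by (simp add: inner_commute[of x] inner_commute[of h] g(4)[of x h x] inner_add_left)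
    ultimately have "((\<lambda>x. x \<bullet> g x) has_derivative (\<lambda>h. (g x + H x x) \<bullet> h)) (at x)" by simp
    from has_gradient_add[OF this has_gradient_cmult[OF g(1)]]
    show ?thesis unfolding M_def[abs_def] .
  qed
  have dG: "((\<lambda>x. g x \<bullet> g x) has_derivative (\<lambda>h. (2 *\<^sub>R H x (g x)) \<bullet> h)) (at x)" for x
  proof -
    have "((\<lambda>x. g x \<bullet> g x) has_derivative (\<lambda>h. g x \<bullet> H x h + H x h \<bullet> g x)) (at x)"
      by (rule has_derivative_inner[OF g(2) g(2)])
    moreover have "g x \<bullet> H x h + H x h \<bullet> g x = (2 *\<^sub>R H x (g x)) \<bullet> h" for h
      by (simp add: inner_commute[of "g x"] g(4)[of x h "g x"])
    ultimately show ?thesis by simp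
  qed
  have ppow: "q powr (- 2) = (inverse q)\<^sup>2" "q powr (- 3) = (inverse q)^3"
    "q powr (- 2 - \<epsilon> / 2) = (inverse q)\<^sup>2 * q powr (- \<epsilon> / 2)"
    "q powr (- 3 - \<epsilon> / 2) = (inverse q)^3 * q powr (- \<epsilon> / 2)" if "q > 0" for q
  proof -
    show 1: "q powr (- 2) = (inverse q)\<^sup>2" "q powr (- 3) = (inverse q)^3"
      using that by (simp_all add: powr_minus power_inverse)
    show "q powr (- 2 - \<epsilon> / 2) = (inverse q)\<^sup>2 * q powr (- \<epsilon> / 2)"
      using powr_add[of q "-2" "- \<epsilon> / 2"] 1 by simp
    show "q powr (- 3 - \<epsilon> / 2) = (inverse q)^3 * q powr (- \<epsilon> / 2)"
      using powr_add[of q "-3" "- \<epsilon> / 2"] 1 by simp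
  qed
  have d\<psi>: "(\<psi> has_derivative (\<lambda>h. ((2 * \<psi>' x) *\<^sub>R x) \<bullet> h)) (at x)" if x: "x \<in> ?U" for x
  proof -
    have "(p has_real_derivative (\<epsilon> / 2 * ((- 2 - \<epsilon> / 2) * (x \<bullet> x) powr (- 3 - \<epsilon> / 2)) - k * ((- 2) * (x \<bullet> x) powr (- 3)))) (at (x \<bullet> x))"
      unfolding p_def using q0[OF x] by (auto intro!: derivative_eq_intros)
    moreover have "\<epsilon> / 2 * ((- 2 - \<epsilon> / 2) * (x \<bullet> x) powr (- 3 - \<epsilon> / 2)) - k * ((- 2) * (x \<bullet> x) powr (- 3)) = \<psi>' x"
    proof -
      have "x \<bullet> x > 0" using q0[OF x] by blast
      then show ?thesis unfolding \<psi>'_def J_def \<tau>_def by (simp only: ppow) (simp add: algebra_simps)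
    qed
    ultimately have "(p has_real_derivative \<psi>' x) (at (x \<bullet> x))" by simp
    from has_gradient_chain[OF has_gradient_norm_sq this]
    have "((\<lambda>x. p (x \<bullet> x)) has_derivative (\<lambda>h. ((2 * \<psi>' x) *\<^sub>R x) \<bullet> h)) (at x)"
      by (simp add: algebra_simps)
    then show ?thesis
    proof (rule has_derivative_transform_within_open[OF _ U x])
      fix y assume "y \<in> ?U"
      then have "y \<bullet> y > 0" using q0 by blast
      then show "p (y \<bullet> y) = \<psi> y" unfolding p_def \<psi>_def J_def \<tau>_def by (simp only: ppow) (simp add: algebra_simps)
    qed
  qed
  have da: "(a has_derivative (\<lambda>h. ga x \<bullet> h)) (at x)" if "x \<in> ?U" for x
    unfolding a_def[abs_def] ga_def by (rule has_gradient_mult[OF dM dJ[OF that]])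
  have dp2: "((\<lambda>x. (\<phi> x)\<^sup>2) has_derivative (\<lambda>h. ((2 * \<phi> x) *\<^sub>R g x) \<bullet> h)) (at x)" for x
    using has_gradient_mult[OF g(1) g(1), of x] by (simp add: power2_eq_square algebra_simps inner_add_left)
  have de: "(e has_derivative (\<lambda>h. ge x \<bullet> h)) (at x)" if "x \<in> ?U" for x
    unfolding e_def[abs_def] ge_def
    by (rule has_gradient_add[OF has_gradient_cmult[OF has_gradient_mult[OF dG dJ[OF that]]]
          has_gradient_mult[OF dp2 d\<psi>[OF that]]])
  have cJ: "continuous_on ?U J" using dJ by (intro continuous_at_imp_continuous_on ballI has_derivative_continuous)
  have c\<tau>: "continuous_on ?U \<tau>"
    unfolding \<tau>_def by (intro continuous_intros) (use q0 in blast)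
  have cM: "continuous_on ?U M" unfolding M_def by (intro continuous_intros cp cg)
  have cga: "continuous_on ?U ga" unfolding ga_def by (intro continuous_intros cM cJ cg cH)
  have cge: "continuous_on ?U ge"
    unfolding ge_def \<psi>'_def \<psi>_def by (intro continuous_intros cM cJ cg cH c\<tau> cp)
  have supp: "a x = 0" "e x = 0" if "x \<notin> ?K" for x
    using p0[OF that] g0[OF that] by (auto simp: a_def e_def M_def)
  define d where "d x = a x * (\<Sum>b\<in>Basis. H x b \<bullet> b) + ga x \<bullet> g x + e x * DIM('a) + ge x \<bullet> x" for x
  have d0: "d x = 0" if "x \<notin> ?K" for x
    using p0[OF that] g0[OF that] linear_0[OF linH]
    by (simp add: d_def a_def e_def ga_def ge_def M_def)
  have int_d: "integrable lborel d" "(LINT x|lborel. d x) = 0"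
    by (rule integral_div_eq_0[OF U K ext g(2,3) da cga de cge supp d_def d0]; assumption)+
  let ?f = "\<lambda>x. \<epsilon>\<^sup>2 * norm x powr (- 4 - \<epsilon>) * (\<phi> x)\<^sup>2"
  have fi: "?f x = \<epsilon>\<^sup>2 * ((J x)\<^sup>2 * \<tau> x) * (\<phi> x)\<^sup>2" if "x \<in> ?U" for x
  proof -
    have "norm x powr (- 4 - \<epsilon>) = (norm x powr 2) powr (- 2 - \<epsilon> / 2)"
      by (subst powr_powr) (simp add: algebra_simps)
    also have "norm x powr 2 = x \<bullet> x" using that by (simp add: dot_square_norm)
    also have "(x \<bullet> x) powr (- 2 - \<epsilon> / 2) = (J x)\<^sup>2 * \<tau> x"
      using q0[OF that] ppow(3)[of "x \<bullet> x"] by (simp add: J_def \<tau>_def)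
    finally show ?thesis by simp
  qed
  have f0: "?f x = 0" if "x \<notin> ?K" for x using p0[OF that] by simp
  show int_f: "integrable lborel ?f"
  proof (rule integrable_compact_support[OF _ K f0])
    have "continuous_on (?U \<union> - ?K) ?f"
    proof (rule continuous_on_open_Un[OF U])
      show "open (- ?K)" by (rule open_Compl[OF closed_closure])
      show "continuous_on ?U ?f" by (intro continuous_intros cp) auto
      show "continuous_on (- ?K) ?f"
        by (rule continuous_on_eq[OF continuous_on_const[of _ 0]]) (use f0 in auto)
    qed
    moreover have "?U \<union> - ?K = UNIV" using ext by auto
    ultimately show "continuous_on UNIV ?f" by simp
  qed
  have "?f x \<le> (laplacian \<phi> x)\<^sup>2 - 4 * d x" for x
  proof (cases "x \<in> ?U")
    case True
    show ?thesis
      unfolding fi[OF True] d_def g(5)[symmetric] a_def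
      by (rule exterior_rellich_pointwise[OF g(4) J1(1)[OF True] t1[OF True] k M_def \<psi>_def \<psi>'_def ga_def e_def ge_def])
  next
    case False
    then have "x \<notin> ?K" using ext by auto
    then show ?thesis using p0[of x] d0[of x] by simp
  qed
  then have "(LINT x|lborel. ?f x) \<le> (LINT x|lborel. (laplacian \<phi> x)\<^sup>2 - 4 * d x)"
    using int_f int_d laplacian_sq_integrable(3)[OF C2 K] by (intro integral_mono) auto
  also have "\<dots> = (LINT x|lborel. (laplacian \<phi> x)\<^sup>2)"
    using int_d laplacian_sq_integrable(3)[OF C2 K] by simp
  finally show "(LINT x|lborel. ?f x) \<le> (LINT x|lborel. (laplacian \<phi> x)\<^sup>2)" .
qed

section \<open>Stability criteria from the Rellich inequalities\<close>

lemma set_integral_eq_integral_of_support: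
  fixes f :: "'a \<Rightarrow> real"
  assumes "\<And>x. x \<notin> A \<Longrightarrow> f x = 0"
  shows "(LINT x:A|M. f x) = (LINT x|M. f x)"
  unfolding set_lebesgue_integral_def
  by (rule Bochner_Integration.integral_cong) (use assms in \<open>auto simp: indicator_def\<close>)

lemma stable_on_iff:
  fixes u :: "'a::euclidean_space \<Rightarrow> real"
  shows "stable_on \<alpha> u \<Omega> \<longleftrightarrow> (\<forall>\<phi>. C2c \<phi> \<Omega> \<longrightarrow>
    (LINT x|lborel. norm x powr \<alpha> * exp (u x) * (\<phi> x)\<^sup>2) \<le> (LINT x|lborel. (laplacian \<phi> x)\<^sup>2))"
proof -
  have "(LINT x:\<Omega>|lborel. (laplacian \<phi> x)^2) = (LINT x|lborel. (laplacian \<phi> x)^2)"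
    "(LINT x:\<Omega>|lborel. norm x powr \<alpha> * exp (u x) * (\<phi> x)^2) = (LINT x|lborel. norm x powr \<alpha> * exp (u x) * (\<phi> x)^2)"
    if "C2c \<phi> \<Omega>" for \<phi>
  proof -
    have *: "C2 \<phi>" "compact (closure {x. \<phi> x \<noteq> 0})" "closure {x. \<phi> x \<noteq> 0} \<subseteq> \<Omega>"
      using that by (auto simp: C2c_def)
    have "laplacian \<phi> x = 0" "\<phi> x = 0" if "x \<notin> \<Omega>" for x
      using laplacian_sq_integrable(2)[OF *(1,2), of x] *(3) that closure_subset[of "{x. \<phi> x \<noteq> 0}"] by auto
    then show "(LINT x:\<Omega>|lborel. (laplacian \<phi> x)^2) = (LINT x|lborel. (laplacian \<phi> x)^2)"
    "(LINT x:\<Omega>|lborel. norm x powr \<alpha> * exp (u x) * (\<phi> x)^2) = (LINT x|lborel. norm x powr \<alpha> * exp (u x) * (\<phi> x)^2)"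
      by (auto intro!: set_integral_eq_integral_of_support)
  qed
  then show ?thesis unfolding stable_on_def by auto
qed

lemma stable_at_infinity_of_decay:
  fixes u :: "'a::euclidean_space \<Rightarrow> real"
  assumes "\<delta> > 0" "\<And>x. R \<le> norm x \<Longrightarrow> norm x powr \<alpha> * exp (u x) \<le> C * norm x powr (- 4 - \<delta>)"
  shows "stable_at_infinity \<alpha> u"
proof -
  \<comment> \<open>Half of the decay rate goes into the exterior inequality; the other half,
    r^(-\<epsilon>), tends to 0 and beats the ratio of \<open>C\<close> to
    \<open>\<epsilon>\<^sup>2\<close> far out.\<close>
  define \<epsilon> where "\<epsilon> = \<delta> / 2"
  have \<epsilon>: "\<epsilon> > 0" "\<delta> = 2 * \<epsilon>" using assms(1) by (auto simp: \<epsilon>_def)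
  have "((\<lambda>r::real. C * r powr (- \<epsilon>)) \<longlongrightarrow> C * 0) at_top"
    using \<epsilon> by (intro tendsto_intros tendsto_neg_powr filterlim_ident) auto
  then have "\<forall>\<^sub>F r::real in at_top. C * r powr (- \<epsilon>) < \<epsilon>\<^sup>2"
    using \<epsilon> by (intro order_tendstoD) auto
  then obtain R1 where R1: "\<And>r. r \<ge> R1 \<Longrightarrow> C * r powr (- \<epsilon>) < \<epsilon>\<^sup>2"
    by (auto simp: eventually_at_top_linorder)
  define R' where "R' = max 1 (max R R1)"
  show ?thesis
    unfolding stable_at_infinity_def
  proof (intro exI conjI)
    show "compact (cball (0::'a) R')" by simp
    show "stable_on \<alpha> u (UNIV - cball 0 R')"
      unfolding stable_on_iff
    proof (intro allI impI)
      fix \<phi> assume "C2c \<phi> (UNIV - cball (0::'a) R')"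
      then have *: "C2 \<phi>" "compact (closure {x. \<phi> x \<noteq> 0})" "closure {x. \<phi> x \<noteq> 0} \<subseteq> {x. R' < norm x}"
        by (auto simp: C2c_def)
      have ext: "closure {x. \<phi> x \<noteq> 0} \<subseteq> {x. 1 < norm x}" using *(3) by (auto simp: R'_def)
      have "(LINT x|lborel. norm x powr \<alpha> * exp (u x) * (\<phi> x)\<^sup>2)
          \<le> (LINT x|lborel. \<epsilon>\<^sup>2 * norm x powr (- 4 - \<epsilon>) * (\<phi> x)\<^sup>2)"
      proof (rule integral_mono'[OF exterior_rellich(1)[OF *(1,2) ext \<epsilon>(1)]])
        fix x :: 'a
        show "norm x powr \<alpha> * exp (u x) * (\<phi> x)\<^sup>2 \<le> \<epsilon>\<^sup>2 * norm x powr (- 4 - \<epsilon>) * (\<phi> x)\<^sup>2"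
        proof (cases "\<phi> x = 0")
          case False
          then have x: "norm x > R'" using *(3) closure_subset[of "{x. \<phi> x \<noteq> 0}"] by auto
          have "norm x powr \<alpha> * exp (u x) \<le> C * norm x powr (- 4 - \<delta>)"
            using assms(2)[of x] x by (auto simp: R'_def)
          also have "\<dots> = (C * norm x powr (- \<epsilon>)) * norm x powr (- 4 - \<epsilon>)"
          proof -
            have "- 4 - \<delta> = - \<epsilon> + (- 4 - \<epsilon>)" by (simp add: \<epsilon>(2))
            then show ?thesis by (simp only: powr_add mult.assoc)
          qed
          also have "\<dots> \<le> \<epsilon>\<^sup>2 * norm x powr (- 4 - \<epsilon>)"
            using R1[of "norm x"] x by (intro mult_right_mono) (auto simp: R'_def)
          finally show ?thesis by (rule mult_right_mono) simp
        qed simp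
      qed auto
      also have "\<dots> \<le> (LINT x|lborel. (laplacian \<phi> x)\<^sup>2)"
        by (rule exterior_rellich(2)[OF *(1,2) ext \<epsilon>(1)])
      finally show "(LINT x|lborel. norm x powr \<alpha> * exp (u x) * (\<phi> x)\<^sup>2) \<le> (LINT x|lborel. (laplacian \<phi> x)\<^sup>2)" .
    qed
  qed
qed

lemma stable_sol_of_rellich_bound:
  fixes u :: "'a::euclidean_space \<Rightarrow> real"
  assumes N: "DIM('a) \<ge> 4" and c: "c = real DIM('a) * (real DIM('a) - 4) / 4"
    and bd: "\<And>x. x \<noteq> 0 \<Longrightarrow> norm x powr \<alpha> * exp (u x) \<le> c\<^sup>2 / norm x ^ 4"
  shows "stable_sol \<alpha> u"
  unfolding stable_sol_def stable_on_iff
proof (intro allI impI)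
  fix \<phi> :: "'a \<Rightarrow> real" assume "C2c \<phi> UNIV"
  then have *: "C2 \<phi>" "compact (closure {x. \<phi> x \<noteq> 0})" by (auto simp: C2c_def)
  let ?V = "\<lambda>x. norm x powr \<alpha> * exp (u x) * (\<phi> x)\<^sup>2" and ?L = "LINT x|lborel. (laplacian \<phi> x)\<^sup>2"
  define f where "f n x = c\<^sup>2 * (\<phi> x)\<^sup>2 / (x \<bullet> x + inverse (real (Suc n)))\<^sup>2" for n x
  have f: "integrable lborel (f n)" "(LINT x|lborel. f n x) \<le> ?L" for n
    unfolding f_def by (rule rellich_regularized[OF * N _ c]; simp)+
  show "(LINT x|lborel. ?V x) \<le> ?L"
  proof (cases "integrable lborel ?V")
    case True
    have "(\<lambda>n. LINT x|lborel. min (?V x) (f n x)) \<longlonglongrightarrow> (LINT x|lborel. ?V x)"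
    proof (rule integral_dominated_convergence[where w = ?V])
      show "?V \<in> borel_measurable lborel" using True by auto
      show "(\<lambda>x. min (?V x) (f n x)) \<in> borel_measurable lborel" for n
        using True f(1)[of n] by (intro borel_measurable_min) auto
      show "integrable lborel ?V" by fact
      show "AE x in lborel. norm (min (?V x) (f n x)) \<le> ?V x" for n
        by (auto simp: f_def min_def)
      show "AE x in lborel. (\<lambda>n. min (?V x) (f n x)) \<longlonglongrightarrow> ?V x"
      \<comment> \<open>The pointwise bound is assumed only away from the origin, which is a null
        set.\<close>
      proof (rule AE_mp[OF AE_lborel_singleton[of 0]], intro AE_I2 impI)
        fix x :: 'a assume x: "x \<noteq> 0"
        have "(\<lambda>n. f n x) \<longlonglongrightarrow> c\<^sup>2 * (\<phi> x)\<^sup>2 / (x \<bullet> x + 0)\<^sup>2"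
          unfolding f_def using x by (intro tendsto_intros LIMSEQ_inverse_real_of_nat) auto
        then have "(\<lambda>n. min (?V x) (f n x)) \<longlonglongrightarrow> min (?V x) (c\<^sup>2 * (\<phi> x)\<^sup>2 / (x \<bullet> x + 0)\<^sup>2)"
          by (intro tendsto_intros)
        moreover have "?V x \<le> c\<^sup>2 * (\<phi> x)\<^sup>2 / (x \<bullet> x + 0)\<^sup>2"
        proof -
          have "(x \<bullet> x)\<^sup>2 = norm x ^ 4" by (simp add: dot_square_norm flip: power_mult)
          then show ?thesis
            using mult_right_mono[OF bd[OF x], of "(\<phi> x)\<^sup>2"] by simp
        qed
        ultimately show "(\<lambda>n. min (?V x) (f n x)) \<longlonglongrightarrow> ?V x" by (simp add: min_absorb1)
      qed
    qed
    moreover have "(LINT x|lborel. min (?V x) (f n x)) \<le> ?L" for n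
    proof -
      have "(LINT x|lborel. min (?V x) (f n x)) \<le> (LINT x|lborel. f n x)"
        using f(1) True by (intro integral_mono Bochner_Integration.integrable_min) auto
      with f(2) show ?thesis using order_trans by blast
    qed
    ultimately show ?thesis by (intro LIMSEQ_le_const2) auto
  next
    \<comment> \<open>A non-integrable function has Bochner integral 0, so the inequality is trivial
      here.\<close>
    case False
    then show ?thesis by (simp add: not_integrable_integral_eq)
  qed
qed

section \<open>Radial integrals and radial test functions\<close>


text \<open>Polar coordinates for radial functions. It suffices to compare the two measures on half
  lines, where the left side is the volume of a ball and the right side is the integral of the
  derivative of that volume.\<close>

lemma distr_norm_lborel:
  fixes K :: real
  defines "K \<equiv> real DIM('a) * unit_ball_vol (real DIM('a))"
  shows "distr (lborel :: 'a::euclidean_space measure) borel norm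
    = density lborel (\<lambda>r. ennreal (K * r ^ (DIM('a) - 1) * indicator {0..} r))"
proof (rule measure_eqI_generator_eq[where \<Omega> = UNIV and E = "range (\<lambda>a::real. {..a})" and A = "\<lambda>i. {..real i}"])
  let ?n = "DIM('a)" and ?d = "\<lambda>r::real. ennreal (K * r ^ (DIM('a) - 1) * indicator {0..} r)"
  have K: "K \<ge> 0" by (simp add: K_def unit_ball_vol_nonneg)
  show "Int_stable (range (\<lambda>a::real. {..a}))"
  proof (rule Int_stableI)
    fix X Y assume "X \<in> range (\<lambda>a::real. {..a})" "Y \<in> range (\<lambda>a::real. {..a})"
    then obtain a b where "X = {..a}" "Y = {..b}" by auto
    then have "X \<inter> Y = {..min a b}" by auto
    then show "X \<inter> Y \<in> range (\<lambda>a::real. {..a})" by blast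
  qed
  have *: "emeasure (distr (lborel :: 'a measure) borel norm) {..a} = emeasure (lborel :: 'a measure) (cball 0 a)" for a
  proof -
    have "norm -` {..a} = cball (0::'a) a" by auto
    then show ?thesis by (simp add: emeasure_distr)
  qed
  show "emeasure (distr (lborel :: 'a measure) borel norm) X = emeasure (density lborel ?d) X"
    if X0: "X \<in> range (\<lambda>a::real. {..a})" for X
  proof -
    obtain a where X: "X = {..a}" using X0 by auto
    have "emeasure (density lborel ?d) {..a} = (\<integral>\<^sup>+r. ?d r * indicator {..a} r \<partial>lborel)"
      by (rule emeasure_density) auto
    also have "\<dots> = (\<integral>\<^sup>+r. ennreal (K * r ^ (?n - 1)) * indicator {0..a} r \<partial>lborel)"
      by (intro nn_integral_cong) (auto simp: indicator_def)
    also have "\<dots> = emeasure (lborel :: 'a measure) (cball 0 a)"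
    proof (cases "a \<ge> 0")
      case True
      have "(\<integral>\<^sup>+r. ennreal (K * r ^ (?n - 1)) * indicator {0..a} r \<partial>lborel)
        = ennreal (unit_ball_vol (real ?n) * a ^ ?n - unit_ball_vol (real ?n) * 0 ^ ?n)"
      proof (rule nn_integral_FTC_Icc)
        show "((\<lambda>r. unit_ball_vol (real ?n) * r ^ ?n) has_real_derivative K * r ^ (?n - 1)) (at r)" for r
          unfolding K_def by (auto intro!: derivative_eq_intros)
      qed (use True K in auto)
      then show ?thesis using True by (simp add: emeasure_cball)
    next
      case False
      then show ?thesis by simp
    qed
    finally show ?thesis unfolding X * ..
  qed
  show "sets (distr (lborel :: 'a measure) borel norm) = sigma_sets UNIV (range (\<lambda>a::real. {..a}))"
    "sets (density lborel ?d) = sigma_sets UNIV (range (\<lambda>a::real. {..a}))"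
    by (simp_all add: borel_eq_atMost)
  show "(\<Union>i. {..real i}) = UNIV" using real_arch_simple by auto
  show "emeasure (distr (lborel :: 'a measure) borel norm) {..real i} \<noteq> \<infinity>" for i
    unfolding * by (simp add: emeasure_cball)
qed auto

lemma integral_radial:
  fixes f :: "real \<Rightarrow> real" and K :: real
  assumes f: "f \<in> borel_measurable borel"
  defines "K \<equiv> real DIM('a) * unit_ball_vol (real DIM('a))"
  shows "integrable (lborel :: 'a::euclidean_space measure) (\<lambda>x. f (norm x))
      \<longleftrightarrow> integrable lborel (\<lambda>r. K * r ^ (DIM('a) - 1) * indicator {0..} r * f r)"
    "(LINT x|(lborel :: 'a measure). f (norm x)) = (LINT r|lborel. K * r ^ (DIM('a) - 1) * indicator {0..} r * f r)"
proof -
  have nn: "AE r in lborel. 0 \<le> K * r ^ (DIM('a) - 1) * indicator {0..} r"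
    by (auto simp: K_def unit_ball_vol_nonneg indicator_def)
  have m: "(\<lambda>r. K * r ^ (DIM('a) - 1) * indicator {0..} r) \<in> borel_measurable lborel" by simp
  have f': "f \<in> borel_measurable lborel" using f by simp
  show "integrable (lborel :: 'a measure) (\<lambda>x. f (norm x))
      \<longleftrightarrow> integrable lborel (\<lambda>r. K * r ^ (DIM('a) - 1) * indicator {0..} r * f r)"
    using integrable_distr_eq[of norm "lborel :: 'a measure" borel f] f
    unfolding distr_norm_lborel K_def[symmetric] integrable_density[OF f' m nn] by simp
  show "(LINT x|(lborel :: 'a measure). f (norm x)) = (LINT r|lborel. K * r ^ (DIM('a) - 1) * indicator {0..} r * f r)"
    using integral_distr[of norm "lborel :: 'a measure" borel f] f
    unfolding distr_norm_lborel K_def[symmetric] integral_density[OF f' m nn] by simp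
qed

text \<open>The exponent condition makes r^(\<alpha>+N-1) bounded near 0, so the singular weight for
  negative \<alpha> is harmless in polar coordinates.\<close>

lemma integrable_weight_compact_support:
  fixes h :: "'a::euclidean_space \<Rightarrow> real"
  assumes \<alpha>: "\<alpha> + real DIM('a) - 1 \<ge> 0" and h: "h \<in> borel_measurable borel"
    and bd: "\<And>x. \<bar>h x\<bar> \<le> B" and supp: "\<And>x. norm x > R \<Longrightarrow> h x = 0"
  shows "integrable lborel (\<lambda>x. norm x powr \<alpha> * h x)"
proof -
  define R' where "R' = max 1 R"
  let ?K = "real DIM('a) * unit_ball_vol (real DIM('a))"
  let ?f = "\<lambda>r::real. r powr \<alpha> * B * indicator {0..R'} r"
  have "0 \<le> B" using bd[of 0] by linarith
  have K0: "?K \<ge> 0" by (simp add: unit_ball_vol_nonneg)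
  have "integrable lborel (\<lambda>r. ?K * r ^ (DIM('a) - 1) * indicator {0..} r * ?f r)"
  proof (rule Bochner_Integration.integrable_bound[where f = "\<lambda>r. (?K * B * R' powr (\<alpha> + real DIM('a) - 1)) * indicator {0..R'} r"])
    show "integrable lborel (\<lambda>r. (?K * B * R' powr (\<alpha> + real DIM('a) - 1)) * indicator {0..R'} r)"
      by (intro integrable_mult_right integrable_real_indicator) (auto simp: emeasure_lborel_Icc_eq)
    show "AE r in lborel. norm (?K * r ^ (DIM('a) - 1) * indicator {0..} r * ?f r)
        \<le> norm (?K * B * R' powr (\<alpha> + real DIM('a) - 1) * indicator {0..R'} r)"
    proof (intro AE_I2)
      fix r :: real
      show "norm (?K * r ^ (DIM('a) - 1) * indicator {0..} r * ?f r)
        \<le> norm (?K * B * R' powr (\<alpha> + real DIM('a) - 1) * indicator {0..R'} r)"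
      proof (cases "0 < r \<and> r \<le> R'")
        case True
        have D: "real (DIM('a) - 1) = real DIM('a) - 1" using DIM_positive[where 'a='a] by linarith
        have "r ^ (DIM('a) - 1) * r powr \<alpha> = r powr (\<alpha> + real DIM('a) - 1)"
          using True by (simp add: powr_realpow[symmetric] powr_add[symmetric] D algebra_simps)
        also have "\<dots> \<le> R' powr (\<alpha> + real DIM('a) - 1)"
          using True \<alpha> by (intro powr_mono2) auto
        finally have "?K * B * (r ^ (DIM('a) - 1) * r powr \<alpha>) \<le> ?K * B * R' powr (\<alpha> + real DIM('a) - 1)"
          using K0 \<open>0 \<le> B\<close> by (intro mult_left_mono) auto
        then show ?thesis using True K0 \<open>0 \<le> B\<close> by (simp add: abs_mult mult_ac)
      qed (auto simp: indicator_def)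
    qed
  qed simp
  then have 1: "integrable (lborel :: 'a measure) (\<lambda>x. ?f (norm x))"
    by (subst integral_radial(1)) auto
  show ?thesis
  proof (rule Bochner_Integration.integrable_bound[OF 1])
    show "(\<lambda>x. norm x powr \<alpha> * h x) \<in> borel_measurable lborel" using h by simp
    show "AE x in lborel. norm (norm x powr \<alpha> * h x) \<le> norm (?f (norm x))"
    proof (intro AE_I2)
      fix x :: 'a
      show "norm (norm x powr \<alpha> * h x) \<le> norm (?f (norm x))"
        using supp[of x] bd[of x] \<open>0 \<le> B\<close>
        by (cases "norm x > R") (auto simp: abs_mult R'_def intro!: mult_left_mono)
    qed
  qed
qed

lemma C2_of_gradient_hessian:
  fixes \<phi> :: "'a::euclidean_space \<Rightarrow> real"
  assumes g: "\<And>x. (\<phi> has_derivative (\<lambda>h. g x \<bullet> h)) (at x)"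
    and H: "\<And>x. (g has_derivative H x) (at x)" and c: "\<And>h. continuous_on UNIV (\<lambda>x. H x h)"
  shows "C2 \<phi>" "laplacian \<phi> x = (\<Sum>b\<in>Basis. H x b \<bullet> b)"
proof -
  define D where "D x = blinfun_inner_right (g x)" for x
  define D2 where "D2 x = Blinfun (\<lambda>h. blinfun_inner_right (H x h))" for x
  have bl: "bounded_linear (\<lambda>h. blinfun_inner_right (H x h))" for x
    by (rule bounded_linear_compose[OF bounded_linear_blinfun_inner_right has_derivative_bounded_linear[OF H]])
  have D2: "blinfun_apply (D2 x) h = blinfun_inner_right (H x h)" for x h
    unfolding D2_def by (simp add: bounded_linear_Blinfun_apply[OF bl])
  show "C2 \<phi>"
    unfolding C2_def
  proof (intro exI conjI allI)
    show "(\<phi> has_derivative blinfun_apply (D x)) (at x)" for x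
      using g[of x] by (simp add: D_def blinfun_inner_right.rep_eq)
    show "(D has_derivative blinfun_apply (D2 x)) (at x)" for x
    proof -
      have "(D has_derivative (\<lambda>h. blinfun_inner_right (H x h))) (at x)"
        unfolding D_def by (rule bounded_linear.has_derivative[OF bounded_linear_blinfun_inner_right H])
      then show ?thesis by (simp add: D2[abs_def])
    qed
    show "continuous_on UNIV D2"
      by (rule continuous_on_blinfun_componentwise)
        (simp add: D2 bounded_linear.continuous_on[OF bounded_linear_blinfun_inner_right c])
  qed
  have 1: "deriv (\<lambda>s. \<phi> (x + s *\<^sub>R b)) = (\<lambda>t. g (x + t *\<^sub>R b) \<bullet> b)" for b
    by (rule ext, rule DERIV_imp_deriv, rule has_real_derivative_along_line[OF g])
  have 2: "deriv (\<lambda>t. g (x + t *\<^sub>R b) \<bullet> b) 0 = H x b \<bullet> b" for b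
    using has_real_derivative_along_line[of "\<lambda>y. g y \<bullet> b" "\<lambda>h. H x h \<bullet> b" x 0 b]
      has_derivative_inner_left[OF H] by (simp add: DERIV_imp_deriv)
  show "laplacian \<phi> x = (\<Sum>b\<in>Basis. H x b \<bullet> b)"
    unfolding laplacian_def 1 2 ..
qed

text \<open>Profiles are functions of s = |x|^2 instead of |x|: since s is smooth in x, no parity
  condition at the origin arises.\<close>

lemma C2_radial:
  fixes k :: "real \<Rightarrow> real"
  assumes k1: "\<And>s. s \<ge> 0 \<Longrightarrow> (k has_real_derivative k1 s) (at s)"
    and k2: "\<And>s. s \<ge> 0 \<Longrightarrow> (k1 has_real_derivative k2 s) (at s)"
    and c: "continuous_on {0..} k2"
  shows "C2 (\<lambda>x::'a::euclidean_space. k (x \<bullet> x))"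
    "laplacian (\<lambda>x::'a. k (x \<bullet> x)) x = 4 * (x \<bullet> x) * k2 (x \<bullet> x) + 2 * real DIM('a) * k1 (x \<bullet> x)"
proof -
  let ?g = "\<lambda>x::'a. (2 * k1 (x \<bullet> x)) *\<^sub>R x"
  let ?H = "\<lambda>(x::'a) h. (2 * k1 (x \<bullet> x)) *\<^sub>R h + (4 * k2 (x \<bullet> x) * (x \<bullet> h)) *\<^sub>R x"
  have g: "((\<lambda>x::'a. k (x \<bullet> x)) has_derivative (\<lambda>h. ?g x \<bullet> h)) (at x)" for x
    using has_gradient_chain[OF has_gradient_norm_sq k1, of x] by (simp add: mult.commute)
  have dk1: "((\<lambda>x::'a. 2 * k1 (x \<bullet> x)) has_derivative (\<lambda>h. ((4 * k2 (x \<bullet> x)) *\<^sub>R x) \<bullet> h)) (at x)" for x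
    using has_gradient_cmult[OF has_gradient_chain[OF has_gradient_norm_sq k2, of x], of 2]
    by (simp add: algebra_simps)
  have H: "(?g has_derivative ?H x) (at x)" for x
    by (rule has_derivative_eq_rhs[OF has_derivative_scaleR[OF dk1 has_derivative_ident]]) auto
  have ck2: "continuous_on UNIV (\<lambda>x::'a. k2 (x \<bullet> x))"
    by (rule continuous_on_compose2[OF c]) (auto intro!: continuous_intros)
  have ck1: "continuous_on UNIV (\<lambda>x::'a. k1 (x \<bullet> x))"
  proof -
    have "continuous_on {0..} k1"
      by (intro continuous_at_imp_continuous_on ballI DERIV_isCont[OF k2]) auto
    then show ?thesis by (rule continuous_on_compose2) (auto intro!: continuous_intros)
  qed
  have cH: "continuous_on UNIV (\<lambda>x. ?H x h)" for h by (intro continuous_intros ck1 ck2)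
  show "C2 (\<lambda>x::'a. k (x \<bullet> x))" by (rule C2_of_gradient_hessian[OF g H cH])
  have "laplacian (\<lambda>x::'a. k (x \<bullet> x)) x = (\<Sum>b\<in>Basis. ?H x b \<bullet> b)"
    by (rule C2_of_gradient_hessian[OF g H cH])
  also have "\<dots> = (\<Sum>b\<in>Basis. 2 * k1 (x \<bullet> x) + 4 * k2 (x \<bullet> x) * ((x \<bullet> b) * (x \<bullet> b)))"
    by (intro sum.cong) (auto simp: inner_add_left)
  also have "\<dots> = 2 * real DIM('a) * k1 (x \<bullet> x) + 4 * k2 (x \<bullet> x) * (\<Sum>b\<in>Basis. (x \<bullet> b) * (x \<bullet> b))"
    by (simp add: sum.distrib sum_distrib_left)
  finally show "laplacian (\<lambda>x::'a. k (x \<bullet> x)) x = 4 * (x \<bullet> x) * k2 (x \<bullet> x) + 2 * real DIM('a) * k1 (x \<bullet> x)"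
    using euclidean_inner[of x x] by simp
qed

lemma has_real_derivative_max_power:
  assumes "n \<ge> 2"
  shows "((\<lambda>t::real. (max 0 t) ^ n) has_real_derivative real n * (max 0 t) ^ (n - 1)) (at t)"
proof -
  consider "t < 0" | "t > 0" | "t = 0" by linarith
  then show ?thesis
  proof cases
    case 1
    have "((\<lambda>t::real. 0) has_real_derivative 0) (at t)" by simp
    then have "((\<lambda>t::real. (max 0 t) ^ n) has_real_derivative 0) (at t)"
      by (rule has_field_derivative_transform_within_open[of _ _ _ "{..<0}"]) (use 1 assms in auto)
    moreover have "real n * (max 0 t) ^ (n - 1) = 0" using 1 assms by (simp add: max.absorb1)
    ultimately show ?thesis by (simp only:)
  next
    case 2
    have "((\<lambda>t::real. t ^ n) has_real_derivative real n * t ^ (n - 1)) (at t)"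
      by (auto intro!: derivative_eq_intros)
    then have "((\<lambda>t::real. (max 0 t) ^ n) has_real_derivative real n * t ^ (n - 1)) (at t)"
      by (rule has_field_derivative_transform_within_open[of _ _ _ "{0<..}"]) (use 2 in auto)
    then show ?thesis using 2 by simp
  next
    case 3
    have "((\<lambda>h::real. (max 0 h) ^ n / h) \<longlongrightarrow> 0) (at 0)"
    proof (rule tendsto_sandwich[where f = "\<lambda>h. - (\<bar>h\<bar> ^ (n - 1))" and h = "\<lambda>h. \<bar>h\<bar> ^ (n - 1)"])
      have *: "\<bar>(max 0 h) ^ n / h\<bar> \<le> \<bar>h\<bar> ^ (n - 1)" for h :: real
      proof (cases "h > 0")
        case True
        obtain m where "n = Suc m" using assms by (cases n) auto
        then show ?thesis using True by (simp add: max.absorb2)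
      next
        case False
        then have "max 0 h = 0" by simp
        then show ?thesis using assms by (simp add: zero_power)
      qed
      show "\<forall>\<^sub>F h in at 0. - (\<bar>h\<bar> ^ (n - 1)) \<le> (max 0 h) ^ n / (h::real)"
        "\<forall>\<^sub>F h in at 0. (max 0 h) ^ n / (h::real) \<le> \<bar>h\<bar> ^ (n - 1)"
        using * by (intro always_eventually allI; smt (verit))+
      have "((\<lambda>h::real. \<bar>h\<bar> ^ (n - 1)) \<longlongrightarrow> \<bar>0\<bar> ^ (n - 1)) (at 0)" by (intro tendsto_intros)
      moreover have "(\<bar>0\<bar>::real) ^ (n - 1) = 0" using assms by simp
      ultimately show "((\<lambda>h::real. \<bar>h\<bar> ^ (n - 1)) \<longlongrightarrow> 0) (at 0)" by (simp only:)
      then show "((\<lambda>h::real. - (\<bar>h\<bar> ^ (n - 1))) \<longlongrightarrow> 0) (at 0)" by (metis minus_zero tendsto_minus)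
    qed
    moreover obtain m where "n = Suc (Suc m)"
      using assms by (metis Suc_le_D numeral_2_eq_2 Suc_le_mono)
    ultimately show ?thesis using 3 by (simp add: DERIV_def)
  qed
qed

text \<open>Only two continuous derivatives are needed, so truncated cubes suffice: with p(t) =
  max(0,t)^3 the step is p(1 - p(1 - t)), which is flat at both ends.\<close>

lemma smooth_cutoff:
  obtains h h1 h2 :: "real \<Rightarrow> real" and C :: real
  where "\<And>t. (h has_real_derivative h1 t) (at t)" "\<And>t. (h1 has_real_derivative h2 t) (at t)"
    "continuous_on UNIV h2" "\<And>t. t \<le> 0 \<Longrightarrow> h t = 0 \<and> h1 t = 0 \<and> h2 t = 0"
    "\<And>t. t \<ge> 1 \<Longrightarrow> h t = 1 \<and> h1 t = 0 \<and> h2 t = 0" "\<And>t. 0 \<le> h t \<and> h t \<le> 1"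
    "\<And>t. \<bar>h1 t\<bar> \<le> C" "\<And>t. \<bar>h2 t\<bar> \<le> C"
proof -
  define p where "p n t = (max 0 t) ^ n" for n :: nat and t :: real
  have dp: "((\<lambda>t. p 3 t) has_real_derivative 3 * p 2 t) (at t)"
    "((\<lambda>t. p 2 t) has_real_derivative 2 * p 1 t) (at t)" for t
    unfolding p_def using has_real_derivative_max_power[of 3 t] has_real_derivative_max_power[of 2 t] by auto
  note dp' = DERIV_chain2[OF dp(1)] DERIV_chain2[OF dp(2)]
  define a where "a t = 1 - p 3 (1 - t)" for t
  have a: "(a has_real_derivative 3 * p 2 (1 - t)) (at t)" for t
    unfolding a_def by (auto intro!: derivative_eq_intros dp')
  define h where "h t = p 3 (a t)" for t
  define h1 where "h1 t = 9 * (p 2 (a t) * p 2 (1 - t))" for t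
  define h2 where "h2 t = 9 * (2 * p 1 (a t) * (3 * p 2 (1 - t)) * p 2 (1 - t) - p 2 (a t) * (2 * p 1 (1 - t)))" for t
  have cp: "continuous_on S (p n)" for n S unfolding p_def by (intro continuous_intros)
  have ca: "continuous_on UNIV a" using a by (intro continuous_at_imp_continuous_on ballI DERIV_isCont)
  have cpc: "continuous_on UNIV (\<lambda>t. p n (f t))" if "continuous_on UNIV f" for n f
    by (rule continuous_on_compose2[OF cp that, of UNIV]) auto
  have A: "(h has_real_derivative h1 t) (at t)" for t
    unfolding h_def[abs_def] h1_def by (rule DERIV_cong[OF DERIV_chain2[OF dp(1) a]]) simp
  have B: "(h1 has_real_derivative h2 t) (at t)" for t
  proof -
    have lin: "((\<lambda>t. 1 - t) has_real_derivative - 1) (at t)" by (auto intro!: derivative_eq_intros)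
    have "((\<lambda>t. p 2 (1 - t)) has_real_derivative - (2 * p 1 (1 - t))) (at t)"
      by (rule DERIV_cong[OF DERIV_chain2[OF dp(2) lin]]) simp
    note DERIV_cmult[OF DERIV_mult[OF DERIV_chain2[OF dp(2) a] this], of 9]
    then show ?thesis
      unfolding h1_def[abs_def] h2_def by (rule DERIV_cong) (simp add: algebra_simps)
  qed
  have C: "continuous_on UNIV h2"
    unfolding h2_def by (intro continuous_intros cpc ca)
  have D: "h t = 0 \<and> h1 t = 0 \<and> h2 t = 0" if "t \<le> 0" for t
  proof -
    have "a t \<le> 0" using that by (auto simp: a_def p_def one_le_power)
    then show ?thesis by (auto simp: h_def h1_def h2_def p_def max_def)
  qed
  have E: "h t = 1 \<and> h1 t = 0 \<and> h2 t = 0" if "t \<ge> 1" for t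
    using that by (auto simp: h_def h1_def h2_def a_def p_def max_def)
  have F: "0 \<le> h t \<and> h t \<le> 1" for t
  proof -
    have "a t \<le> 1" by (simp add: a_def p_def)
    then show ?thesis by (auto simp: h_def p_def max_def power_le_one)
  qed
  have bd: "\<exists>C. \<forall>t. \<bar>f t\<bar> \<le> C" if "continuous_on UNIV f" "\<And>t. t \<notin> {0..1} \<Longrightarrow> f t = 0" for f :: "real \<Rightarrow> real"
  proof -
    have "bounded (f ` {0..1})"
      using that(1) by (intro compact_imp_bounded compact_continuous_image) (auto intro: continuous_on_subset)
    then obtain C where "\<And>t. t \<in> {0..1} \<Longrightarrow> \<bar>f t\<bar> \<le> C"
      by (metis bounded_iff image_eqI real_norm_def)
    then have "\<bar>f t\<bar> \<le> max 0 C" for t using that(2)[of t] by (cases "t \<in> {0..1}") (force simp: max_def)+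
    then show ?thesis by blast
  qed
  have "continuous_on UNIV h1" using B by (intro continuous_at_imp_continuous_on ballI DERIV_isCont)
  then obtain C1 where C1: "\<And>t. \<bar>h1 t\<bar> \<le> C1" using bd[of h1] D E by force
  obtain C2 where C2: "\<And>t. \<bar>h2 t\<bar> \<le> C2" using bd[OF C] D E by force
  show ?thesis
    by (rule that[of h h1 h2 "max C1 C2"]) (use A B C D E F C1 C2 in \<open>auto simp: le_max_iff_disj\<close>)
qed

lemma C2c_radial:
  fixes k :: "real \<Rightarrow> real"
  assumes "C2 (\<lambda>x::'a::euclidean_space. k (x \<bullet> x))" "\<And>s. s > R\<^sup>2 \<Longrightarrow> k s = 0" "R \<ge> 0"
  shows "C2c (\<lambda>x::'a. k (x \<bullet> x)) UNIV"
proof -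
  have "{x::'a. k (x \<bullet> x) \<noteq> 0} \<subseteq> cball 0 R"
  proof
    fix x :: 'a assume "x \<in> {x. k (x \<bullet> x) \<noteq> 0}"
    then have "(norm x)\<^sup>2 \<le> R\<^sup>2" using assms(2)[of "x \<bullet> x"] by (force simp: dot_square_norm)
    then show "x \<in> cball 0 R" using power2_le_imp_le[OF _ assms(3)] by auto
  qed
  then have "bounded {x::'a. k (x \<bullet> x) \<noteq> 0}" using bounded_cball bounded_subset by blast
  then show ?thesis using assms(1) by (simp add: C2c_def compact_eq_bounded_closed bounded_closure)
qed

section \<open>Instability by logarithmic test functions\<close>

text \<open>For N at most 4 the constant 1 is approximated by cutoffs in ln(1 + |x|^2) spread over
  length T. The energy of these cutoffs is O(1/T), while the potential term stays at least
  \<open>\<kappa>\<close>, its value on the unit ball.\<close>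

lemma unstable_low_dimension:
  fixes v :: "real \<Rightarrow> real"
  assumes N: "DIM('a::euclidean_space) = 3 \<or> DIM('a) = 4" and \<alpha>: "\<alpha> > - 2"
    and v: "continuous_on UNIV v" "\<And>r. v r \<le> 0"
  shows "\<not> stable_sol \<alpha> (\<lambda>x::'a. v (norm x))"
proof
  assume stab: "stable_sol \<alpha> (\<lambda>x::'a. v (norm x))"
  obtain h h1 h2 C where h: "\<And>t. (h has_real_derivative h1 t) (at t)" "\<And>t. (h1 has_real_derivative h2 t) (at t)"
    "continuous_on UNIV h2" "\<And>t. t \<le> 0 \<Longrightarrow> h t = 0 \<and> h1 t = 0 \<and> h2 t = 0"
    "\<And>t. t \<ge> 1 \<Longrightarrow> h t = 1 \<and> h1 t = 0 \<and> h2 t = 0" "\<And>t. 0 \<le> h t \<and> h t \<le> 1"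
    "\<And>t. \<bar>h1 t\<bar> \<le> C" "\<And>t. \<bar>h2 t\<bar> \<le> C"
    using smooth_cutoff by blast
  have C0: "C \<ge> 0" using h(7)[of 0] by linarith
  let ?n = "real DIM('a)"
  let ?K = "?n * unit_ball_vol ?n"
  have K0: "?K > 0" using N by auto
  have mv: "(\<lambda>x::'a. exp (v (norm x))) \<in> borel_measurable borel"
    by (intro borel_measurable_continuous_onI continuous_intros continuous_on_compose2[OF v(1)]) auto
  let ?W = "\<lambda>x::'a. norm x powr \<alpha> * (exp (v (norm x)) * indicator (cball 0 1) x)"
  have bdW: "\<bar>exp (v (norm x)) * indicator (cball 0 1) x\<bar> \<le> 1" for x :: 'a
    using v(2)[of "norm x"] by (auto simp: indicator_def)
  have intW: "integrable lborel ?W"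
    by (rule integrable_weight_compact_support[where B = 1 and R = 1]) (use N \<alpha> mv bdW in \<open>auto simp: indicator_def\<close>)
  define \<kappa> where "\<kappa> = (LINT x|lborel. ?W x)"
  have \<kappa>: "\<kappa> > 0"
  proof -
    have "\<kappa> \<noteq> 0"
    proof
      assume "\<kappa> = 0"
      then have "AE x in lborel. ?W x = 0"
        unfolding \<kappa>_def by (subst (asm) integral_nonneg_eq_0_iff_AE[OF intW]) (auto simp: indicator_def)
      then have "AE x in lborel. x \<notin> cball (0::'a) 1"
        using AE_lborel_singleton[of "0::'a"] by eventually_elim (auto simp: indicator_def split: if_splits)
      then have "emeasure lborel (cball (0::'a) 1) = 0"
        by (subst (asm) AE_iff_measurable[of "cball 0 1"]) auto
      then have "unit_ball_vol ?n \<le> 0" by (simp add: emeasure_cball ennreal_eq_0_iff)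
      then show False using unit_ball_vol_pos[of ?n] by linarith
    qed
    moreover have "\<kappa> \<ge> 0" unfolding \<kappa>_def by (intro Bochner_Integration.integral_nonneg) auto
    ultimately show ?thesis by simp
  qed
  \<comment> \<open>The square of 16 C: the second derivative part of the Laplacian contributes 8 C,
    and the first derivative part another 8 C because N is at most 4.\<close>
  define B where "B = (12 * C + 4 * C)\<^sup>2"
  have main: "\<kappa> \<le> ?K * (B / T\<^sup>2) * (1 + T)" if T: "T \<ge> 1" for T
  proof -
    define k where "k s = h (2 - ln (1 + s) / T)" for s
    define k1 where "k1 s = - (h1 (2 - ln (1 + s) / T) * inverse (1 + s)) / T" for s
    define k2 where "k2 s = (h2 (2 - ln (1 + s) / T) / T + h1 (2 - ln (1 + s) / T)) * (inverse (1 + s))\<^sup>2 / T" for s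
    have darg: "((\<lambda>s. 2 - ln (1 + s) / T) has_real_derivative - inverse (1 + s) / T) (at s)" if "s \<ge> 0" for s
      using that T by (auto intro!: derivative_eq_intros simp: divide_simps)
    have d1: "(k has_real_derivative k1 s) (at s)" if "s \<ge> 0" for s
      unfolding k_def[abs_def] k1_def by (rule DERIV_cong[OF DERIV_chain2[OF h(1) darg[OF that]]]) simp
    have d2: "(k1 has_real_derivative k2 s) (at s)" if "s \<ge> 0" for s
    proof -
      have "((\<lambda>s. inverse (1 + s)) has_real_derivative - (inverse (1 + s))\<^sup>2) (at s)"
        using that by (auto intro!: derivative_eq_intros simp: power2_eq_square)
      note DERIV_cdivide[OF DERIV_minus[OF DERIV_mult[OF DERIV_chain2[OF h(2) darg[OF that]] this]], of T]
      then show ?thesis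
        unfolding k1_def[abs_def] k2_def by (rule DERIV_cong) (simp add: algebra_simps power2_eq_square)
    qed
    have carg: "continuous_on {0..} (\<lambda>s. 2 - ln (1 + s) / T)" using T by (intro continuous_intros) auto
    have ch1: "continuous_on UNIV h1" using h(2) by (intro continuous_at_imp_continuous_on ballI DERIV_isCont)
    have c2: "continuous_on {0..} k2"
      unfolding k2_def using T
      by (intro continuous_intros continuous_on_compose2[OF h(3) carg] continuous_on_compose2[OF ch1 carg]) auto
    let ?\<phi> = "\<lambda>x::'a. k (x \<bullet> x)"
    have C2: "C2 ?\<phi>" by (rule C2_radial(1)[OF d1 d2 c2])
    have lap: "laplacian ?\<phi> x = 4 * (x \<bullet> x) * k2 (x \<bullet> x) + 2 * ?n * k1 (x \<bullet> x)" for x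
      by (rule C2_radial(2)[OF d1 d2 c2])
    have far: "k s = 0 \<and> k1 s = 0 \<and> k2 s = 0" if "s > (exp T)\<^sup>2" for s
    proof -
      have "(exp T)\<^sup>2 = exp (2 * T)" by (simp add: exp_double)
      then have "ln (1 + s) \<ge> 2 * T" using that by (subst ln_ge_iff) (auto intro: add_pos_pos less_trans[OF exp_gt_zero])
      then have "2 - ln (1 + s) / T \<le> 0" using T by (simp add: field_simps)
      then show ?thesis using h(4) by (simp add: k_def k1_def k2_def)
    qed
    have C2c: "C2c ?\<phi> UNIV" by (rule C2c_radial[OF C2, of "exp T"]) (use far in auto)
    have lower: "\<kappa> \<le> (LINT x|lborel. norm x powr \<alpha> * exp (v (norm x)) * (?\<phi> x)\<^sup>2)"
      unfolding \<kappa>_def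
    proof (rule integral_mono[OF intW])
      have ck: "continuous_on UNIV ?\<phi>"
        by (rule continuous_on_compose2[of "{0..}" k])
          (auto intro!: continuous_intros continuous_at_imp_continuous_on DERIV_isCont[OF d1])
      have m: "(\<lambda>x. exp (v (norm x)) * (?\<phi> x)\<^sup>2) \<in> borel_measurable borel"
        using mv borel_measurable_continuous_onI[OF ck] by simp
      have bd: "\<bar>exp (v (norm x)) * (?\<phi> x)\<^sup>2\<bar> \<le> 1" for x :: 'a
        using v(2)[of "norm x"] h(6) by (auto simp: k_def abs_mult intro!: mult_le_one power_le_one)
      have z: "exp (v (norm x)) * (?\<phi> x)\<^sup>2 = 0" if "norm x > exp T" for x :: 'a
        using far[of "x \<bullet> x"] power_strict_mono[OF that, of 2] by (auto simp: dot_square_norm)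
      have "integrable lborel (\<lambda>x::'a. norm x powr \<alpha> * (exp (v (norm x)) * (?\<phi> x)\<^sup>2))"
        by (rule integrable_weight_compact_support[where B = 1 and R = "exp T", OF _ m bd z])
          (use N \<alpha> in auto)
      then show "integrable lborel (\<lambda>x::'a. norm x powr \<alpha> * exp (v (norm x)) * (?\<phi> x)\<^sup>2)" by (simp add: mult.assoc)
      fix x :: 'a
      show "?W x \<le> norm x powr \<alpha> * exp (v (norm x)) * (?\<phi> x)\<^sup>2"
      proof (cases "x \<in> cball 0 1")
        case True
        then have "x \<bullet> x \<le> 1" by (simp add: dot_square_norm power_le_one)
        then have "ln (1 + x \<bullet> x) \<le> 1"
          using ln_add_one_self_le_self[of "x \<bullet> x"] by (simp add: add.commute)
        then have "2 - ln (1 + x \<bullet> x) / T \<ge> 1" using T by (simp add: field_simps)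
        then have "?\<phi> x = 1" using h(5) by (simp add: k_def)
        then show ?thesis using True by simp
      qed simp
    qed
    \<comment> \<open>\<open>?F\<close> majorises the squared Laplacian. In these dimensions r^(N-1)
      / (1+r^2)^2 is at most 1 on [0,1] and at most 1/r beyond, so the integral of the majorant
      \<open>?G\<close> grows only linearly in T against the factor 1/T^2.\<close>
    let ?F = "\<lambda>r::real. (B / T\<^sup>2) * ((inverse (1 + r\<^sup>2))\<^sup>2 * indicator {0..exp T} r)"
    let ?G = "\<lambda>r::real. ?K * (B / T\<^sup>2) * (1 * indicator {0..1} r + inverse r * indicator {1..exp T} r)"
    have intG: "has_bochner_integral lborel ?G (?K * (B / T\<^sup>2) * ((1 - 0) + (ln (exp T) - ln 1)))"
      by (intro has_bochner_integral_mult_right has_bochner_integral_add has_bochner_integral_FTC_Icc_nonneg)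
        (use T in \<open>auto intro!: derivative_eq_intros simp: divide_inverse\<close>)
    have FG: "\<bar>?K * r ^ (DIM('a) - 1) * indicator {0..} r * ?F r\<bar> \<le> ?G r" for r
    proof -
      have BT: "?K * (B / T\<^sup>2) \<ge> 0" using K0 by (simp add: B_def)
      have *: "\<bar>?K * r ^ (DIM('a) - 1) * indicator {0..} r * ?F r\<bar>
          = ?K * (B / T\<^sup>2) * (r ^ (DIM('a) - 1) * (inverse (1 + r\<^sup>2))\<^sup>2 * indicator {0..exp T} r)"
        using BT by (cases "0 \<le> r \<and> r \<le> exp T") (auto simp: indicator_def abs_mult B_def)
      consider "r < 0 \<or> r > exp T" | "0 \<le> r" "r \<le> 1" | "1 < r" "r \<le> exp T" by linarith
      then have "r ^ (DIM('a) - 1) * (inverse (1 + r\<^sup>2))\<^sup>2 * indicator {0..exp T} r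
          \<le> 1 * indicator {0..1} r + inverse r * indicator {1..exp T} r"
      proof cases
        case 2
        have "r ^ (DIM('a) - 1) * (inverse (1 + r\<^sup>2))\<^sup>2 \<le> 1 * 1"
          using 2 by (intro mult_mono power_le_one) (auto simp: inverse_le_1_iff)
        then show ?thesis using 2 T order_trans[OF 2(2), of "exp T"] by (auto simp: indicator_def)
      next
        case 3
        have "r ^ (DIM('a) - 1) \<le> r ^ 3" using 3 N by (intro power_increasing) auto
        moreover have "(inverse (1 + r\<^sup>2))\<^sup>2 \<le> (inverse (r\<^sup>2))\<^sup>2"
          using 3 by (intro power_mono le_imp_inverse_le) auto
        ultimately have "r ^ (DIM('a) - 1) * (inverse (1 + r\<^sup>2))\<^sup>2 \<le> r ^ 3 * (inverse (r\<^sup>2))\<^sup>2"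
          using 3 by (intro mult_mono) auto
        also have "\<dots> = inverse r" using 3 by (simp add: field_simps power2_eq_square power3_eq_cube)
        finally show ?thesis using 3 by (auto simp: indicator_def)
      qed (auto simp: indicator_def)
      then show ?thesis unfolding * using BT by (intro mult_left_mono)
    qed
    have intF: "integrable lborel (\<lambda>r. ?K * r ^ (DIM('a) - 1) * indicator {0..} r * ?F r)"
    proof (rule Bochner_Integration.integrable_bound)
      show "integrable lborel ?G" using intG by (simp only: has_bochner_integral_iff)
      show "AE r in lborel. norm (?K * r ^ (DIM('a) - 1) * indicator {0..} r * ?F r) \<le> norm (?G r)"
        using FG by (intro AE_I2) (simp only: real_norm_def, meson abs_ge_self order_trans)
    qed simp
    have mF: "?F \<in> borel_measurable borel" by simp
    have "\<kappa> \<le> (LINT x|lborel. (laplacian ?\<phi> x)\<^sup>2)"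
      using lower stab C2c unfolding stable_sol_def stable_on_iff by force
    also have "\<dots> \<le> (LINT x|(lborel::'a measure). ?F (norm x))"
    proof (rule integral_mono')
      show "integrable lborel (\<lambda>x::'a. ?F (norm x))"
        unfolding integral_radial(1)[OF mF] by (rule intF)
      fix x :: 'a
      show "0 \<le> ?F (norm x)" by (auto simp: B_def)
      show "(laplacian ?\<phi> x)\<^sup>2 \<le> ?F (norm x)"
      proof (cases "norm x > exp T")
        case True
        then have "laplacian ?\<phi> x = 0"
          using far[of "x \<bullet> x"] power_strict_mono[OF True, of 2] unfolding lap by (auto simp: dot_square_norm)
        then show ?thesis by (simp add: B_def)
      next
        case False
        define s where "s = x \<bullet> x"
        define i where "i = inverse (1 + s)"
        have s: "s \<ge> 0" "s = (norm x)\<^sup>2" by (auto simp: s_def dot_square_norm)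
        have i: "i > 0" "s * i \<le> 1" using s(1) by (auto simp: i_def field_simps)
        let ?a = "2 - ln (1 + s) / T"
        have "\<bar>k1 s\<bar> = \<bar>h1 ?a\<bar> * i / T" using T i by (simp add: k1_def i_def[symmetric] abs_mult)
        also have "\<dots> \<le> C * i / T" using h(7) T i by (intro divide_right_mono mult_right_mono) auto
        finally have k1b: "\<bar>k1 s\<bar> \<le> C * i / T" .
        have "\<bar>h2 ?a / T + h1 ?a\<bar> \<le> C + C"
        proof -
          have "\<bar>h2 ?a / T\<bar> = \<bar>h2 ?a\<bar> / T" using T by simp
          also have "\<dots> \<le> \<bar>h2 ?a\<bar> / 1" using T by (intro divide_left_mono) auto
          finally show ?thesis using h(7)[of ?a] h(8)[of ?a] by linarith
        qed
        then have "\<bar>k2 s\<bar> \<le> (C + C) * i\<^sup>2 / T"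
          using T i unfolding k2_def i_def[symmetric] abs_mult abs_divide
          by (intro divide_mono mult_mono) auto
        then have "\<bar>4 * s * k2 s\<bar> \<le> 4 * s * ((C + C) * i\<^sup>2 / T)"
          using s by (simp only: abs_mult) (intro mult_mono, auto)
        also have "\<dots> = 8 * C * i / T * (s * i)" by (simp add: power2_eq_square)
        also have "\<dots> \<le> 8 * C * i / T * 1" using i C0 T by (intro mult_left_mono) auto
        finally have A: "\<bar>4 * s * k2 s\<bar> \<le> 8 * C * i / T" by simp
        have "\<bar>2 * ?n * k1 s\<bar> = 2 * ?n * \<bar>k1 s\<bar>" by (simp add: abs_mult)
        also have "\<dots> \<le> 8 * (C * i / T)" using k1b N by (intro mult_mono) auto
        finally have "\<bar>laplacian ?\<phi> x\<bar> \<le> 16 * C * i / T"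
          using A unfolding lap s_def[symmetric] by linarith
        then have "(laplacian ?\<phi> x)\<^sup>2 \<le> (16 * C * i / T)\<^sup>2"
          by (metis abs_le_square_iff abs_ge_self order_trans)
        also have "\<dots> = (B / T\<^sup>2) * i\<^sup>2" by (simp add: B_def power_mult_distrib power_divide)
        finally show ?thesis using False by (simp add: i_def s(2) indicator_def)
      qed
    qed
    also have "\<dots> = (LINT r|lborel. ?K * r ^ (DIM('a) - 1) * indicator {0..} r * ?F r)"
      by (rule integral_radial(2)[OF mF])
    also have "\<dots> \<le> (LINT r|lborel. ?G r)"
    proof (rule integral_mono[OF intF])
      show "integrable lborel ?G" using intG by (simp only: has_bochner_integral_iff)
      show "?K * r ^ (DIM('a) - 1) * indicator {0..} r * ?F r \<le> ?G r" for r
        using FG[of r] abs_ge_self order_trans by blast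
    qed
    also have "\<dots> = ?K * (B / T\<^sup>2) * (1 + T)"
      unfolding has_bochner_integral_integral_eq[OF intG] by simp
    finally show ?thesis .
  qed
  \<comment> \<open>Since T is at least 1, the energy is at most 2 K B / T; this T makes that
    smaller than \<open>\<kappa>\<close>.\<close>
  define T where "T = 1 + 2 * (?K * B) / \<kappa>"
  have KB: "?K * B \<ge> 0" using K0 by (simp add: B_def)
  have "0 \<le> 2 * (?K * B) / \<kappa>"
    using KB \<kappa> by (intro divide_nonneg_pos mult_nonneg_nonneg[OF _ KB]) auto
  then have T: "T \<ge> 1" unfolding T_def by linarith
  have "\<kappa> \<le> ?K * (B / T\<^sup>2) * (1 + T)" by (rule main[OF T])
  also have "\<dots> \<le> ?K * (B / T\<^sup>2) * (2 * T)" using T K0 by (intro mult_left_mono) (auto simp: B_def)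
  also have "\<dots> = 2 * ?K * B / T" using T by (simp add: power2_eq_square)
  finally have "\<kappa> * T \<le> 2 * ?K * B" using T by (simp add: field_simps)
  moreover have "\<kappa> * T = \<kappa> + 2 * ?K * B" using \<kappa> by (simp add: T_def field_simps)
  ultimately show False using \<kappa> by linarith
qed


lemma has_real_derivative_extend_zero:
  fixes k :: "real \<Rightarrow> real"
  assumes "s0 > 0" "\<And>s. s > 0 \<Longrightarrow> (k has_real_derivative k1 s) (at s)"
    and "\<And>s. 0 < s \<Longrightarrow> s < s0 \<Longrightarrow> k s = 0"
  shows "((\<lambda>s. if s \<le> 0 then 0 else k s) has_real_derivative (if s \<le> 0 then 0 else k1 s)) (at s)"
proof (cases "s \<le> 0")
  case True
  have "((\<lambda>s::real. 0::real) has_real_derivative 0) (at s)" by simp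
  then have "((\<lambda>s. if s \<le> 0 then 0 else k s) has_real_derivative 0) (at s)"
    by (rule has_field_derivative_transform_within_open[of _ _ _ "{..<s0}"])
      (use True assms in auto)
  then show ?thesis using True by simp
next
  case False
  have "(k has_real_derivative k1 s) (at s)" using False assms(2) by simp
  then have "((\<lambda>s. if s \<le> 0 then 0 else k s) has_real_derivative k1 s) (at s)"
    by (rule has_field_derivative_transform_within_open[of _ _ _ "{0<..}"])
      (use False in auto)
  then show ?thesis using False by simp
qed

lemma has_real_derivative_powr_times_log:
  assumes "\<And>t. (f has_real_derivative f' t) (at t)" "s > 0"
  shows "((\<lambda>s. s powr p * f (ln s / 2)) has_real_derivative s powr (p - 1) * (p * f (ln s / 2) + f' (ln s / 2) / 2)) (at s)"
proof -
  have 1: "((\<lambda>s. ln s / 2) has_real_derivative 1 / (2 * s)) (at s)"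
    using assms(2) by (auto intro!: derivative_eq_intros simp: divide_simps)
  have 2: "((\<lambda>s. s powr p) has_real_derivative p * s powr (p - 1)) (at s)"
    using assms(2) by (rule has_real_derivative_powr)
  have 3: "s powr p = s * s powr (p - 1)" using assms(2) by (simp add: powr_diff)
  show ?thesis
    by (rule DERIV_cong[OF DERIV_mult[OF 2 DERIV_chain2[OF assms(1) 1]]])
      (use assms(2) in \<open>simp add: 3 field_simps\<close>)
qed

text \<open>The lower bound on \<open>G\<close> says that the integral of e^z over logarithmic time
  L is at least \<theta> L - O(1), with e^z = r^(4+\<alpha>) e^v. The test function r^(-(N-4)/2),
  cut off to an annulus of logarithmic length L, has energy c^2 L + O(1) up to the common factor
  \<open>?K\<close>, so c^2 < \<theta> gives instability for large L.\<close>

lemma unstable_exterior: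
  fixes v G :: "real \<Rightarrow> real"
  assumes \<alpha>: "\<alpha> + real DIM('a::euclidean_space) - 1 \<ge> 0"
    and v: "continuous_on UNIV v" "\<And>r. v r \<le> 0"
    and c: "c = real DIM('a) * (real DIM('a) - 4) / 4" "c\<^sup>2 < \<theta>"
    and R0: "R0 > 0"
    and G: "\<And>r. r \<ge> R0 \<Longrightarrow> (G has_real_derivative (r powr (4 + \<alpha>) * exp (v r) - \<theta>) / r) (at r)"
    and Gb: "\<And>r. r \<ge> R0 \<Longrightarrow> G r \<ge> Bd"
    and K: "compact (K :: 'a set)"
  shows "\<not> stable_on \<alpha> (\<lambda>x::'a. v (norm x)) (UNIV - K)"
proof
  assume stab: "stable_on \<alpha> (\<lambda>x::'a. v (norm x)) (UNIV - K)"
  obtain h h1 h2 C where h: "\<And>t. (h has_real_derivative h1 t) (at t)" "\<And>t. (h1 has_real_derivative h2 t) (at t)"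
    "continuous_on UNIV h2" "\<And>t. t \<le> 0 \<Longrightarrow> h t = 0 \<and> h1 t = 0 \<and> h2 t = 0"
    "\<And>t. t \<ge> 1 \<Longrightarrow> h t = 1 \<and> h1 t = 0 \<and> h2 t = 0" "\<And>t. 0 \<le> h t \<and> h t \<le> 1"
    "\<And>t. \<bar>h1 t\<bar> \<le> C" "\<And>t. \<bar>h2 t\<bar> \<le> C"
    using smooth_cutoff by blast
  have C0: "C \<ge> 0" using h(7)[of 0] by linarith
  let ?n = "real DIM('a)"
  let ?K = "?n * unit_ball_vol ?n"
  have K0: "?K > 0" using unit_ball_vol_pos[of ?n] DIM_positive[where 'a='a] by auto
  have mv: "(\<lambda>x::'a. exp (v (norm x))) \<in> borel_measurable borel"
    by (intro borel_measurable_continuous_onI continuous_intros continuous_on_compose2[OF v(1)]) auto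
  have mv': "(\<lambda>r. exp (v r)) \<in> borel_measurable borel"
    by (intro borel_measurable_continuous_onI continuous_intros v(1))
  obtain \<rho> where \<rho>: "\<rho> > 0" "\<And>x. x \<in> K \<Longrightarrow> norm x \<le> \<rho>"
    using compact_imp_bounded[OF K] by (auto simp: bounded_pos)
  \<comment> \<open>The cutoff starts at logarithmic radius T - 1, already outside \<open>K\<close>;
    the plateau starts at T, where the derivative of \<open>G\<close> is available.\<close>
  define T where "T = max (ln R0) (ln \<rho>) + 2"
  have T: "exp T \<ge> R0" "exp (T - 1) > \<rho>"
  proof -
    have "R0 = exp (ln R0)" "\<rho> = exp (ln \<rho>)" using R0 \<rho> by auto
    moreover have "exp (ln R0) \<le> exp T" "exp (ln \<rho>) < exp (T - 1)" by (auto simp: T_def)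
    ultimately show "exp T \<ge> R0" "exp (T - 1) > \<rho>" by linarith+
  qed
  \<comment> \<open>The exponent in s = r^2, so that s^p = r^(-(N-4)/2).\<close>
  define p where "p = - (?n - 4) / 4"
  \<comment> \<open>Bounds f'' + 2 f' - c f: the three terms are at most 2 C + 2 C^2, 4 C and
    |c|.\<close>
  define M where "M = 6 * C + 2 * C\<^sup>2 + \<bar>c\<bar>"
  have main: "\<theta> * L + Bd - G (exp T) \<le> c\<^sup>2 * L + 2 * M\<^sup>2" if L: "L \<ge> 0" for L
  proof -
    define f where "f t = h (t - T + 1) * h (T + L + 1 - t)" for t
    define f1 where "f1 t = h1 (t - T + 1) * h (T + L + 1 - t) - h (t - T + 1) * h1 (T + L + 1 - t)" for t
    define f2 where "f2 t = h2 (t - T + 1) * h (T + L + 1 - t) - 2 * h1 (t - T + 1) * h1 (T + L + 1 - t) + h (t - T + 1) * h2 (T + L + 1 - t)" for t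
    have l1: "((\<lambda>t. t - T + 1) has_real_derivative 1) (at t)" for t by (auto intro!: derivative_eq_intros)
    have l2: "((\<lambda>t. T + L + 1 - t) has_real_derivative - 1) (at t)" for t by (auto intro!: derivative_eq_intros)
    note ha = DERIV_chain2[OF h(1) l1] and hb = DERIV_chain2[OF h(1) l2] and h1a = DERIV_chain2[OF h(2) l1] and h1b = DERIV_chain2[OF h(2) l2]
    have df: "(f has_real_derivative f1 t) (at t)" for t
      unfolding f_def[abs_def] f1_def by (rule DERIV_cong[OF DERIV_mult[OF ha hb]]) (simp add: algebra_simps)
    have df1: "(f1 has_real_derivative f2 t) (at t)" for t
      unfolding f1_def[abs_def] f2_def
      by (rule DERIV_cong[OF DERIV_diff[OF DERIV_mult[OF h1a hb] DERIV_mult[OF ha h1b]]]) (simp add: algebra_simps)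
    have ch: "continuous_on S h" "continuous_on S h1" "continuous_on S h2" for S
      using h(1,2) continuous_on_subset[OF h(3)] by (auto intro!: continuous_at_imp_continuous_on DERIV_isCont)
    have cf2: "continuous_on UNIV f2"
      unfolding f2_def
      by (intro continuous_intros continuous_on_compose2[OF ch(1), where t = UNIV] continuous_on_compose2[OF ch(2), where t = UNIV]
          continuous_on_compose2[OF ch(3), where t = UNIV]) auto
    have cf: "continuous_on UNIV f" "continuous_on UNIV f1"
      using df df1 by (auto intro!: continuous_at_imp_continuous_on DERIV_isCont)
    have off: "f t = 0 \<and> f1 t = 0 \<and> f2 t = 0" if "t \<le> T - 1 \<or> t \<ge> T + L + 1" for t
      using that h(4)[of "t - T + 1"] h(4)[of "T + L + 1 - t"] by (auto simp: f_def f1_def f2_def)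
    have on: "f t = 1 \<and> f1 t = 0 \<and> f2 t = 0" if "T \<le> t" "t \<le> T + L" for t
      using that h(5)[of "t - T + 1"] h(5)[of "T + L + 1 - t"] by (auto simp: f_def f1_def f2_def)
    \<comment> \<open>The Laplacian of r^(-(N-4)/2) f(ln r) is r^(-N/2) times \<open>Lf\<close> at
      ln r. On the plateau f = 1 it leaves just -c.\<close>
    define Lf where "Lf t = f2 t + 2 * f1 t - c * f t" for t
    have Lf_bd: "(Lf t)\<^sup>2 \<le> M\<^sup>2" for t
    proof -
      let ?a = "t - T + 1" and ?b = "T + L + 1 - t"
      have hb: "\<bar>h u\<bar> \<le> 1" for u using h(6)[of u] by auto
      have m1: "\<bar>x * y\<bar> \<le> a * b" if "\<bar>x\<bar> \<le> a" "\<bar>y\<bar> \<le> b" for x y a b :: real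
        using that unfolding abs_mult by (intro mult_mono) auto
      have f_le: "\<bar>f t\<bar> \<le> 1" unfolding f_def using m1[OF hb hb] by simp
      have f1_le: "\<bar>f1 t\<bar> \<le> 2 * C"
        unfolding f1_def using m1[OF h(7)[of ?a] hb[of ?b]] m1[OF hb[of ?a] h(7)[of ?b]] by linarith
      have "\<bar>f2 t\<bar> \<le> C + 2 * (C * C) + C"
        unfolding f2_def using m1[OF h(8)[of ?a] hb[of ?b]] m1[OF hb[of ?a] h(8)[of ?b]] m1[OF h(7)[of ?a] h(7)[of ?b]]
        by (simp add: mult.assoc)
      moreover have "\<bar>c * f t\<bar> \<le> \<bar>c\<bar> * 1" using f_le by (intro m1) auto
      ultimately have "\<bar>Lf t\<bar> \<le> M"
        unfolding Lf_def M_def power2_eq_square using f1_le by linarith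
      then show ?thesis by (metis abs_le_square_iff abs_ge_self order_trans)
    qed
    \<comment> \<open>The profile vanishes for 0 < s < s0, so its extension by 0 to s at most 0
      remains twice differentiable.\<close>
    define s0 where "s0 = (exp (T - 1))\<^sup>2"
    have s0: "s0 > 0" by (simp add: s0_def)
    have lns: "ln s / 2 \<le> T - 1" if "0 < s" "s \<le> s0" for s
    proof -
      have "ln s \<le> ln s0" using that by simp
      also have "\<dots> = 2 * (T - 1)" unfolding s0_def by (subst ln_realpow) auto
      finally show ?thesis by simp
    qed
    define k where "k s = (if s \<le> 0 then 0 else s powr p * f (ln s / 2))" for s
    define k1 where "k1 s = (if s \<le> 0 then 0 else s powr (p - 1) * (p * f (ln s / 2) + f1 (ln s / 2) / 2))" for s
    define k2 where "k2 s = (if s \<le> 0 then 0 else s powr (p - 1 - 1) *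
        ((p - 1) * (p * f (ln s / 2) + f1 (ln s / 2) / 2) + (p * f1 (ln s / 2) + f2 (ln s / 2) / 2) / 2))" for s
    have d1: "(k has_real_derivative k1 s) (at s)" for s
      unfolding k_def[abs_def] k1_def
    proof (rule has_real_derivative_extend_zero[OF s0])
      show "((\<lambda>s. s powr p * f (ln s / 2)) has_real_derivative s powr (p - 1) * (p * f (ln s / 2) + f1 (ln s / 2) / 2)) (at s)"
        if "s > 0" for s
        by (rule has_real_derivative_powr_times_log[OF df that])
      show "s powr p * f (ln s / 2) = 0" if "0 < s" "s < s0" for s
        using off[of "ln s / 2"] lns[of s] that by simp
    qed
    have dfh: "((\<lambda>t. p * f t + f1 t / 2) has_real_derivative p * f1 t + f2 t / 2) (at t)" for t
      by (intro DERIV_add DERIV_cmult DERIV_cdivide df df1)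
    have d2: "(k1 has_real_derivative k2 s) (at s)" for s
      unfolding k1_def[abs_def] k2_def
    proof (rule has_real_derivative_extend_zero[OF s0])
      show "((\<lambda>s. s powr (p - 1) * (p * f (ln s / 2) + f1 (ln s / 2) / 2)) has_real_derivative s powr (p - 1 - 1) *
        ((p - 1) * (p * f (ln s / 2) + f1 (ln s / 2) / 2) + (p * f1 (ln s / 2) + f2 (ln s / 2) / 2) / 2)) (at s)"
        if "s > 0" for s
        by (rule has_real_derivative_powr_times_log[OF dfh that])
      show "s powr (p - 1) * (p * f (ln s / 2) + f1 (ln s / 2) / 2) = 0" if "0 < s" "s < s0" for s
        using off[of "ln s / 2"] lns[of s] that by simp
    qed
    have c2: "continuous_on {0..} k2"
    proof -
      have a: "continuous_on {..<s0} k2"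
        by (rule continuous_on_eq[OF continuous_on_const[of _ 0]])
          (use off lns in \<open>auto simp: k2_def\<close>)
      have b: "continuous_on {0<..} k2"
      proof (rule continuous_on_eq)
        show "continuous_on {0<..} (\<lambda>s. s powr (p - 1 - 1) *
          ((p - 1) * (p * f (ln s / 2) + f1 (ln s / 2) / 2) + (p * f1 (ln s / 2) + f2 (ln s / 2) / 2) / 2))"
          by (intro continuous_intros continuous_on_compose2[OF cf(1)] continuous_on_compose2[OF cf(2)] continuous_on_compose2[OF cf2]) auto
      qed (auto simp: k2_def)
      have "continuous_on ({..<s0} \<union> {0<..}) k2" by (rule continuous_on_open_Un[OF _ _ a b]) auto
      then show ?thesis by (rule continuous_on_subset) (use s0 in auto)
    qed
    let ?\<phi> = "\<lambda>x::'a. k (x \<bullet> x)"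
    have C2: "C2 ?\<phi>" by (rule C2_radial(1)[OF d1 d2 c2])
    have lap: "laplacian ?\<phi> x = 4 * (x \<bullet> x) * k2 (x \<bullet> x) + 2 * ?n * k1 (x \<bullet> x)" for x
      by (rule C2_radial(2)[OF d1 d2 c2])
    have k_far: "k s = 0" if "s > (exp (T + L + 1))\<^sup>2" for s
    proof -
      have "s > 0" using that by (meson less_trans zero_less_power exp_gt_zero)
      have "ln ((exp (T + L + 1))\<^sup>2) \<le> ln s" using that \<open>s > 0\<close> by (subst ln_le_cancel_iff) auto
      then have "ln s / 2 \<ge> T + L + 1" by (simp add: ln_realpow)
      then show ?thesis using off by (simp add: k_def)
    qed
    have C2c_UNIV: "C2c ?\<phi> UNIV" by (rule C2c_radial[OF C2, of "exp (T + L + 1)"]) (use k_far in auto)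
    have C2c: "C2c ?\<phi> (UNIV - K)"
    proof -
      have "{x. ?\<phi> x \<noteq> 0} \<subseteq> {x. exp (T - 1) \<le> norm x}"
      proof
        fix x assume "x \<in> {x. ?\<phi> x \<noteq> 0}"
        then have nz: "k (x \<bullet> x) \<noteq> 0" by simp
        then have pos: "x \<bullet> x > 0" by (auto simp: k_def split: if_splits)
        have "\<not> x \<bullet> x \<le> s0"
          using nz lns[of "x \<bullet> x"] off[of "ln (x \<bullet> x) / 2"] pos by (auto simp: k_def)
        then have "(exp (T - 1))\<^sup>2 \<le> (norm x)\<^sup>2" by (simp add: s0_def dot_square_norm)
        then show "x \<in> {x. exp (T - 1) \<le> norm x}" using power2_le_imp_le[OF _ norm_ge_zero] by auto
      qed
      moreover have "closed {x::'a. exp (T - 1) \<le> norm x}" by (intro closed_Collect_le continuous_intros)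
      ultimately have "closure {x. ?\<phi> x \<noteq> 0} \<subseteq> {x. exp (T - 1) \<le> norm x}" by (rule closure_minimal)
      then have "closure {x. ?\<phi> x \<noteq> 0} \<subseteq> UNIV - K" using \<rho>(2) T(2) by fastforce
      then show ?thesis using C2c_UNIV by (simp add: C2c_def)
    qed
    have kr: "k (r\<^sup>2) = r powr (2 * p) * f (ln r)" if "r > 0" for r
      using that by (simp add: k_def ln_realpow powr_power powr_powr flip: powr_numeral)
    have lap_r: "4 * r\<^sup>2 * k2 (r\<^sup>2) + 2 * ?n * k1 (r\<^sup>2) = r powr (- ?n / 2) * Lf (ln r)" if "r > 0" for r
    proof -
      have e1: "(r\<^sup>2) powr (p - 1) = r powr (- ?n / 2)"
        using that unfolding p_def powr_numeral[OF less_imp_le[OF that], symmetric] powr_powr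
        by (simp add: field_simps)
      have e2: "r\<^sup>2 * (r\<^sup>2) powr (p - 1 - 1) = (r\<^sup>2) powr (p - 1)"
      proof -
        have "(r\<^sup>2) powr (p - 1 - 1) = (r\<^sup>2) powr (p - 1) / r\<^sup>2"
          using powr_diff[of "r\<^sup>2" "p - 1" 1] that by simp
        then show ?thesis using that by simp
      qed
      have l: "ln (r\<^sup>2) / 2 = ln r" using that by (simp add: ln_realpow)
      have "4 * r\<^sup>2 * k2 (r\<^sup>2) + 2 * ?n * k1 (r\<^sup>2) = 4 * ((r\<^sup>2 * (r\<^sup>2) powr (p - 1 - 1)) *
        ((p - 1) * (p * f (ln r) + f1 (ln r) / 2) + (p * f1 (ln r) + f2 (ln r) / 2) / 2)) +
         2 * ?n * ((r\<^sup>2) powr (p - 1) * (p * f (ln r) + f1 (ln r) / 2))"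
        using that by (simp add: k1_def k2_def l)
      also have "\<dots> = r powr (- ?n / 2) * Lf (ln r)"
        unfolding e2 e1 unfolding Lf_def c(1) p_def by (simp add: field_simps)
      finally show ?thesis .
    qed
    let ?F = "\<lambda>r::real. (4 * r\<^sup>2 * k2 (r\<^sup>2) + 2 * ?n * k1 (r\<^sup>2))\<^sup>2"
    \<comment> \<open>Annuli of logarithmic length b - a. The plateau costs c^2 L and each of the
      two collars of length 1 costs at most M^2.\<close>
    let ?I = "\<lambda>a b r::real. inverse r * indicator {exp a..exp b} r"
    let ?G = "\<lambda>r. ?K * (c\<^sup>2 * ?I T (T + L) r + M\<^sup>2 * ?I (T - 1) T r + M\<^sup>2 * ?I (T + L) (T + L + 1) r)"
    have intI: "has_bochner_integral lborel (?I a b) (ln (exp b) - ln (exp a))" if "a \<le> b" for a b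
    proof (rule has_bochner_integral_FTC_Icc_nonneg)
      show "(ln has_real_derivative inverse x) (at x)" if "x \<in> {exp a..exp b}" for x
        using that less_le_trans[OF exp_gt_zero, of a x] by (intro DERIV_ln) auto
      show "0 \<le> inverse x" if "x \<in> {exp a..exp b}" for x
        using that less_le_trans[OF exp_gt_zero, of a x] by auto
    qed (use that in auto)
    have intG: "has_bochner_integral lborel ?G (?K * (c\<^sup>2 * (ln (exp (T + L)) - ln (exp T)) + M\<^sup>2 * (ln (exp T) - ln (exp (T - 1))) + M\<^sup>2 * (ln (exp (T + L + 1)) - ln (exp (T + L)))))"
      by (intro has_bochner_integral_mult_right has_bochner_integral_add intI) (use L in auto)
    have cF: "continuous_on UNIV ?F"
    proof -
      have ck1: "continuous_on {0..} k1" using d2 by (intro continuous_at_imp_continuous_on ballI DERIV_isCont)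
      have sq: "continuous_on UNIV (\<lambda>r::real. r\<^sup>2)" "(\<lambda>r::real. r\<^sup>2) ` UNIV \<subseteq> {0..}"
        by (auto intro!: continuous_intros)
      show ?thesis
        by (intro continuous_intros continuous_on_compose2[OF ck1 sq] continuous_on_compose2[OF c2 sq])
    qed
    have mF: "?F \<in> borel_measurable borel" by (rule borel_measurable_continuous_onI[OF cF])
    have lap_F: "(laplacian ?\<phi> x)\<^sup>2 = ?F (norm x)" for x unfolding lap by (simp add: dot_square_norm)
    have intF: "integrable lborel (\<lambda>r. ?K * r ^ (DIM('a) - 1) * indicator {0..} r * ?F r)"
    proof -
      have "integrable lborel (\<lambda>x. (laplacian ?\<phi> x)\<^sup>2)"
        using C2c_UNIV by (intro laplacian_sq_integrable) (auto simp: C2c_def)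
      then show ?thesis unfolding lap_F integral_radial(1)[OF mF] .
    qed
    have FG: "?K * r ^ (DIM('a) - 1) * indicator {0..} r * ?F r \<le> ?G r" for r
    proof (cases "r > 0")
      case True
      have D: "real (DIM('a) - 1) = ?n - 1" using DIM_positive[where 'a='a] by linarith
      have "r ^ (DIM('a) - 1) * (r powr (- ?n / 2))\<^sup>2 = r powr (?n - 1) * r powr (- ?n)"
      proof -
        have "r ^ (DIM('a) - 1) = r powr (?n - 1)" using powr_realpow[OF True, of "DIM('a) - 1"] D by simp
        moreover have "(r powr (- ?n / 2))\<^sup>2 = r powr (- ?n)"
          unfolding power2_eq_square powr_add[symmetric] by simp
        ultimately show ?thesis by simp
      qed
      also have "\<dots> = inverse r" unfolding powr_add[symmetric] using True by (simp add: powr_minus)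
      finally have e: "r ^ (DIM('a) - 1) * ?F r = inverse r * (Lf (ln r))\<^sup>2"
        unfolding lap_r[OF True] power_mult_distrib by simp
      have le_exp: "exp a \<le> r \<longleftrightarrow> a \<le> ln r" "r \<le> exp a \<longleftrightarrow> ln r \<le> a" for a
        using exp_le_cancel_iff[of a "ln r"] exp_le_cancel_iff[of "ln r" a] True by auto
      have b: "(Lf (ln r))\<^sup>2 \<le> c\<^sup>2 * indicator {exp T..exp (T + L)} r + M\<^sup>2 * indicator {exp (T - 1)..exp T} r
         + M\<^sup>2 * indicator {exp (T + L)..exp (T + L + 1)} r"
      proof -
        consider "ln r \<le> T - 1 \<or> ln r \<ge> T + L + 1" | "T \<le> ln r" "ln r \<le> T + L" | "T - 1 \<le> ln r" "ln r \<le> T"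
          | "T + L \<le> ln r" "ln r \<le> T + L + 1" by linarith
        then show ?thesis
        proof cases
          case 1
          then show ?thesis using off[of "ln r"] by (simp add: Lf_def)
        next
          case 2
          then have "(Lf (ln r))\<^sup>2 = c\<^sup>2" using on[of "ln r"] by (simp add: Lf_def)
          then show ?thesis using 2 by (simp add: le_exp indicator_def)
        next
          case 3
          then have "(Lf (ln r))\<^sup>2 \<le> 0 + M\<^sup>2 * indicator {exp (T - 1)..exp T} r + 0"
            using Lf_bd[of "ln r"] by (simp add: le_exp)
          also have "\<dots> \<le> c\<^sup>2 * indicator {exp T..exp (T + L)} r + M\<^sup>2 * indicator {exp (T - 1)..exp T} r
            + M\<^sup>2 * indicator {exp (T + L)..exp (T + L + 1)} r" by (intro add_mono) auto
          finally show ?thesis .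
        next
          case 4
          then have "(Lf (ln r))\<^sup>2 \<le> 0 + 0 + M\<^sup>2 * indicator {exp (T + L)..exp (T + L + 1)} r"
            using Lf_bd[of "ln r"] by (simp add: le_exp)
          also have "\<dots> \<le> c\<^sup>2 * indicator {exp T..exp (T + L)} r + M\<^sup>2 * indicator {exp (T - 1)..exp T} r
            + M\<^sup>2 * indicator {exp (T + L)..exp (T + L + 1)} r" by (intro add_mono) auto
          finally show ?thesis .
        qed
      qed
      have "?K * r ^ (DIM('a) - 1) * indicator {0..} r * ?F r = ?K * (inverse r * (Lf (ln r))\<^sup>2)"
        using True e by (simp add: mult.assoc)
      also have "\<dots> \<le> ?K * (inverse r * (c\<^sup>2 * indicator {exp T..exp (T + L)} r + M\<^sup>2 * indicator {exp (T - 1)..exp T} r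
         + M\<^sup>2 * indicator {exp (T + L)..exp (T + L + 1)} r))"
        using b True K0 by (intro mult_left_mono) auto
      also have "\<dots> = ?G r" by (simp add: algebra_simps)
      finally show ?thesis .
    next
      case False
      then have "\<not> exp a \<le> r" for a using exp_gt_zero[of a] by linarith
      then have "?G r = 0" by simp
      moreover have "?K * r ^ (DIM('a) - 1) * indicator {0..} r * ?F r = 0"
      proof (cases "r = 0")
        case True
        have "?F 0 = 0" by (simp add: k1_def)
        then show ?thesis unfolding True by simp
      next
        case neg: False
        then have "indicator {0..} r = (0::real)" using False by simp
        then show ?thesis by simp
      qed
      ultimately show ?thesis by linarith
    qed
    have upper: "(LINT x|lborel. (laplacian ?\<phi> x)\<^sup>2) \<le> ?K * (c\<^sup>2 * L + 2 * M\<^sup>2)"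
    proof -
      have "(LINT x|lborel. (laplacian ?\<phi> x)\<^sup>2) = (LINT r|lborel. ?K * r ^ (DIM('a) - 1) * indicator {0..} r * ?F r)"
        unfolding lap_F by (rule integral_radial(2)[OF mF])
      also have "\<dots> \<le> (LINT r|lborel. ?G r)"
        by (rule integral_mono[OF intF integrable.intros[OF intG] FG])
      also have "\<dots> = ?K * (c\<^sup>2 * L + 2 * M\<^sup>2)"
        unfolding has_bochner_integral_integral_eq[OF intG] by (simp add: algebra_simps)
      finally show ?thesis .
    qed
    let ?V = "\<lambda>r. r powr \<alpha> * exp (v r) * (k (r\<^sup>2))\<^sup>2"
    have ck0: "continuous_on UNIV k" by (intro continuous_at_imp_continuous_on ballI DERIV_isCont[OF d1])
    have ck: "continuous_on UNIV (\<lambda>r. k (r\<^sup>2))"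
      by (rule continuous_on_compose2[OF ck0 _ subset_UNIV]) (intro continuous_intros)
    have mV: "?V \<in> borel_measurable borel" using mv' borel_measurable_continuous_onI[OF ck] by simp
    have V_eq: "norm x powr \<alpha> * exp (v (norm x)) * (?\<phi> x)\<^sup>2 = ?V (norm x)" for x :: 'a by (simp add: dot_square_norm)
    have intV: "integrable (lborel::'a measure) (\<lambda>x. ?V (norm x))"
    proof -
      have bd: "\<exists>B. \<forall>x::'a. \<bar>exp (v (norm x)) * (?\<phi> x)\<^sup>2\<bar> \<le> B"
      proof -
        have "bounded ((\<lambda>r. k (r\<^sup>2)) ` {0..exp (T + L + 1)})"
          using continuous_on_subset[OF ck] by (intro compact_imp_bounded compact_continuous_image) auto
        then obtain B where B: "\<And>r. r \<in> {0..exp (T + L + 1)} \<Longrightarrow> \<bar>k (r\<^sup>2)\<bar> \<le> B" "B > 0"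
          unfolding bounded_pos by (metis image_eqI real_norm_def)
        have kB: "\<bar>k ((norm x)\<^sup>2)\<bar> \<le> B" for x :: 'a
        proof (cases "norm x \<le> exp (T + L + 1)")
          case False
          then show ?thesis using k_far[of "(norm x)\<^sup>2"] B(2) power_strict_mono[of "exp (T + L + 1)" "norm x" 2] by auto
        qed (use B in auto)
        have "\<bar>exp (v (norm x)) * (?\<phi> x)\<^sup>2\<bar> \<le> 1 * B\<^sup>2" for x :: 'a
        proof -
          have "(?\<phi> x)\<^sup>2 \<le> B\<^sup>2" using kB[of x] B(2) by (simp add: dot_square_norm abs_le_square_iff[symmetric])
          then show ?thesis unfolding abs_mult using v(2)[of "norm x"] by (intro mult_mono) auto
        qed
        then show ?thesis by blast
      qed
      then obtain B where bd: "\<And>x::'a. \<bar>exp (v (norm x)) * (?\<phi> x)\<^sup>2\<bar> \<le> B" by blast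
      have z: "exp (v (norm x)) * (?\<phi> x)\<^sup>2 = 0" if "norm x > exp (T + L + 1)" for x :: 'a
        using k_far[of "x \<bullet> x"] power_strict_mono[OF that, of 2] by (auto simp: dot_square_norm)
      have m: "(\<lambda>x::'a. exp (v (norm x)) * (?\<phi> x)\<^sup>2) \<in> borel_measurable borel"
      proof -
        have "continuous_on UNIV ?\<phi>"
          by (rule continuous_on_compose2[OF ck0 _ subset_UNIV]) (intro continuous_intros)
        from borel_measurable_continuous_onI[OF this] show ?thesis using mv by simp
      qed
      have "integrable lborel (\<lambda>x::'a. norm x powr \<alpha> * (exp (v (norm x)) * (?\<phi> x)\<^sup>2))"
        by (rule integrable_weight_compact_support[OF \<alpha> m bd z])
      then show ?thesis by (simp add: dot_square_norm mult.assoc)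
    qed
    let ?E = "\<lambda>r. r powr (4 + \<alpha>) * exp (v r) / r"
    have intE: "has_bochner_integral lborel (\<lambda>r. ?E r * indicator {exp T..exp (T + L)} r)
        ((G (exp (T + L)) + \<theta> * ln (exp (T + L))) - (G (exp T) + \<theta> * ln (exp T)))"
    proof (rule has_bochner_integral_FTC_Icc_nonneg)
      fix r assume r: "r \<in> {exp T..exp (T + L)}"
      then have r0: "r > 0" using less_le_trans[OF exp_gt_zero, of T r] by auto
      show "((\<lambda>r. G r + \<theta> * ln r) has_real_derivative ?E r) (at r)"
        by (rule DERIV_cong[OF DERIV_add[OF G DERIV_cmult[OF DERIV_ln[OF r0]]]])
          (use r r0 T in \<open>auto simp: field_simps\<close>)
      show "0 \<le> ?E r" using r0 by auto
    qed (use mv' L in auto)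
    have lower: "?K * (\<theta> * L + Bd - G (exp T)) \<le> (LINT x|(lborel::'a measure). ?V (norm x))"
    proof -
      have "exp (T + L) \<ge> R0" using T(1) L by (meson exp_le_cancel_iff le_add_same_cancel1 order_trans)
      then have "?K * (\<theta> * L + Bd - G (exp T)) \<le> ?K * ((G (exp (T + L)) + \<theta> * ln (exp (T + L))) - (G (exp T) + \<theta> * ln (exp T)))"
        using K0 Gb by (intro mult_left_mono) (auto simp: algebra_simps)
      also have "\<dots> = (LINT r|lborel. ?K * (?E r * indicator {exp T..exp (T + L)} r))"
        by (rule has_bochner_integral_integral_eq[symmetric], intro has_bochner_integral_mult_right intE)
      also have "\<dots> \<le> (LINT r|lborel. ?K * r ^ (DIM('a) - 1) * indicator {0..} r * ?V r)"
      proof (rule integral_mono)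
        show "integrable lborel (\<lambda>r. ?K * (?E r * indicator {exp T..exp (T + L)} r))"
          using intE by (intro integrable_mult_right) (simp only: has_bochner_integral_iff)
        show "integrable lborel (\<lambda>r. ?K * r ^ (DIM('a) - 1) * indicator {0..} r * ?V r)"
          using intV unfolding integral_radial(1)[OF mV] .
        fix r :: real
        show "?K * (?E r * indicator {exp T..exp (T + L)} r) \<le> ?K * r ^ (DIM('a) - 1) * indicator {0..} r * ?V r"
        proof (cases "r \<in> {exp T..exp (T + L)}")
          case True
          then have r0: "r > 0" using less_le_trans[OF exp_gt_zero, of T r] by auto
          have "T \<le> ln r" "ln r \<le> T + L" using True r0 exp_le_cancel_iff[of T "ln r"] exp_le_cancel_iff[of "ln r" "T + L"] by auto
          then have kk: "k (r\<^sup>2) = r powr (2 * p)" using kr[OF r0] on[of "ln r"] by simp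
          have D: "real (DIM('a) - 1) = ?n - 1" using DIM_positive[where 'a='a] by linarith
          have "r ^ (DIM('a) - 1) * (r powr \<alpha> * (r powr (2 * p))\<^sup>2) = r powr (?n - 1) * (r powr \<alpha> * r powr (4 * p))"
          proof -
            have "r ^ (DIM('a) - 1) = r powr (?n - 1)" using powr_realpow[OF r0, of "DIM('a) - 1"] D by simp
            moreover have "(r powr (2 * p))\<^sup>2 = r powr (4 * p)"
              unfolding power2_eq_square powr_add[symmetric] by simp
            ultimately show ?thesis by simp
          qed
          also have "\<dots> = r powr (4 + \<alpha> - 1)"
          proof -
            have "?n - 1 + (\<alpha> + 4 * p) = 4 + \<alpha> - 1" by (simp add: p_def field_simps)
            then show ?thesis unfolding powr_add[symmetric] by (simp only:)
          qed
          also have "\<dots> = r powr (4 + \<alpha>) / r" using r0 by (subst powr_diff) simp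
          finally have "r powr (4 + \<alpha>) / r = r ^ (DIM('a) - 1) * (r powr \<alpha> * (r powr (2 * p))\<^sup>2)" ..
          then have "?K * (r powr (4 + \<alpha>) / r * exp (v r)) = ?K * (r ^ (DIM('a) - 1) * (r powr \<alpha> * (r powr (2 * p))\<^sup>2) * exp (v r))" by simp
          then show ?thesis using True r0 by (simp add: kk mult_ac)
        next
          case False
          then show ?thesis using K0 by (auto simp: indicator_def)
        qed
      qed
      also have "\<dots> = (LINT x|(lborel::'a measure). ?V (norm x))"
        by (rule integral_radial(2)[OF mV, symmetric])
      finally show ?thesis .
    qed
    have "(LINT x|(lborel::'a measure). ?V (norm x)) \<le> (LINT x|lborel. (laplacian ?\<phi> x)\<^sup>2)"
      using stab C2c unfolding stable_on_iff V_eq[symmetric] by blast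
    with lower upper have "?K * (\<theta> * L + Bd - G (exp T)) \<le> ?K * (c\<^sup>2 * L + 2 * M\<^sup>2)" by linarith
    then show ?thesis using K0 mult_le_cancel_left_pos by blast
  qed
  \<comment> \<open>\<open>q\<close> exceeds all terms independent of L by 1, and L is chosen so
    that the gap (\<theta> - c^2) L equals \<open>q\<close>.\<close>
  define q where "q = \<bar>2 * M\<^sup>2 - Bd + G (exp T)\<bar> + 1"
  define L where "L = q / (\<theta> - c\<^sup>2)"
  have "L \<ge> 0" using c by (simp add: q_def L_def)
  from main[OF this] have "(\<theta> - c\<^sup>2) * L \<le> 2 * M\<^sup>2 - Bd + G (exp T)"
    by (simp add: left_diff_distrib)
  moreover have "(\<theta> - c\<^sup>2) * L = q" using c by (simp add: L_def)
  ultimately show False by (simp add: q_def)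
qed

section \<open>Radial integral operators\<close>


definition radial_moment :: "real \<Rightarrow> (real \<Rightarrow> real) \<Rightarrow> real \<Rightarrow> real" where
  "radial_moment e h s = integral {0..s} (\<lambda>t. t powr e * h t)"

text \<open>Inverts the radial Laplacian with zero value and slope at 0: v =
  \<open>radial_op N e h\<close> has Laplacian r^(e-N+1) h, and \<open>radial_moment\<close> is
  r^(N-1) v'. The exponent e = N-1 serves the equation for v, and e = N-1+\<alpha> the one for
  w.\<close>

definition radial_op :: "nat \<Rightarrow> real \<Rightarrow> (real \<Rightarrow> real) \<Rightarrow> real \<Rightarrow> real" where
  "radial_op N e h r = integral {0..r} (\<lambda>s. s powr (1 - real N) * radial_moment e h s)"

text \<open>Weaker than continuity because a pointwise limit of the iteration is at first only known
  to be measurable and locally bounded.\<close>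

definition locally_bounded_borel :: "(real \<Rightarrow> real) \<Rightarrow> bool" where
  "locally_bounded_borel h \<longleftrightarrow> h \<in> borel_measurable borel \<and> (\<forall>R. \<exists>C. \<forall>t\<in>{0..R}. \<bar>h t\<bar> \<le> C)"

lemma locally_bounded_borel_continuous:
  assumes "continuous_on UNIV h" shows "locally_bounded_borel h"
  unfolding locally_bounded_borel_def
proof (intro conjI allI)
  show "h \<in> borel_measurable borel" by (rule borel_measurable_continuous_onI[OF assms])
  fix R :: real
  have "bounded (h ` {0..R})"
    using continuous_on_subset[OF assms] by (intro compact_imp_bounded compact_continuous_image) auto
  then show "\<exists>C. \<forall>t\<in>{0..R}. \<bar>h t\<bar> \<le> C" by (auto simp: bounded_iff)
qed

lemma locally_bounded_borel_const [simp]: "locally_bounded_borel (\<lambda>_. c)"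
  by (rule locally_bounded_borel_continuous) auto

lemma locally_bounded_borel_cmult: "locally_bounded_borel h \<Longrightarrow> locally_bounded_borel (\<lambda>t. c * h t)"
  unfolding locally_bounded_borel_def
proof (intro conjI allI)
  assume h: "h \<in> borel_measurable borel \<and> (\<forall>R. \<exists>C. \<forall>t\<in>{0..R}. \<bar>h t\<bar> \<le> C)"
  then have [measurable]: "h \<in> borel_measurable borel" by blast
  show "(\<lambda>t. c * h t) \<in> borel_measurable borel" by measurable
  fix R
  obtain C where "\<forall>t\<in>{0..R}. \<bar>h t\<bar> \<le> C" using h by blast
  then show "\<exists>C. \<forall>t\<in>{0..R}. \<bar>c * h t\<bar> \<le> C"
    by (intro exI[of _ "\<bar>c\<bar> * C"]) (auto simp: abs_mult intro!: mult_left_mono)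
qed

text \<open>The condition on \<open>e\<close> makes s^(1-N) s^(e+1) integrable at 0, so the outer
  integral converges for locally bounded data.\<close>

locale radial_operator =
  fixes N :: nat and e :: real
  assumes N3: "N \<ge> 3" and e: "real N - 3 < e"
begin

lemma e_pos: "e > 0" using N3 e by linarith

lemma mom_set_integrable:
  assumes "locally_bounded_borel h"
  shows "set_integrable lborel {0..s} (\<lambda>t. t powr e * h t)"
proof -
  obtain C where C: "\<And>t. t \<in> {0..s} \<Longrightarrow> \<bar>h t\<bar> \<le> C"
    using assms unfolding locally_bounded_borel_def by metis
  show ?thesis
    unfolding set_integrable_def
  proof (rule Bochner_Integration.integrable_bound[where f = "\<lambda>t. (s powr e * C) * indicator {0..s} t"])
    show "integrable lborel (\<lambda>t. (s powr e * C) * indicator {0..s} t)"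
      by (intro integrable_mult_right integrable_real_indicator) (auto simp: emeasure_lborel_Icc_eq)
    have [measurable]: "h \<in> borel_measurable borel"
      using assms by (simp add: locally_bounded_borel_def)
    show "(\<lambda>t. indicator {0..s} t *\<^sub>R (t powr e * h t)) \<in> borel_measurable lborel"
      by simp
    show "AE t in lborel. norm (indicator {0..s} t *\<^sub>R (t powr e * h t)) \<le> norm (s powr e * C * indicator {0..s} t)"
    proof (intro AE_I2)
      fix t :: real
      show "norm (indicator {0..s} t *\<^sub>R (t powr e * h t)) \<le> norm (s powr e * C * indicator {0..s} t)"
      proof (cases "t \<in> {0..s}")
        case True
        have "t powr e * \<bar>h t\<bar> \<le> s powr e * C"
          using True C[OF True] e_pos by (intro mult_mono powr_mono2) auto
        then show ?thesis using True C[OF True] by (simp add: abs_mult)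
      qed simp
    qed
  qed
qed

lemma mom_integrable_on: "locally_bounded_borel h \<Longrightarrow> (\<lambda>t. t powr e * h t) integrable_on {0..s}"
  using set_borel_integral_eq_integral(1)[OF mom_set_integrable] .

lemma mom_LBINT: "locally_bounded_borel h \<Longrightarrow> s \<ge> 0 \<Longrightarrow> (LBINT t=0..s. t powr e * h t) = radial_moment e h s"
  using interval_integral_eq_integral[of 0 s] mom_set_integrable[of h s] by (simp add: radial_moment_def zero_ereal_def)

lemma mom_const: "s \<ge> 0 \<Longrightarrow> radial_moment e (\<lambda>_. c) s = c * s powr (e + 1) / (e + 1)"
proof -
  assume "s \<ge> 0"
  then have "((\<lambda>t. t powr e * c) has_integral (s powr (e + 1) / (e + 1) * c)) {0..s}"
    using e_pos by (intro has_integral_mult_left has_integral_powr_from_0) auto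
  then show ?thesis unfolding radial_moment_def by (simp only: integral_unique) simp
qed

lemma mom_mono:
  assumes "locally_bounded_borel h" "locally_bounded_borel k" "\<And>t. 0 \<le> t \<Longrightarrow> t \<le> s \<Longrightarrow> h t \<le> k t"
  shows "radial_moment e h s \<le> radial_moment e k s"
  unfolding radial_moment_def using assms
  by (intro integral_le mom_integrable_on) (auto intro!: mult_left_mono)

lemma mom_abs_le:
  assumes "locally_bounded_borel h" "s \<ge> 0" "\<And>t. 0 \<le> t \<Longrightarrow> t \<le> s \<Longrightarrow> \<bar>h t\<bar> \<le> C"
  shows "\<bar>radial_moment e h s\<bar> \<le> C * s powr (e + 1) / (e + 1)"
proof -
  have "radial_moment e h s \<le> radial_moment e (\<lambda>_. C) s" "radial_moment e (\<lambda>_. - C) s \<le> radial_moment e h s"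
    using assms(1,3) by (intro mom_mono; force simp: abs_le_iff)+
  then show ?thesis using assms(2) by (simp add: mom_const)
qed

lemma mom_continuous: "locally_bounded_borel h \<Longrightarrow> continuous_on {0..R} (radial_moment e h)"
  unfolding radial_moment_def using indefinite_integral_continuous_1[OF mom_integrable_on] .

lemma mom_has_derivative:
  assumes "continuous_on UNIV h" "s > 0"
  shows "(radial_moment e h has_real_derivative s powr e * h s) (at s)"
proof -
  have "continuous_on {0..s + 1} (\<lambda>t. t powr e * h t)"
    using e_pos by (intro continuous_intros continuous_on_powr' continuous_on_subset[OF assms(1)]) auto
  then have "((\<lambda>u. integral {0..u} (\<lambda>t. t powr e * h t)) has_real_derivative s powr e * h s) (at s within {0..s + 1})"
    using assms(2) by (intro integral_has_real_derivative) auto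
  moreover have "at s within {0..s + 1} = at s"
    using assms(2) by (intro at_within_interior) auto
  ultimately show ?thesis unfolding radial_moment_def[abs_def] by simp
qed

lemma rop_integrand_abs_le:
  assumes "locally_bounded_borel h" "s \<ge> 0" "\<And>t. 0 \<le> t \<Longrightarrow> t \<le> s \<Longrightarrow> \<bar>h t\<bar> \<le> C"
  shows "\<bar>s powr (1 - real N) * radial_moment e h s\<bar> \<le> C / (e + 1) * s powr (e + 2 - real N)"
proof -
  have "\<bar>s powr (1 - real N) * radial_moment e h s\<bar> = s powr (1 - real N) * \<bar>radial_moment e h s\<bar>" by (simp add: abs_mult)
  also have "\<dots> \<le> s powr (1 - real N) * (C * s powr (e + 1) / (e + 1))"
    by (intro mult_left_mono mom_abs_le assms) auto
  also have "\<dots> = C / (e + 1) * (s powr (1 - real N) * s powr (e + 1))" by simp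
  also have "s powr (1 - real N) * s powr (e + 1) = s powr (e + 2 - real N)"
    unfolding powr_add[symmetric] by (simp add: algebra_simps)
  finally show ?thesis .
qed

lemma set_integrable_powr: "r \<ge> 0 \<Longrightarrow> set_integrable lborel {0..r} (\<lambda>s. c * s powr (e + 2 - real N))"
proof -
  assume r: "r \<ge> 0"
  have "(\<lambda>s. s powr (e + 2 - real N)) absolutely_integrable_on {0..r}"
    using r e by (intro nonnegative_absolutely_integrable_1 integrable_on_powr_from_0) auto
  then have "set_integrable lborel {0..r} (\<lambda>s. s powr (e + 2 - real N))"
    unfolding set_integrable_def by (subst (asm) integrable_completion) auto
  then show ?thesis by (rule set_integrable_mult_right)
qed

lemma rop_set_integrable:
  assumes h: "locally_bounded_borel h"
  shows "set_integrable lborel {0..r} (\<lambda>s. s powr (1 - real N) * radial_moment e h s)"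
proof (cases "r \<ge> 0")
  case True
  obtain C where C: "\<And>t. t \<in> {0..r} \<Longrightarrow> \<bar>h t\<bar> \<le> C"
    using h unfolding locally_bounded_borel_def by metis
  show ?thesis
  proof (rule set_integrable_bound[OF set_integrable_powr[OF True, of "C / (e + 1)"]])
    have "(\<lambda>s. indicator {0..r} s *\<^sub>R radial_moment e h s) \<in> borel_measurable borel"
      by (rule borel_measurable_continuous_on_indicator[OF _ mom_continuous[OF h]]) auto
    then have "(\<lambda>s. s powr (1 - real N) * (indicator {0..r} s *\<^sub>R radial_moment e h s)) \<in> borel_measurable borel" by simp
    then show "set_borel_measurable lborel {0..r} (\<lambda>s. s powr (1 - real N) * radial_moment e h s)"
      unfolding set_borel_measurable_def by (simp add: mult_ac)
    show "AE s in lborel. s \<in> {0..r} \<longrightarrow> norm (s powr (1 - real N) * radial_moment e h s) \<le> norm (C / (e + 1) * s powr (e + 2 - real N))"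
    proof (intro AE_I2 impI)
      fix s assume s: "s \<in> {0..r}"
      have "\<bar>s powr (1 - real N) * radial_moment e h s\<bar> \<le> C / (e + 1) * s powr (e + 2 - real N)"
        using s C by (intro rop_integrand_abs_le h) auto
      then show "norm (s powr (1 - real N) * radial_moment e h s) \<le> norm (C / (e + 1) * s powr (e + 2 - real N))"
        unfolding real_norm_def using abs_ge_self order_trans by blast
    qed
  qed
qed (simp add: set_integrable_def)

lemma rop_integrable_on:
  "locally_bounded_borel h \<Longrightarrow> (\<lambda>s. s powr (1 - real N) * radial_moment e h s) integrable_on {0..r}"
  using set_borel_integral_eq_integral(1)[OF rop_set_integrable] .

lemma rop_LBINT:
  assumes h: "locally_bounded_borel h" and r: "r \<ge> 0"
  shows "(LBINT s=0..r. s powr (1 - real N) * (LBINT t=0..s. t powr e * h t)) = radial_op N e h r"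
proof -
  have "(LBINT s=0..r. s powr (1 - real N) * (LBINT t=0..s. t powr e * h t))
      = (LBINT s=0..r. s powr (1 - real N) * radial_moment e h s)"
    using r by (intro interval_integral_cong) (auto simp: mom_LBINT[OF h, unfolded zero_ereal_def] einterval_iff zero_ereal_def)
  also have "\<dots> = radial_op N e h r"
    using interval_integral_eq_integral[OF r rop_set_integrable[OF h]] by (simp add: radial_op_def zero_ereal_def)
  finally show ?thesis .
qed

text \<open>The integral over an empty or one-point interval is 0. This convention extends solutions
  to negative radii by constants and allows continuity statements on the whole line.\<close>

lemma rop_neg: "r \<le> 0 \<Longrightarrow> radial_op N e h r = 0"
  by (cases "r = 0") (auto simp: radial_op_def)

lemma rop_const:
  assumes "r \<ge> 0"
  shows "radial_op N e (\<lambda>_. c) r = c * r powr (e + 3 - real N) / ((e + 1) * (e + 3 - real N))"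
proof -
  have "((\<lambda>s. c / (e + 1) * s powr (e + 2 - real N)) has_integral c / (e + 1) * (r powr (e + 2 - real N + 1) / (e + 2 - real N + 1))) {0..r}"
    using assms e by (intro has_integral_mult_right has_integral_powr_from_0) auto
  moreover have "c / (e + 1) * s powr (e + 2 - real N) = s powr (1 - real N) * radial_moment e (\<lambda>_. c) s" if "s \<in> {0..r}" for s
  proof -
    have "s powr (1 - real N) * s powr (e + 1) = s powr (e + 2 - real N)"
      unfolding powr_add[symmetric] by (simp add: algebra_simps)
    then show ?thesis using that by (simp add: mom_const)
  qed
  ultimately have "((\<lambda>s. s powr (1 - real N) * radial_moment e (\<lambda>_. c) s) has_integral c / (e + 1) * (r powr (e + 2 - real N + 1) / (e + 2 - real N + 1))) {0..r}"
    by (rule has_integral_eq[rotated])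
  then show ?thesis unfolding radial_op_def by (simp add: integral_unique algebra_simps)
qed

lemma rop_mono:
  assumes "locally_bounded_borel h" "locally_bounded_borel k" "\<And>t. 0 \<le> t \<Longrightarrow> t \<le> r \<Longrightarrow> h t \<le> k t"
  shows "radial_op N e h r \<le> radial_op N e k r"
  unfolding radial_op_def using assms
  by (intro integral_le rop_integrable_on) (auto intro!: mult_left_mono mom_mono)

lemma rop_abs_le:
  assumes "locally_bounded_borel h" "r \<ge> 0" "\<And>t. 0 \<le> t \<Longrightarrow> t \<le> r \<Longrightarrow> \<bar>h t\<bar> \<le> C"
  shows "\<bar>radial_op N e h r\<bar> \<le> C * r powr (e + 3 - real N) / ((e + 1) * (e + 3 - real N))"
proof -
  have "radial_op N e h r \<le> radial_op N e (\<lambda>_. C) r" "radial_op N e (\<lambda>_. - C) r \<le> radial_op N e h r"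
    using assms(1,3) by (intro rop_mono; force simp: abs_le_iff)+
  then show ?thesis using assms(2) by (simp add: rop_const)
qed

lemma rop_cong:
  assumes "\<And>t. 0 \<le> t \<Longrightarrow> t \<le> r \<Longrightarrow> h t = k t"
  shows "radial_op N e h r = radial_op N e k r"
  unfolding radial_op_def radial_moment_def using assms by (intro integral_cong) (auto intro!: integral_cong)

lemma rop_continuous: "locally_bounded_borel h \<Longrightarrow> continuous_on UNIV (radial_op N e h)"
proof -
  assume h: "locally_bounded_borel h"
  have "isCont (radial_op N e h) r" for r
  proof -
    have "continuous_on {0..\<bar>r\<bar> + 1} (radial_op N e h)"
      unfolding radial_op_def by (rule indefinite_integral_continuous_1[OF rop_integrable_on[OF h]])
    moreover have "continuous_on {- \<bar>r\<bar> - 1..0} (radial_op N e h)"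
      by (rule continuous_on_eq[OF continuous_on_const[of _ 0]]) (simp add: rop_neg)
    ultimately have "continuous_on ({- \<bar>r\<bar> - 1..0} \<union> {0..\<bar>r\<bar> + 1}) (radial_op N e h)"
      by (intro continuous_on_closed_Un) auto
    moreover have "{- \<bar>r\<bar> - 1..0} \<union> {0..\<bar>r\<bar> + 1} = {- \<bar>r\<bar> - 1..\<bar>r\<bar> + 1}" by auto
    moreover have "r \<in> interior {- \<bar>r\<bar> - 1..\<bar>r\<bar> + 1}" by (simp add: abs_real_def)
    ultimately show ?thesis by (metis continuous_on_interior)
  qed
  then show ?thesis by (simp add: continuous_on_eq_continuous_at)
qed

lemma rop_has_derivative:
  assumes h: "locally_bounded_borel h" and r: "r > 0"
  shows "(radial_op N e h has_real_derivative r powr (1 - real N) * radial_moment e h r) (at r)"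
proof -
  let ?f = "\<lambda>s. s powr (1 - real N) * radial_moment e h s"
  \<comment> \<open>The primitive is restarted at r/2 because the weight s^(1-N) is singular at
    0.\<close>
  have "continuous_on {r / 2..r + 1} ?f"
    using r by (intro continuous_intros continuous_on_subset[OF mom_continuous[OF h, of "r + 1"]]) auto
  then have "((\<lambda>u. integral {r / 2..u} ?f) has_real_derivative ?f r) (at r within {r / 2..r + 1})"
    using r by (intro integral_has_real_derivative) auto
  moreover have "at r within {r / 2..r + 1} = at r"
    using r by (intro at_within_interior) auto
  ultimately have "((\<lambda>u. radial_op N e h (r / 2) + integral {r / 2..u} ?f) has_real_derivative ?f r) (at r)"
    by (auto intro!: derivative_eq_intros)
  then show ?thesis
  proof (rule has_field_derivative_transform_within_open[of _ _ _ "{r / 2<..}"])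
    fix u assume "u \<in> {r / 2<..}"
    then show "radial_op N e h (r / 2) + integral {r / 2..u} ?f = radial_op N e h u"
      unfolding radial_op_def using r by (intro Henstock_Kurzweil_Integration.integral_combine rop_integrable_on h) auto
  qed (use r in auto)
qed

lemma rop_tendsto:
  assumes h: "\<And>n::nat. locally_bounded_borel (h n)" and k: "locally_bounded_borel k" and r: "r \<ge> 0"
    and C: "\<And>n t. 0 \<le> t \<Longrightarrow> t \<le> r \<Longrightarrow> \<bar>h n t\<bar> \<le> C"
    and lim: "\<And>t. 0 \<le> t \<Longrightarrow> t \<le> r \<Longrightarrow> (\<lambda>n. h n t) \<longlonglongrightarrow> k t"
  shows "(\<lambda>n. radial_op N e (h n) r) \<longlonglongrightarrow> radial_op N e k r"
proof -
  have mlim: "(\<lambda>n. radial_moment e (h n) s) \<longlonglongrightarrow> radial_moment e k s" if s: "s \<in> {0..r}" for s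
    unfolding radial_moment_def
  proof (rule dominated_convergence(2)[where h = "\<lambda>t. t powr e * C"])
    show "(\<lambda>t. t powr e * h n t) integrable_on {0..s}" for n by (rule mom_integrable_on[OF h])
    show "(\<lambda>t. t powr e * C) integrable_on {0..s}" by (rule mom_integrable_on) simp
    show "norm (t powr e * h n t) \<le> t powr e * C" if "t \<in> {0..s}" for n t
      using C[of t n] that s by (auto simp: abs_mult intro!: mult_left_mono)
    show "(\<lambda>n. t powr e * h n t) \<longlonglongrightarrow> t powr e * k t" if "t \<in> {0..s}" for t
      using lim[of t] that s by (intro tendsto_intros) auto
  qed
  show ?thesis
    unfolding radial_op_def
  proof (rule dominated_convergence(2)[where h = "\<lambda>s. C / (e + 1) * s powr (e + 2 - real N)"])
    show "(\<lambda>s. s powr (1 - real N) * radial_moment e (h n) s) integrable_on {0..r}" for n by (rule rop_integrable_on[OF h])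
    show "(\<lambda>s. C / (e + 1) * s powr (e + 2 - real N)) integrable_on {0..r}"
      using set_borel_integral_eq_integral(1)[OF set_integrable_powr[OF r]] .
    show "norm (s powr (1 - real N) * radial_moment e (h n) s) \<le> C / (e + 1) * s powr (e + 2 - real N)" if "s \<in> {0..r}" for n s
      unfolding real_norm_def using that C by (intro rop_integrand_abs_le h) auto
    show "(\<lambda>n. s powr (1 - real N) * radial_moment e (h n) s) \<longlonglongrightarrow> s powr (1 - real N) * radial_moment e k s" if "s \<in> {0..r}" for s
      by (intro tendsto_intros mlim that)
  qed
qed

end

section \<open>Entire radial solutions\<close>


context radial_operator begin

text \<open>Clipping extends data given on [0,r] to the whole line without changing it there, so
  facts about globally defined functions carry over.\<close>

lemma locally_bounded_borel_clip:
  assumes "continuous_on {0..r} h" "r \<ge> 0"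
  shows "locally_bounded_borel (\<lambda>t. h (max 0 (min t r)))"
  by (rule locally_bounded_borel_continuous, rule continuous_on_compose2[OF assms(1)])
    (use assms(2) in \<open>auto intro!: continuous_intros\<close>)

lemma rop_mono_cont:
  assumes "continuous_on {0..r} h" "continuous_on {0..r} k" "\<And>t. 0 \<le> t \<Longrightarrow> t \<le> r \<Longrightarrow> h t \<le> k t" "r \<ge> 0"
  shows "radial_op N e h r \<le> radial_op N e k r"
proof -
  have "radial_op N e (\<lambda>t. h (max 0 (min t r))) r \<le> radial_op N e (\<lambda>t. k (max 0 (min t r))) r"
    using assms by (intro rop_mono locally_bounded_borel_clip) auto
  moreover have "radial_op N e (\<lambda>t. h (max 0 (min t r))) r = radial_op N e h r" for h
    by (rule rop_cong) (auto simp: max_def min_def)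
  ultimately show ?thesis by simp
qed

lemma rop_LBINT_cont:
  assumes "continuous_on {0..r} h" "r \<ge> 0"
  shows "(LBINT s=0..r. s powr (1 - real N) * (LBINT t=0..s. t powr e * h t)) = radial_op N e h r"
proof -
  let ?h = "\<lambda>t. h (max 0 (min t r))"
  have in_eq: "(LBINT t=0..s. t powr e * h t) = (LBINT t=0..s. t powr e * ?h t)" if "0 \<le> s" "s \<le> r" for s
    using that by (intro interval_integral_cong) (auto simp: einterval_iff max_def min_def zero_ereal_def)
  have "(LBINT s=0..r. s powr (1 - real N) * (LBINT t=0..s. t powr e * h t))
      = (LBINT s=0..r. s powr (1 - real N) * (LBINT t=0..s. t powr e * ?h t))"
    using assms(2) by (intro interval_integral_cong) (auto simp: einterval_iff in_eq[unfolded zero_ereal_def] zero_ereal_def)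
  also have "\<dots> = radial_op N e ?h r" by (rule rop_LBINT[OF locally_bounded_borel_clip[OF assms] assms(2)])
  also have "\<dots> = radial_op N e h r" by (rule rop_cong) (auto simp: max_def min_def)
  finally show ?thesis .
qed

end

text \<open>The equations are imposed for all real r. For negative r the operators vanish, which
  forces v = 0 and w = \<beta> there.\<close>

definition entire_sol :: "nat \<Rightarrow> real \<Rightarrow> real \<Rightarrow> (real \<Rightarrow> real) \<Rightarrow> (real \<Rightarrow> real) \<Rightarrow> bool" where
  "entire_sol N \<alpha> \<beta> v w \<longleftrightarrow> continuous_on UNIV v \<and> continuous_on UNIV w \<and>
    (\<forall>r. v r = radial_op N (real N - 1) w r) \<and>
    (\<forall>r. w r = \<beta> + radial_op N (real N - 1 + \<alpha>) (\<lambda>t. exp (v t)) r)"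

text \<open>The integral system with inequalities on a bounded interval. Solutions on longer
  intervals qualify, and so do solutions with a larger parameter.\<close>

definition supersol :: "nat \<Rightarrow> real \<Rightarrow> real \<Rightarrow> real \<Rightarrow> (real \<Rightarrow> real) \<Rightarrow> (real \<Rightarrow> real) \<Rightarrow> bool" where
  "supersol N \<alpha> \<beta> R v w \<longleftrightarrow> continuous_on {0..R} v \<and> continuous_on {0..R} w \<and>
    (\<forall>r\<in>{0..R}. radial_op N (real N - 1) w r \<le> v r) \<and>
    (\<forall>r\<in>{0..R}. \<beta> + radial_op N (real N - 1 + \<alpha>) (\<lambda>t. exp (v t)) r \<le> w r)"

locale radial_problem =
  fixes N :: nat and \<alpha> :: real
  assumes N3: "N \<ge> 3" and alpha: "\<alpha> > - 2"
begin

sublocale A: radial_operator N "real N - 1"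
  using N3 by unfold_locales auto

sublocale B: radial_operator N "real N - 1 + \<alpha>"
  using N3 alpha by unfold_locales auto

abbreviation "opA \<equiv> radial_op N (real N - 1)"
abbreviation "opB \<equiv> radial_op N (real N - 1 + \<alpha>)"

lemma radial_sol_iff:
  assumes I: "\<And>r. r \<in> I \<Longrightarrow> {0..r} \<subseteq> I" "I \<subseteq> {0..}"
  shows "radial_sol N \<alpha> \<beta> I v w \<longleftrightarrow> continuous_on I v \<and> continuous_on I w \<and>
    (\<forall>r\<in>I. v r = opA w r) \<and> (\<forall>r\<in>I. w r = \<beta> + opB (\<lambda>t. exp (v t)) r)"
proof -
  have A: "(LBINT s=0..r. s powr (1 - real N) * (LBINT t=0..s. t powr (real N - 1) * w t)) = opA w r"
    if "continuous_on I w" "r \<in> I" for r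
    using that I by (intro A.rop_LBINT_cont) (auto intro: continuous_on_subset)
  have B: "(LBINT s=0..r. s powr (1 - real N) * (LBINT t=0..s. t powr (real N - 1 + \<alpha>) * exp (v t))) = opB (\<lambda>t. exp (v t)) r"
    if "continuous_on I v" "r \<in> I" for r
    using that I by (intro B.rop_LBINT_cont) (auto intro!: continuous_intros intro: continuous_on_subset)
  show ?thesis unfolding radial_sol_def using A B by auto
qed

lemma entire_sol_of_radial_sol:
  assumes "radial_sol N \<alpha> \<beta> {0..} v w"
  shows "entire_sol N \<alpha> \<beta> (\<lambda>r. v (max 0 r)) (\<lambda>r. w (max 0 r))"
proof -
  have *: "continuous_on {0..} v" "continuous_on {0..} w" "\<And>r. r \<ge> 0 \<Longrightarrow> v r = opA w r"
    "\<And>r. r \<ge> 0 \<Longrightarrow> w r = \<beta> + opB (\<lambda>t. exp (v t)) r"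
    using assms by (auto simp: radial_sol_iff)
  have c: "continuous_on UNIV (\<lambda>r. f (max 0 r))" if "continuous_on {0..} f" for f :: "real \<Rightarrow> real"
    by (rule continuous_on_compose2[OF that]) (auto intro!: continuous_intros)
  have a: "opA w r = opA (\<lambda>r. w (max 0 r)) r" for r by (rule A.rop_cong) auto
  have b: "opB (\<lambda>t. exp (v t)) r = opB (\<lambda>t. exp (v (max 0 t))) r" for r by (rule B.rop_cong) auto
  have "v (max 0 r) = opA (\<lambda>r. w (max 0 r)) r" for r
    using *(3)[of "max 0 r"] a A.rop_neg by (cases "r \<ge> 0") (auto simp: max_def)
  moreover have "w (max 0 r) = \<beta> + opB (\<lambda>t. exp (v (max 0 t))) r" for r
    using *(4)[of "max 0 r"] b B.rop_neg by (cases "r \<ge> 0") (auto simp: max_def)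
  ultimately show ?thesis unfolding entire_sol_def using c *(1,2) by blast
qed

lemma radial_sol_of_entire_sol:
  assumes "entire_sol N \<alpha> \<beta> v w"
  shows "radial_sol N \<alpha> \<beta> {0..} v w" "radial_sol N \<alpha> \<beta> {0..<R} v w"
proof -
  have *: "continuous_on S v" "continuous_on S w" "v r = opA w r" "w r = \<beta> + opB (\<lambda>t. exp (v t)) r" for S r
    using assms unfolding entire_sol_def by (auto intro: continuous_on_subset)
  show "radial_sol N \<alpha> \<beta> {0..} v w"
    proof (subst radial_sol_iff)
    show "{0..r} \<subseteq> {0..}" for r :: real by auto
  qed (use *(1,2) *(3,4) in \<open>force\<close>)+
  show "radial_sol N \<alpha> \<beta> {0..<R} v w"
  proof (subst radial_sol_iff)
    show "{0..r} \<subseteq> {0..<R}" if "r \<in> {0..<R}" for r using that by auto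
  qed (use *(1,2) *(3,4) in \<open>force\<close>)+
qed

text \<open>Both integral operators preserve order, so iterating from the constant \<beta> increases
  and stays below every supersolution. The iteration itself does not depend on R; supersolutions
  chosen separately for each R therefore give one entire solution, which lies below all of
  them.\<close>

lemma minimal_entire_sol:
  assumes sup: "\<And>R. R \<ge> 0 \<Longrightarrow> \<exists>vb wb. supersol N \<alpha> \<beta> R vb wb"
  obtains v w where "entire_sol N \<alpha> \<beta> v w"
    "\<And>R vb wb r. supersol N \<alpha> \<beta> R vb wb \<Longrightarrow> 0 \<le> r \<Longrightarrow> r \<le> R \<Longrightarrow> v r \<le> vb r \<and> w r \<le> wb r"
proof -
  define F where "F w = (\<lambda>r. \<beta> + opB (\<lambda>t. exp (opA w t)) r)" for w
  define W where "W n = (F ^^ n) (\<lambda>_. \<beta>)" for n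
  have W0: "W 0 = (\<lambda>_. \<beta>)" and WS: "W (Suc n) = F (W n)" for n by (auto simp: W_def)
  have cA: "continuous_on UNIV (opA w)" if "continuous_on UNIV w" for w
    using that by (intro A.rop_continuous locally_bounded_borel_continuous)
  have cW: "continuous_on UNIV (W n)" for n
  proof (induction n)
    case (Suc n)
    show ?case unfolding WS F_def
      by (intro continuous_intros B.rop_continuous locally_bounded_borel_continuous cA Suc)
  qed (simp add: W0)
  have ce: "continuous_on UNIV (\<lambda>t. exp (opA (W n) t))" for n by (intro continuous_intros cA cW)
  note lbW = locally_bounded_borel_continuous[OF cW] and lbe = locally_bounded_borel_continuous[OF ce]
  have mono: "W n r \<le> W (Suc n) r" for n r
  proof (induction n arbitrary: r)
    case 0
    have "opB (\<lambda>_. 0) r \<le> opB (\<lambda>t. exp (opA (W 0) t)) r" using lbe by (intro B.rop_mono) auto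
    moreover have "opB (\<lambda>_. 0) r = 0" by (simp add: radial_op_def radial_moment_def)
    ultimately show ?case by (simp add: WS F_def) (simp add: W0)
  next
    case (Suc n)
    have "opA (W n) t \<le> opA (W (Suc n)) t" for t using Suc lbW by (intro A.rop_mono) auto
    then have "opB (\<lambda>t. exp (opA (W n) t)) r \<le> opB (\<lambda>t. exp (opA (W (Suc n)) t)) r"
      using lbe by (intro B.rop_mono) auto
    then show ?case by (simp add: WS[of n] WS[of "Suc n"] F_def)
  qed
  have upper: "W n r \<le> wb r \<and> opA (W n) r \<le> vb r" if s: "supersol N \<alpha> \<beta> R vb wb" and r: "0 \<le> r" "r \<le> R" for n r R vb wb
    using r
  proof (induction n arbitrary: r)
    have cv: "continuous_on {0..r} vb" and cw: "continuous_on {0..r} wb" if "r \<le> R" for r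
      using s that by (auto simp: supersol_def intro: continuous_on_subset)
    have stepA: "opA (W n) r \<le> vb r" if "\<And>t. 0 \<le> t \<Longrightarrow> t \<le> R \<Longrightarrow> W n t \<le> wb t" "0 \<le> r" "r \<le> R" for n r
    proof -
      have "opA (W n) r \<le> opA wb r"
        using that cw by (intro A.rop_mono_cont continuous_on_subset[OF cW]) auto
      also have "\<dots> \<le> vb r" using s that by (auto simp: supersol_def)
      finally show ?thesis .
    qed
    {
      case 0
      have "opB (\<lambda>_. 0) t \<le> opB (\<lambda>t. exp (vb t)) t" if "0 \<le> t" "t \<le> R" for t
        using that cv by (intro B.rop_mono_cont) (auto intro!: continuous_intros)
      moreover have "opB (\<lambda>_. 0) t = 0" for t by (simp add: radial_op_def radial_moment_def)
      ultimately have "\<beta> \<le> wb t" if "0 \<le> t" "t \<le> R" for t using s that add_increasing2 unfolding supersol_def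
        by (smt (verit) atLeastAtMost_iff)
      then show ?case using 0 stepA[of 0 r] by (simp add: W0)
    next
      case (Suc n)
      have "W (Suc n) t \<le> wb t" if t: "0 \<le> t" "t \<le> R" for t
      proof -
        have "opB (\<lambda>t. exp (opA (W n) t)) t \<le> opB (\<lambda>t. exp (vb t)) t"
          using t cv Suc.IH by (intro B.rop_mono_cont continuous_on_subset[OF ce]) (auto intro!: continuous_intros)
        moreover have "\<beta> + opB (\<lambda>t. exp (vb t)) t \<le> wb t" using s t by (simp add: supersol_def)
        ultimately show ?thesis by (simp add: WS F_def)
      qed
      then show ?case using Suc.prems stepA[of "Suc n" r] by auto
    }
  qed
  have incW: "incseq (\<lambda>n. W n r)" for r by (rule incseq_SucI) (rule mono)
  have ge: "\<beta> \<le> W n r" for n r using incseqD[OF incW, of 0 n r] by (simp add: W0)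
  \<comment> \<open>Bounds uniform in n on each interval, needed both for convergence and for
    dominated convergence inside the operators.\<close>
  have bnd: "\<exists>C. \<forall>n. \<forall>t\<in>{0..R}. \<bar>W n t\<bar> \<le> C \<and> exp (opA (W n) t) \<le> C" for R
  proof -
    obtain vb wb where s: "supersol N \<alpha> \<beta> \<bar>R\<bar> vb wb" using sup[of "\<bar>R\<bar>"] by auto
    have "bounded (vb ` {0..\<bar>R\<bar>})" "bounded (wb ` {0..\<bar>R\<bar>})"
      using s by (auto simp: supersol_def intro!: compact_imp_bounded compact_continuous_image)
    then obtain C D where C: "\<And>t. t \<in> {0..\<bar>R\<bar>} \<Longrightarrow> \<bar>vb t\<bar> \<le> C" and D: "\<And>t. t \<in> {0..\<bar>R\<bar>} \<Longrightarrow> \<bar>wb t\<bar> \<le> D"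
      unfolding bounded_iff by (metis image_eqI real_norm_def)
    have "\<bar>W n t\<bar> \<le> max (exp C) (max \<bar>\<beta>\<bar> D) \<and> exp (opA (W n) t) \<le> max (exp C) (max \<bar>\<beta>\<bar> D)" if t: "t \<in> {0..R}" for n t
    proof -
      have t': "t \<in> {0..\<bar>R\<bar>}" using t by auto
      have "W n t \<le> D" "opA (W n) t \<le> C" using upper[OF s, of t n] C[OF t'] D[OF t'] t' by force+
      then show ?thesis using ge[of n t] by (auto simp: le_max_iff_disj)
    qed
    then show ?thesis by blast
  qed
  have conv: "convergent (\<lambda>n. W n r)" for r
  proof (cases "r \<ge> 0")
    case True
    obtain C where "\<And>n. W n r \<le> C" using bnd[of r] True by (force simp: abs_le_iff)
    then show ?thesis using incseq_convergent[OF incW] by (metis convergentI)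
  next
    case False
    have "W n r = \<beta>" for n using False by (cases n) (auto simp: W0 WS F_def B.rop_neg)
    then show ?thesis by (simp add: convergent_const)
  qed
  define w where "w r = lim (\<lambda>n. W n r)" for r
  have wlim: "(\<lambda>n. W n r) \<longlonglongrightarrow> w r" for r
    using conv[of r] by (simp add: w_def convergent_LIMSEQ_iff)
  have wge: "W n r \<le> w r" for n r by (rule incseq_le[OF incW wlim])
  have lbw: "locally_bounded_borel w"
    unfolding locally_bounded_borel_def
  proof (intro conjI allI)
    show "w \<in> borel_measurable borel"
      by (rule borel_measurable_LIMSEQ_real[OF wlim]) (auto intro!: borel_measurable_continuous_onI cW)
    fix R :: real
    obtain C where "\<And>n t. t \<in> {0..R} \<Longrightarrow> \<bar>W n t\<bar> \<le> C" using bnd[of R] by blast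
    then have "\<bar>w t\<bar> \<le> C" if "t \<in> {0..R}" for t
      using that by (intro LIMSEQ_le_const2[OF tendsto_rabs[OF wlim]]) auto
    then show "\<exists>C. \<forall>t\<in>{0..R}. \<bar>w t\<bar> \<le> C" by blast
  qed
  define v where "v = opA w"
  have cv: "continuous_on UNIV v" unfolding v_def by (rule A.rop_continuous[OF lbw])
  have vlim: "(\<lambda>n. opA (W n) r) \<longlonglongrightarrow> v r" for r
  proof (cases "r \<ge> 0")
    case True
    obtain C where "\<And>n t. t \<in> {0..r} \<Longrightarrow> \<bar>W n t\<bar> \<le> C" using bnd[of r] by blast
    then show ?thesis unfolding v_def using True lbW lbw wlim by (intro A.rop_tendsto[where C = C]) auto
  qed (simp add: v_def A.rop_neg)
  have cev: "continuous_on UNIV (\<lambda>t. exp (v t))" by (intro continuous_intros cv)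
  have weq: "w r = \<beta> + opB (\<lambda>t. exp (v t)) r" for r
  proof -
    have "(\<lambda>n. W (Suc n) r) \<longlonglongrightarrow> \<beta> + opB (\<lambda>t. exp (v t)) r"
    proof (cases "r \<ge> 0")
      case True
      obtain C where C: "\<And>n t. t \<in> {0..r} \<Longrightarrow> exp (opA (W n) t) \<le> C" using bnd[of r] by blast
      have "(\<lambda>n. opB (\<lambda>t. exp (opA (W n) t)) r) \<longlonglongrightarrow> opB (\<lambda>t. exp (v t)) r"
        using True C by (intro B.rop_tendsto[where C = C] lbe locally_bounded_borel_continuous[OF cev] tendsto_exp vlim) auto
      then show ?thesis unfolding WS F_def by (intro tendsto_intros)
    qed (simp add: WS F_def B.rop_neg)
    then show ?thesis using LIMSEQ_unique[OF LIMSEQ_Suc[OF wlim]] by blast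
  qed
  \<comment> \<open>The limit becomes continuous only now, because the integral equation writes it
    as an operator value.\<close>
  have cw: "continuous_on UNIV w"
  proof -
    have "continuous_on UNIV (\<lambda>r. \<beta> + opB (\<lambda>t. exp (v t)) r)"
      by (intro continuous_intros B.rop_continuous locally_bounded_borel_continuous[OF cev])
    then show ?thesis using weq by (simp cong: continuous_on_cong)
  qed
  show thesis
  proof (rule that)
    show "entire_sol N \<alpha> \<beta> v w" unfolding entire_sol_def using cv cw weq v_def by auto
    fix R vb wb r assume s: "supersol N \<alpha> \<beta> R vb wb" and r: "0 \<le> r" "r \<le> R"
    have "v r \<le> vb r" by (rule LIMSEQ_le_const2[OF vlim]) (use upper[OF s r] in blast)
    moreover have "w r \<le> wb r" by (rule LIMSEQ_le_const2[OF wlim]) (use upper[OF s r] in blast)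
    ultimately show "v r \<le> vb r \<and> w r \<le> wb r" ..
  qed
qed

lemma supersol_of_entire_sol:
  assumes "entire_sol N \<alpha> \<beta>' v w" "\<beta> \<le> \<beta>'"
  shows "supersol N \<alpha> \<beta> R v w"
  using assms by (auto simp: supersol_def entire_sol_def intro: continuous_on_subset)

text \<open>An infinite supremum provides solutions on arbitrarily long intervals which need not be
  known to agree. They serve only as supersolutions, so no uniqueness is used here.\<close>

lemma R_max_infinite_iff: "R_max N \<alpha> \<beta> = \<infinity> \<longleftrightarrow> (\<exists>v w. entire_sol N \<alpha> \<beta> v w)"
proof
  assume "\<exists>v w. entire_sol N \<alpha> \<beta> v w"
  then have *: "ereal R \<in> {ereal R | R. 0 < R \<and> (\<exists>v w. radial_sol N \<alpha> \<beta> {0..<R} v w)}" if "R > 0" for R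
    using radial_sol_of_entire_sol(2) that by blast
  have "ereal R \<le> R_max N \<alpha> \<beta>" for R
  proof -
    have "ereal R \<le> ereal (max R 1)" by simp
    also have "\<dots> \<le> R_max N \<alpha> \<beta>" unfolding R_max_def by (rule Sup_upper[OF *]) simp
    finally show ?thesis .
  qed
  then show "R_max N \<alpha> \<beta> = \<infinity>" by (rule ereal_top)
next
  assume inf: "R_max N \<alpha> \<beta> = \<infinity>"
  have "\<exists>vb wb. supersol N \<alpha> \<beta> R vb wb" if "R \<ge> 0" for R
  proof -
    have "ereal R < Sup {ereal R | R. 0 < R \<and> (\<exists>v w. radial_sol N \<alpha> \<beta> {0..<R} v w)}"
      using inf by (simp add: R_max_def)
    then obtain R' v w where R': "R < R'" "radial_sol N \<alpha> \<beta> {0..<R'} v w"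
      unfolding less_Sup_iff by auto
    have I: "{0..r} \<subseteq> {0..<R'}" if "r \<in> {0..<R'}" for r using that by auto
    have "supersol N \<alpha> \<beta> R v w"
      using R' I by (subst (asm) radial_sol_iff) (auto simp: supersol_def intro: continuous_on_subset)
    then show ?thesis by blast
  qed
  then show "\<exists>v w. entire_sol N \<alpha> \<beta> v w" using minimal_entire_sol by metis
qed

text \<open>A first-contact argument: up to the first point \<open>q\<close> where w1 reaches w2 the
  order of v1 and v2 holds, and then the integral equation gives the full gap \<beta>2 - \<beta>1 at
  \<open>q\<close>, a contradiction.\<close>

lemma entire_sol_comparison:
  assumes 1: "entire_sol N \<alpha> \<beta>1 v1 w1" and 2: "entire_sol N \<alpha> \<beta>2 v2 w2" and \<beta>: "\<beta>1 < \<beta>2" and r: "r \<ge> 0"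
  shows "w1 r + (\<beta>2 - \<beta>1) \<le> w2 r" "v1 r \<le> v2 r"
proof -
  note s = 1[unfolded entire_sol_def] 2[unfolded entire_sol_def]
  have c: "continuous_on UNIV v1" "continuous_on UNIV v2" "continuous_on UNIV w1" "continuous_on UNIV w2" using s by auto
  have lb: "locally_bounded_borel w1" "locally_bounded_borel w2"
    "locally_bounded_borel (\<lambda>t. exp (v1 t))" "locally_bounded_borel (\<lambda>t. exp (v2 t))"
    using c by (auto intro!: locally_bounded_borel_continuous continuous_intros)
  have step: "w1 r + (\<beta>2 - \<beta>1) \<le> w2 r \<and> v1 r \<le> v2 r" if "\<And>t. 0 \<le> t \<Longrightarrow> t \<le> r \<Longrightarrow> w1 t \<le> w2 t" for r
  proof -
    have v: "v1 t \<le> v2 t" if "t \<le> r" for t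
    proof -
      have "opA w1 t \<le> opA w2 t" using \<open>\<And>t. 0 \<le> t \<Longrightarrow> t \<le> r \<Longrightarrow> w1 t \<le> w2 t\<close> that lb by (intro A.rop_mono) auto
      then show ?thesis using s by metis
    qed
    have "opB (\<lambda>t. exp (v1 t)) r \<le> opB (\<lambda>t. exp (v2 t)) r" using v lb by (intro B.rop_mono) auto
    moreover have "w1 r = \<beta>1 + opB (\<lambda>t. exp (v1 t)) r" "w2 r = \<beta>2 + opB (\<lambda>t. exp (v2 t)) r" using s by blast+
    ultimately show ?thesis using v[of r] by simp
  qed
  have main: "w1 r < w2 r" if "r \<ge> 0" for r
  proof (rule ccontr)
    assume "\<not> w1 r < w2 r"
    define S where "S = {t \<in> {0..r}. w2 t \<le> w1 t}"
    have S: "r \<in> S" using \<open>\<not> w1 r < w2 r\<close> that by (auto simp: S_def)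
    have "S = {0..r} \<inter> {t. w2 t \<le> w1 t}" by (auto simp: S_def)
    then have "closed S" using c by (auto intro!: closed_Int closed_Collect_le)
    moreover have "bdd_below S" by (auto simp: S_def intro!: bdd_belowI[of _ 0])
    ultimately have rs: "Inf S \<in> S" using S closed_contains_Inf by blast
    define q where "q = Inf S"
    have lt: "w1 t < w2 t" if "0 \<le> t" "t < q" for t
    proof (rule ccontr)
      assume "\<not> w1 t < w2 t"
      moreover have "q \<le> r" using rs by (auto simp: q_def S_def)
      ultimately have "t \<in> S" using that by (auto simp: S_def)
      then have "q \<le> t" unfolding q_def using \<open>bdd_below S\<close> by (rule cInf_lower)
      then show False using that by simp
    qed
    have q0: "q \<ge> 0" using rs by (auto simp: q_def S_def)
    have w0: "w1 0 = \<beta>1" "w2 0 = \<beta>2" using s B.rop_neg by force+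
    have "q > 0" using rs w0 \<beta> q0 by (cases "q = 0") (auto simp: q_def S_def)
    have cd: "continuous_on (closure {0..<q}) (\<lambda>t. w2 t - w1 t)"
      by (intro continuous_on_diff continuous_on_subset[OF c(4)] continuous_on_subset[OF c(3)] subset_UNIV)
    have "w2 t - w1 t \<ge> 0" if "t \<in> closure {0..<q}" for t
    proof (rule continuous_ge_on_closure[OF cd that])
      show "0 \<le> w2 t - w1 t" if "t \<in> {0..<q}" for t using lt[of t] that by simp
    qed
    then have "w1 t \<le> w2 t" if "0 \<le> t" "t \<le> q" for t using that \<open>q > 0\<close> by simp
    then have "w1 q + (\<beta>2 - \<beta>1) \<le> w2 q" using step[of q] by blast
    moreover have "w2 q \<le> w1 q" using rs by (simp add: q_def S_def)
    ultimately show False using \<beta> by linarith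
  qed
  show "w1 r + (\<beta>2 - \<beta>1) \<le> w2 r" "v1 r \<le> v2 r"
    using step[of r] main less_imp_le r by auto
qed

end


section \<open>Growth estimates and blow-up when the Laplacian becomes nonnegative\<close>

lemma nondecreasing_of_derivative:
  fixes f f' :: "real \<Rightarrow> real"
  assumes "a \<le> b" "continuous_on {a..b} f" "\<And>x. a < x \<Longrightarrow> x < b \<Longrightarrow> (f has_real_derivative f' x) (at x)"
    and "\<And>x. a < x \<Longrightarrow> x < b \<Longrightarrow> 0 \<le> f' x"
  shows "f a \<le> f b"
  using assms(2,3,4) by (intro DERIV_nonneg_imp_increasing_open[OF assms(1)]) blast+

lemma increment_ge_linear:
  fixes F F' :: "real \<Rightarrow> real"
  assumes "a \<le> b" "continuous_on {a..b} F" "\<And>x. a < x \<Longrightarrow> x < b \<Longrightarrow> (F has_real_derivative F' x) (at x)"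
    and "\<And>x. a < x \<Longrightarrow> x < b \<Longrightarrow> K * (x - a) + L \<le> F' x"
  shows "F a + K * (b - a)\<^sup>2 / 2 + L * (b - a) \<le> F b"
proof -
  have "F a - (K * (a - a)\<^sup>2 / 2 + L * (a - a)) \<le> F b - (K * (b - a)\<^sup>2 / 2 + L * (b - a))"
  proof (rule nondecreasing_of_derivative[OF assms(1), where f' = "\<lambda>x. F' x - (K * (x - a) + L)"])
    fix x assume x: "a < x" "x < b"
    show "((\<lambda>x. F x - (K * (x - a)\<^sup>2 / 2 + L * (x - a))) has_real_derivative F' x - (K * (x - a) + L)) (at x)"
      by (rule DERIV_diff[OF assms(3)[OF x]]) (auto intro!: derivative_eq_intros)
    show "0 \<le> F' x - (K * (x - a) + L)" using assms(4)[OF x] by simp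
  qed (auto intro!: continuous_intros assms(2))
  then show ?thesis by simp
qed

lemma bounded_of_derivative_decay:
  fixes f f' :: "real \<Rightarrow> real"
  assumes "\<And>x. x \<ge> 1 \<Longrightarrow> (f has_real_derivative f' x) (at x)" "\<And>x. x \<ge> 1 \<Longrightarrow> f' x \<le> K * x powr (- 2)"
    and "K \<ge> 0" "s \<ge> 1"
  shows "f s \<le> f 1 + K"
proof -
  have d: "((\<lambda>s. - f s - K * inverse s) has_real_derivative - f' x + K * x powr (- 2)) (at x)" if x: "x \<ge> 1" for x
  proof -
    have "(inverse has_real_derivative - (x powr (- 2))) (at x)"
      using x by (auto intro!: derivative_eq_intros simp: powr_minus power2_eq_square)
    from DERIV_diff[OF DERIV_minus[OF assms(1)[OF x]] DERIV_cmult[OF this, of K]]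
    show ?thesis by simp
  qed
  have "- f 1 - K * inverse 1 \<le> - f s - K * inverse s"
  proof (rule nondecreasing_of_derivative[OF assms(4)])
    show "continuous_on {1..s} (\<lambda>s. - f s - K * inverse s)"
      by (intro continuous_at_imp_continuous_on ballI DERIV_isCont[OF d]) auto
    show "((\<lambda>s. - f s - K * inverse s) has_real_derivative - f' x + K * x powr (- 2)) (at x)" if "1 < x" for x
      using d[of x] that by simp
    show "0 \<le> - f' x + K * x powr (- 2)" if "1 < x" for x using assms(2)[of x] that by simp
  qed
  moreover have "K * inverse s \<ge> 0" using assms by simp
  ultimately show ?thesis by simp
qed

context radial_operator begin

lemma mom_add:
  assumes "locally_bounded_borel h" "locally_bounded_borel k"
  shows "radial_moment e (\<lambda>t. h t + k t) s = radial_moment e h s + radial_moment e k s"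
  unfolding radial_moment_def distrib_left by (intro integral_add mom_integrable_on assms)

lemma mom_cmult: "radial_moment e (\<lambda>t. c * h t) s = c * radial_moment e h s"
  unfolding radial_moment_def by (simp add: mult.left_commute)

lemma rop_add:
  assumes "locally_bounded_borel h" "locally_bounded_borel k"
  shows "radial_op N e (\<lambda>t. h t + k t) s = radial_op N e h s + radial_op N e k s"
  unfolding radial_op_def mom_add[OF assms] distrib_left by (intro integral_add rop_integrable_on assms)

lemma rop_cmult: "radial_op N e (\<lambda>t. c * h t) s = c * radial_op N e h s"
  unfolding radial_op_def mom_cmult by (simp add: mult.left_commute)

lemma rop_diff:
  assumes "locally_bounded_borel h" "locally_bounded_borel k"
  shows "radial_op N e (\<lambda>t. h t - k t) s = radial_op N e h s - radial_op N e k s"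
  using rop_add[OF assms(1) locally_bounded_borel_cmult[OF assms(2), of "- 1"]] rop_cmult[of "- 1" k] by simp

lemma mom_nonneg: "locally_bounded_borel h \<Longrightarrow> (\<And>t. 0 \<le> t \<Longrightarrow> t \<le> s \<Longrightarrow> 0 \<le> h t) \<Longrightarrow> 0 \<le> radial_moment e h s"
  using mom_mono[of "\<lambda>_. 0" h s] by (auto simp: radial_moment_def)

lemma rop_nonneg: "locally_bounded_borel h \<Longrightarrow> (\<And>t. 0 \<le> t \<Longrightarrow> t \<le> s \<Longrightarrow> 0 \<le> h t) \<Longrightarrow> 0 \<le> radial_op N e h s"
  using rop_mono[of "\<lambda>_. 0" h s] by (auto simp: radial_op_def radial_moment_def)

lemma rop_increasing:
  assumes "locally_bounded_borel h" "\<And>t. 0 \<le> t \<Longrightarrow> 0 \<le> h t" "0 \<le> r" "r \<le> s"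
  shows "radial_op N e h r \<le> radial_op N e h s"
proof (rule nondecreasing_of_derivative[OF assms(4)])
  show "continuous_on {r..s} (radial_op N e h)" by (rule continuous_on_subset[OF rop_continuous[OF assms(1)]]) simp
  fix x assume x: "r < x" "x < s"
  show "(radial_op N e h has_real_derivative x powr (1 - real N) * radial_moment e h x) (at x)"
    using x assms(3) by (intro rop_has_derivative assms(1)) simp
  show "0 \<le> x powr (1 - real N) * radial_moment e h x"
    using assms(2) by (intro mult_nonneg_nonneg mom_nonneg assms(1)) auto
qed

text \<open>The decay makes the moment bounded; then N at least 3 bounds the derivative of the
  operator value by a multiple of s^(-2), so the same integration applies a second time.\<close>

lemma rop_bounded:
  assumes h: "continuous_on UNIV h" "\<And>t. 0 \<le> t \<Longrightarrow> 0 \<le> h t" and K: "\<And>t. t \<ge> 1 \<Longrightarrow> t powr e * h t \<le> K * t powr (- 2)"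
  shows "\<exists>C. \<forall>r\<ge>0. radial_op N e h r \<le> C"
proof -
  note lb = locally_bounded_borel_continuous[OF h(1)]
  have K0: "K \<ge> 0" using K[of 1] h(2)[of 1] by simp
  define M where "M = radial_moment e h 1 + K"
  have M: "radial_moment e h s \<le> M" if "s \<ge> 1" for s
    unfolding M_def
    by (rule bounded_of_derivative_decay[OF mom_has_derivative[OF h(1)] K K0 that]) auto
  have M0: "M \<ge> 0" using mom_nonneg[OF lb, of 1] h(2) K0 by (simp add: M_def)
  have b: "radial_op N e h s \<le> radial_op N e h 1 + M" if "s \<ge> 1" for s
  proof (rule bounded_of_derivative_decay[OF rop_has_derivative[OF lb] _ M0 that])
    fix x :: real assume x: "x \<ge> 1"
    then show "x > 0" by simp
    have "x powr (1 - real N) * radial_moment e h x \<le> x powr (- 2) * M"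
      using x N3 M[OF x] h(2) by (intro mult_mono powr_mono mom_nonneg lb) auto
    then show "x powr (1 - real N) * radial_moment e h x \<le> M * x powr (- 2)" by (simp add: mult.commute)
  qed
  have "radial_op N e h r \<le> radial_op N e h 1 + M" if "r \<ge> 0" for r
  proof (cases "r \<ge> 1")
    case False
    then have "radial_op N e h r \<le> radial_op N e h 1" using rop_increasing[OF lb h(2) that, of 1] by simp
    then show ?thesis using M0 by simp
  qed (rule b)
  then show ?thesis by blast
qed

end

context radial_problem begin

lemma entire_solD:
  assumes "entire_sol N \<alpha> \<beta> v w"
  shows "continuous_on S v" "continuous_on S w" "v r = opA w r" "w r = \<beta> + opB (\<lambda>t. exp (v t)) r"
    "locally_bounded_borel w" "locally_bounded_borel (\<lambda>t. exp (v t))" "v 0 = 0" "w 0 = \<beta>"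
proof -
  have *: "continuous_on UNIV v" "continuous_on UNIV w" "\<And>r. v r = opA w r" "\<And>r. w r = \<beta> + opB (\<lambda>t. exp (v t)) r"
    using assms by (auto simp: entire_sol_def)
  show "continuous_on S v" "continuous_on S w" using *(1,2) continuous_on_subset by blast+
  show "v r = opA w r" "w r = \<beta> + opB (\<lambda>t. exp (v t)) r" by fact+
  show "locally_bounded_borel w" "locally_bounded_borel (\<lambda>t. exp (v t))"
    using *(1,2) by (auto intro!: locally_bounded_borel_continuous continuous_intros)
  show "v 0 = 0" "w 0 = \<beta>" using *(3)[of 0] *(4)[of 0] by (auto simp: A.rop_neg B.rop_neg)
qed

abbreviation "momA \<equiv> radial_moment (real N - 1)"
abbreviation "momB v \<equiv> radial_moment (real N - 1 + \<alpha>) (\<lambda>t. exp (v t))"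

lemma entire_sol_derivatives:
  assumes sol: "entire_sol N \<alpha> \<beta> v w" and r: "r > 0"
  shows "(v has_real_derivative r powr (1 - real N) * momA w r) (at r)"
    "(w has_real_derivative r powr (1 - real N) * momB v r) (at r)"
    "(momA w has_real_derivative r powr (real N - 1) * w r) (at r)"
    "(momB v has_real_derivative r powr (real N - 1 + \<alpha>) * exp (v r)) (at r)"
proof -
  note s = entire_solD[OF sol]
  have "v = opA w" using s(3) by blast
  then show "(v has_real_derivative r powr (1 - real N) * momA w r) (at r)"
    using A.rop_has_derivative[OF s(5) r] by simp
  have w: "w = (\<lambda>r. \<beta> + opB (\<lambda>t. exp (v t)) r)" using s(4) by blast
  show "(w has_real_derivative r powr (1 - real N) * momB v r) (at r)"
    by (subst w) (auto intro!: derivative_eq_intros B.rop_has_derivative[OF s(6) r])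
  show "(momA w has_real_derivative r powr (real N - 1) * w r) (at r)"
    by (rule A.mom_has_derivative[OF s(2) r])
  show "(momB v has_real_derivative r powr (real N - 1 + \<alpha>) * exp (v r)) (at r)"
    by (rule B.mom_has_derivative[OF _ r]) (intro continuous_intros s(1))
qed

lemma momB_pos:
  assumes sol: "entire_sol N \<alpha> \<beta> v w" and r: "r > 0"
  shows "momB v r > 0"
proof -
  note s = entire_solD[OF sol]
  have "\<exists>q\<in>{0..r}. \<forall>t\<in>{0..r}. exp (v q) \<le> exp (v t)"
    using r by (intro continuous_attains_inf) (auto intro!: continuous_intros s(1))
  then obtain q where q: "\<forall>t\<in>{0..r}. exp (v q) \<le> exp (v t)" by blast
  have "0 < exp (v q) * r powr (real N - 1 + \<alpha> + 1) / (real N - 1 + \<alpha> + 1)"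
    using r B.e_pos by simp
  also have "\<dots> = radial_moment (real N - 1 + \<alpha>) (\<lambda>_. exp (v q)) r" using r by (subst B.mom_const) auto
  also have "\<dots> \<le> momB v r" using q by (intro B.mom_mono s(6)) auto
  finally show ?thesis .
qed

lemma w_strict_mono:
  assumes sol: "entire_sol N \<alpha> \<beta> v w" and r: "0 \<le> r" "r < s"
  shows "w r < w s"
proof (rule DERIV_pos_imp_increasing_open[OF r(2)])
  fix x assume "r < x" "x < s"
  then have "x > 0" using r by simp
  then show "\<exists>y. (w has_real_derivative y) (at x) \<and> 0 < y"
    using entire_sol_derivatives(2)[OF sol, of x] momB_pos[OF sol, of x]
    by (intro exI[of _ "x powr (1 - real N) * momB v x"]) auto
qed (rule entire_solD(2)[OF sol])

lemma w_mono: "entire_sol N \<alpha> \<beta> v w \<Longrightarrow> 0 \<le> r \<Longrightarrow> r \<le> s \<Longrightarrow> w r \<le> w s"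
  using w_strict_mono[of \<beta> v w r s] by (cases "r < s") (auto simp: less_imp_le)

text \<open>If \<open>\<Delta>u\<close> becomes nonnegative, then \<open>u\<close> grows quadratically and the maximum of
  \<open>e\<^sup>v (R - r)\<^sup>4\<close> over a unit interval \<open>[r\<^sub>2, R]\<close> contradicts the growth of \<open>v\<close> over half the
  distance from the maximum point to \<open>R\<close>.\<close>

lemma entire_sol_w_neg:
  assumes sol: "entire_sol N \<alpha> \<beta> v w" and r0: "r0 \<ge> 0"
  shows "w r0 < 0"
proof (rule ccontr)
  assume "\<not> w r0 < 0"
  define r1 where "r1 = r0 + 1"
  define c where "c = w r1"
  have r1: "r1 \<ge> 1" using r0 by (simp add: r1_def)
  have c: "c > 0" using w_strict_mono[OF sol r0, of r1] \<open>\<not> w r0 < 0\<close> by (simp add: c_def r1_def)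
  have wc: "w r \<ge> c" if "r \<ge> r1" for r unfolding c_def using w_mono[OF sol _ that] r1 by simp
  have Npos: "real N > 0" using N3 by simp
  define D where "D = \<bar>momA w r1 - c * r1 powr real N / real N\<bar>"
  have mA: "momA w r \<ge> c * r powr real N / real N - D" if "r \<ge> r1" for r
  proof -
    have "momA w r1 - c * r1 powr real N / real N \<le> momA w r - c * r powr real N / real N"
    proof (rule nondecreasing_of_derivative[OF that, where f' = "\<lambda>x. x powr (real N - 1) * (w x - c)"])
      show "continuous_on {r1..r} (\<lambda>r. momA w r - c * r powr real N / real N)"
        using r1 Npos by (intro continuous_intros continuous_on_subset[OF A.mom_continuous[OF entire_solD(5)[OF sol], of r]]) auto
      fix x assume x: "r1 < x" "x < r"
      then have x0: "x > 0" using r1 by simp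
      have "((\<lambda>r. momA w r - c * r powr real N / real N) has_real_derivative x powr (real N - 1) * w x - c * (real N * x powr (real N - 1)) / real N) (at x)"
        by (intro DERIV_diff DERIV_cdivide DERIV_cmult entire_sol_derivatives(3)[OF sol] has_real_derivative_powr x0)
      moreover have "x powr (real N - 1) * w x - c * (real N * x powr (real N - 1)) / real N = x powr (real N - 1) * (w x - c)"
        using Npos by (simp add: field_simps)
      ultimately show "((\<lambda>r. momA w r - c * r powr real N / real N) has_real_derivative x powr (real N - 1) * (w x - c)) (at x)"
        by simp
      show "0 \<le> x powr (real N - 1) * (w x - c)" using wc[of x] x by simp
    qed
    then show ?thesis unfolding D_def by linarith
  qed
  define v' where "v' r = r powr (1 - real N) * momA w r" for r
  have v'ge: "v' r \<ge> c / real N * r - D" if "r \<ge> r1" for r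
  proof -
    have r: "r \<ge> 1" using that r1 by simp
    have "r powr (1 - real N) * (c * r powr real N / real N - D) \<le> v' r"
      unfolding v'_def using mA[OF that] by (intro mult_left_mono) auto
    moreover have "r powr (1 - real N) * (c * r powr real N / real N - D) = c / real N * r - r powr (1 - real N) * D"
    proof -
      have "r powr (1 - real N) * r powr real N = r" using r unfolding powr_add[symmetric] by simp
      then show ?thesis by (simp add: algebra_simps)
    qed
    moreover have "r powr (1 - real N) * D \<le> 1 * D"
      using r N3 powr_mono[of "1 - real N" 0 r] by (intro mult_right_mono) (auto simp: D_def)
    ultimately show ?thesis by linarith
  qed
  define a where "a = c / real N"
  have a: "a > 0" using c Npos by (simp add: a_def)
  define E where "E = \<bar>v r1\<bar>"
  have vge: "v r \<ge> a * (r - r1)\<^sup>2 / 2 - D * (r - r1) - E" if "r \<ge> r1" for r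
  proof -
    have "v r1 + a * (r - r1)\<^sup>2 / 2 + (- D) * (r - r1) \<le> v r"
    proof (rule increment_ge_linear[OF that entire_solD(1)[OF sol], where F' = v'])
      fix x assume x: "r1 < x" "x < r"
      then show "(v has_real_derivative v' x) (at x)"
        unfolding v'_def using r1 by (intro entire_sol_derivatives(1)[OF sol]) auto
      have "a * (x - r1) \<le> a * x" using a r1 by (intro mult_left_mono) auto
      then show "a * (x - r1) + - D \<le> v' x" using v'ge[of x] x by (simp add: a_def)
    qed
    then show ?thesis by (simp add: E_def)
  qed
  \<comment> \<open>Quadratic growth of v makes e^v beat the powers of r lost in the weights. The
    constant 1024 ln 16 is what the maximum argument needs: moving halfway to R divides (R-r)^4 by
    16, while growth over this distance d/2 yields k^2 e^v (d/4)^4 / 4 = k^2 e^v d^4 / 1024.\<close>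
  have "filterlim (\<lambda>r::real. exp (a * (r - r1)\<^sup>2 / 2 - D * (r - r1) - E) * (r + 1) powr (2 - 2 * real N)) at_top at_top"
    using a by real_asymp
  then have "\<forall>\<^sub>F r::real in at_top. exp (a * (r - r1)\<^sup>2 / 2 - D * (r - r1) - E) * (r + 1) powr (2 - 2 * real N) > 1024 * ln 16"
    by (simp add: filterlim_at_top_dense)
  moreover have "\<forall>\<^sub>F r::real in at_top. r \<ge> max r1 (D / a)" by (rule eventually_ge_at_top)
  ultimately have "\<forall>\<^sub>F r::real in at_top. exp (a * (r - r1)\<^sup>2 / 2 - D * (r - r1) - E) * (r + 1) powr (2 - 2 * real N) > 1024 * ln 16 \<and> r \<ge> max r1 (D / a)"
    by eventually_elim auto
  then obtain r2 where r2': "exp (a * (r2 - r1)\<^sup>2 / 2 - D * (r2 - r1) - E) * (r2 + 1) powr (2 - 2 * real N) > 1024 * ln 16" "r2 \<ge> max r1 (D / a)"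
    by (auto simp: eventually_at_top_linorder)
  have r2: "r2 \<ge> r1" "r2 \<ge> 1" "r2 \<ge> D / a" using r2'(2) r1 by auto
  define R where "R = r2 + 1"
  \<comment> \<open>On [r2, R] the weight s^(1-N) is at least \<open>k\<close>, and positive powers
    of s are at least 1, so the equation is compared with one having constant coefficients.\<close>
  define k where "k = R powr (1 - real N)"
  have k0: "k > 0" using r2 by (simp add: k_def R_def)
  have big: "k\<^sup>2 * exp (v r2) > 1024 * ln 16"
  proof -
    have "k\<^sup>2 = (r2 + 1) powr (2 - 2 * real N)"
      unfolding k_def R_def power2_eq_square powr_add[symmetric] by (simp add: algebra_simps)
    moreover have "exp (a * (r2 - r1)\<^sup>2 / 2 - D * (r2 - r1) - E) \<le> exp (v r2)" using vge[OF r2(1)] by simp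
    ultimately have "exp (a * (r2 - r1)\<^sup>2 / 2 - D * (r2 - r1) - E) * (r2 + 1) powr (2 - 2 * real N) \<le> exp (v r2) * k\<^sup>2"
      by (intro mult_mono) auto
    then show ?thesis using r2'(1) by (simp add: mult.commute)
  qed
  have v'nn: "v' r \<ge> 0" if "r \<ge> r2" for r
  proof -
    have "D \<le> a * r2" using r2(3) a by (simp add: field_simps)
    also have "\<dots> \<le> a * r" using that a by simp
    finally have "D \<le> a * r" .
    then show ?thesis using v'ge[of r] that r2 by (simp add: a_def)
  qed
  have vmono: "v r \<le> v s" if "r2 \<le> r" "r \<le> s" for r s
  proof -
    have "v r + 0 * (s - r)\<^sup>2 / 2 + 0 * (s - r) \<le> v s"
      by (rule increment_ge_linear[OF that(2) entire_solD(1)[OF sol], where F' = v'])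
        (use that r2 v'nn in \<open>auto simp: v'_def intro!: entire_sol_derivatives(1)[OF sol]\<close>)
    then show ?thesis by simp
  qed
  have kle: "k \<le> s powr (1 - real N)" if "r2 \<le> s" "s \<le> R" for s
    unfolding k_def using that r2 N3 by (intro powr_mono2') auto
  have one: "1 \<le> s powr p" if "r2 \<le> s" "p > 0" for s p
    using that r2 by (intro ge_one_powr_ge_zero) auto
  have cmA: "continuous_on {x..y} (momA w)" if "x \<ge> 0" for x y
    by (rule continuous_on_subset[OF A.mom_continuous[OF entire_solD(5)[OF sol], of y]]) (use that in auto)
  have cmB: "continuous_on {x..y} (momB v)" if "x \<ge> 0" for x y
    by (rule continuous_on_subset[OF B.mom_continuous[OF entire_solD(6)[OF sol], of y]]) (use that in auto)
  \<comment> \<open>The first half step turns e^v into growth of w through \<open>momB\<close>; the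
    second turns w into growth of v through \<open>momA\<close>. Each half step contributes a factor
    \<open>k\<close> and h^2 / 2.\<close>
  have growth: "v (r + 2 * h) \<ge> v r + k\<^sup>2 * exp (v r) * h ^ 4 / 4" if r: "r2 \<le> r" and h: "h > 0" "r + 2 * h \<le> R" for r h
  proof -
    have B: "momB v s \<ge> exp (v r) * (s - r)" if "r \<le> s" "s \<le> R" for s
    proof -
      have "momB v r + 0 * (s - r)\<^sup>2 / 2 + exp (v r) * (s - r) \<le> momB v s"
      proof (rule increment_ge_linear[OF that(1) cmB])
        fix x assume x: "r < x" "x < s"
        show "(momB v has_real_derivative x powr (real N - 1 + \<alpha>) * exp (v x)) (at x)"
          using x r r2 by (intro entire_sol_derivatives(4)[OF sol]) auto
        have "1 * exp (v r) \<le> x powr (real N - 1 + \<alpha>) * exp (v x)"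
          using x r one[of x "real N - 1 + \<alpha>"] vmono[of r x] B.e_pos by (intro mult_mono) auto
        then show "0 * (x - r) + exp (v r) \<le> x powr (real N - 1 + \<alpha>) * exp (v x)" by simp
      qed (use r r2 in auto)
      moreover have "momB v r > 0" using r r2 by (intro momB_pos[OF sol]) auto
      ultimately show ?thesis by simp
    qed
    have "w r + (k * exp (v r)) * ((r + h) - r)\<^sup>2 / 2 + 0 * ((r + h) - r) \<le> w (r + h)"
    proof (rule increment_ge_linear[OF _ entire_solD(2)[OF sol]])
      fix x assume x: "r < x" "x < r + h"
      show "(w has_real_derivative x powr (1 - real N) * momB v x) (at x)"
        using x r r2 by (intro entire_sol_derivatives(2)[OF sol]) auto
      have "k * (exp (v r) * (x - r)) \<le> x powr (1 - real N) * momB v x"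
        using x r h kle[of x] B[of x] k0 by (intro mult_mono) auto
      then show "k * exp (v r) * (x - r) + 0 \<le> x powr (1 - real N) * momB v x" by simp
    qed (use h in auto)
    moreover have "w r \<ge> 0" using wc[of r] r r2 c by linarith
    ultimately have wh: "k * exp (v r) * h\<^sup>2 / 2 \<le> w (r + h)" by simp
    have wh0: "w (r + h) \<ge> 0" using wc[of "r + h"] r r2 c h by linarith
    have A: "momA w s \<ge> w (r + h) * (s - (r + h))" if "r + h \<le> s" "s \<le> R" for s
    proof -
      have "momA w (r + h) + 0 * (s - (r + h))\<^sup>2 / 2 + w (r + h) * (s - (r + h)) \<le> momA w s"
      proof (rule increment_ge_linear[OF that(1) cmA])
        fix x assume x: "r + h < x" "x < s"
        show "(momA w has_real_derivative x powr (real N - 1) * w x) (at x)"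
          using x r r2 h by (intro entire_sol_derivatives(3)[OF sol]) auto
        have "1 * w (r + h) \<le> x powr (real N - 1) * w x"
          using x r r2 h one[of x "real N - 1"] w_mono[OF sol, of "r + h" x] wh0 A.e_pos by (intro mult_mono) auto
        then show "0 * (x - (r + h)) + w (r + h) \<le> x powr (real N - 1) * w x" by simp
      qed (use r r2 h in auto)
      moreover have "momA w (r + h) \<ge> 0"
      proof -
        have "v' (r + h) \<ge> 0" using v'nn[of "r + h"] r h by simp
        moreover have "(r + h) powr (1 - real N) > 0" using r r2 h by simp
        ultimately show ?thesis unfolding v'_def by (simp add: zero_le_mult_iff)
      qed
      ultimately show ?thesis by simp
    qed
    have "v (r + h) + (k * w (r + h)) * ((r + 2 * h) - (r + h))\<^sup>2 / 2 + 0 * ((r + 2 * h) - (r + h)) \<le> v (r + 2 * h)"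
    proof (rule increment_ge_linear[OF _ entire_solD(1)[OF sol]])
      fix x assume x: "r + h < x" "x < r + 2 * h"
      show "(v has_real_derivative x powr (1 - real N) * momA w x) (at x)"
        using x r r2 h by (intro entire_sol_derivatives(1)[OF sol]) auto
      have "k * (w (r + h) * (x - (r + h))) \<le> x powr (1 - real N) * momA w x"
        using x r h kle[of x] A[of x] k0 wh0 by (intro mult_mono mult_nonneg_nonneg) auto
      then show "k * w (r + h) * (x - (r + h)) + 0 \<le> x powr (1 - real N) * momA w x" by simp
    qed (use h in auto)
    then have "v (r + h) + k * w (r + h) * h\<^sup>2 / 2 \<le> v (r + 2 * h)" by simp
    moreover have "v r \<le> v (r + h)" using vmono[of r "r + h"] r h by simp
    moreover have "k * (k * exp (v r) * h\<^sup>2 / 2) * h\<^sup>2 / 2 \<le> k * w (r + h) * h\<^sup>2 / 2"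
      using wh k0 by (intro divide_right_mono mult_right_mono mult_left_mono) auto
    moreover have "k * (k * exp (v r) * h\<^sup>2 / 2) * h\<^sup>2 / 2 = k\<^sup>2 * exp (v r) * h ^ 4 / 4"
      by (simp add: power2_eq_square power4_eq_xxxx)
    ultimately show ?thesis by linarith
  qed
  have "\<exists>q\<in>{r2..R}. \<forall>r\<in>{r2..R}. exp (v r) * (R - r) ^ 4 \<le> exp (v q) * (R - q) ^ 4"
    by (intro continuous_attains_sup) (auto simp: R_def intro!: continuous_intros entire_solD(1)[OF sol])
  then obtain q where q: "q \<in> {r2..R}" "\<And>r. r \<in> {r2..R} \<Longrightarrow> exp (v r) * (R - r) ^ 4 \<le> exp (v q) * (R - q) ^ 4" by blast
  have m2: "exp (v r2) \<le> exp (v q) * (R - q) ^ 4" using q(2)[of r2] by (simp add: R_def)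
  have "q \<noteq> R" using m2 by (auto simp: not_le)
  then have d0: "R - q > 0" using q(1) by simp
  define d where "d = R - q"
  have d: "d > 0" "q = R - d" using d0 by (auto simp: d_def)
  have "q + 2 * (d / 4) \<in> {r2..R}" using q(1) d by auto
  from q(2)[OF this] have le: "exp (v (q + 2 * (d / 4))) * (R - (q + 2 * (d / 4))) ^ 4 \<le> exp (v q) * d ^ 4"
    by (simp only: d_def)
  have "R - (q + 2 * (d / 4)) = d / 2" by (simp add: d(2))
  then have "(R - (q + 2 * (d / 4))) ^ 4 = d ^ 4 / 16" by (simp only: power_divide) simp
  from le[unfolded this] have "exp (v (q + 2 * (d / 4))) * d ^ 4 \<le> (exp (v q) * 16) * d ^ 4" by simp
  then have "exp (v (q + 2 * (d / 4))) \<le> exp (v q) * 16" using d(1) by (simp only: mult_le_cancel_right_pos zero_less_power)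
  also have "\<dots> = exp (v q + ln 16)" by (simp add: exp_add)
  finally have "v (q + 2 * (d / 4)) \<le> v q + ln 16" by simp
  moreover have "v (q + 2 * (d / 4)) \<ge> v q + k\<^sup>2 * exp (v q) * (d / 4) ^ 4 / 4"
    using q(1) d by (intro growth) auto
  moreover have "k\<^sup>2 * exp (v q) * (d / 4) ^ 4 / 4 = k\<^sup>2 * (exp (v q) * (R - q) ^ 4) / 1024"
    by (simp add: d(2) power_divide)
  moreover have "k\<^sup>2 * exp (v r2) / 1024 \<le> k\<^sup>2 * (exp (v q) * (R - q) ^ 4) / 1024"
    using m2 by (intro divide_right_mono mult_left_mono) auto
  ultimately show False using big by linarith
qed

lemma entire_sol_v_nonpos:
  assumes sol: "entire_sol N \<alpha> \<beta> v w"
  shows "v r \<le> 0"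
proof -
  have "opA w r \<le> opA (\<lambda>_. 0) r"
    using entire_sol_w_neg[OF sol] by (intro A.rop_mono entire_solD[OF sol]) (auto intro: less_imp_le)
  then show ?thesis using entire_solD(3)[OF sol, of r] by (simp add: radial_op_def radial_moment_def)
qed

lemma entire_sol_w_ge: "entire_sol N \<alpha> \<beta> v w \<Longrightarrow> \<beta> \<le> w r"
  using B.rop_nonneg[OF entire_solD(6), of \<beta> v w r] entire_solD(4)[of \<beta> v w r] by simp

end


section \<open>Uniqueness, limits in the parameter, and the set of entire parameters\<close>

lemma abs_exp_diff_le:
  fixes a b :: real
  assumes "a \<le> 0" "b \<le> 0"
  shows "\<bar>exp a - exp b\<bar> \<le> \<bar>a - b\<bar>"
proof -
  have *: "exp y - exp x \<le> y - x" if "x \<le> y" "y \<le> 0" for x y :: real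
  proof -
    have "exp y - exp x = exp y * (1 - exp (x - y))" by (simp add: exp_diff algebra_simps)
    also have "\<dots> \<le> 1 * (y - x)"
    proof (rule mult_mono)
      show "1 - exp (x - y) \<le> y - x" using exp_ge_add_one_self[of "x - y"] by linarith
    qed (use that in auto)
    finally show ?thesis by simp
  qed
  show ?thesis using *[of a b] *[of b a] assms by (cases "a \<le> b") auto
qed

context radial_problem begin

lemma opA_const: "r \<ge> 0 \<Longrightarrow> opA (\<lambda>_. c) r = c * r\<^sup>2 / (2 * real N)"
  using A.rop_const[of r c] by (simp add: mult.commute)

text \<open>Applying the operator to e^(\<mu> t) gains a factor 1/\<mu>, which makes the solution
  map contract in an exponentially weighted norm.\<close>

lemma opA_exp_le:
  assumes \<mu>: "\<mu> > 0" and r: "0 \<le> r" "r \<le> R"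
  shows "opA (\<lambda>t. exp (\<mu> * t)) r \<le> R / (real N * \<mu>) * exp (\<mu> * r)"
proof -
  have N0: "real N > 0" using N3 by simp
  have lb: "locally_bounded_borel (\<lambda>t. exp (\<mu> * t))"
    by (intro locally_bounded_borel_continuous continuous_intros)
  let ?f = "\<lambda>r. R / (real N * \<mu>) * exp (\<mu> * r) - opA (\<lambda>t. exp (\<mu> * t)) r"
  have "?f 0 \<le> ?f r"
  proof (rule nondecreasing_of_derivative[OF r(1), where f' = "\<lambda>x. R / real N * exp (\<mu> * x) - x powr (1 - real N) * momA (\<lambda>t. exp (\<mu> * t)) x"])
    show "continuous_on {0..r} ?f"
      by (intro continuous_intros continuous_on_subset[OF A.rop_continuous[OF lb]]) auto
    fix x assume x: "0 < x" "x < r"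
    show "(?f has_real_derivative R / real N * exp (\<mu> * x) - x powr (1 - real N) * momA (\<lambda>t. exp (\<mu> * t)) x) (at x)"
      using \<mu> x N0 by (auto intro!: derivative_eq_intros A.rop_has_derivative[OF lb])
    have "momA (\<lambda>t. exp (\<mu> * t)) x \<le> momA (\<lambda>_. exp (\<mu> * x)) x"
      using \<mu> by (intro A.mom_mono lb) auto
    also have "\<dots> = exp (\<mu> * x) * x powr real N / real N" using x by (subst A.mom_const) auto
    finally have "x powr (1 - real N) * momA (\<lambda>t. exp (\<mu> * t)) x \<le> x powr (1 - real N) * (exp (\<mu> * x) * x powr real N / real N)"
      by (intro mult_left_mono) auto
    also have "\<dots> = x / real N * exp (\<mu> * x)"
    proof -
      have "x powr (1 - real N) * x powr real N = x" using x unfolding powr_add[symmetric] by simp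
      then show ?thesis by (simp add: field_simps)
    qed
    also have "\<dots> \<le> R / real N * exp (\<mu> * x)" using x r N0 by (intro mult_right_mono divide_right_mono) auto
    finally show "0 \<le> R / real N * exp (\<mu> * x) - x powr (1 - real N) * momA (\<lambda>t. exp (\<mu> * t)) x" by simp
  qed
  moreover have "?f 0 \<ge> 0" using N0 \<mu> r by (simp add: A.rop_neg)
  ultimately show ?thesis by simp
qed

text \<open>Since v1 and v2 are nonpositive, exp is 1-Lipschitz along both. At the point maximising
  |v1 - v2| e^(-\<mu> t) on [0,R], the integral system bounds this maximum by half of
  itself.\<close>

lemma entire_sol_unique:
  assumes 1: "entire_sol N \<alpha> \<beta> v1 w1" and 2: "entire_sol N \<alpha> \<beta> v2 w2" and r: "r \<ge> 0"
  shows "v1 r = v2 r"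
proof -
  note s1 = entire_solD[OF 1] and s2 = entire_solD[OF 2]
  define R where "R = max r 1"
  have R: "R \<ge> 1" "r \<le> R" by (auto simp: R_def)
  have N0: "real N > 0" using N3 by simp
  \<comment> \<open>The norm of \<open>opB\<close> on [0,R], increased by 1 to be visibly positive;
    \<open>\<mu>\<close> is then set so that CB R / (N \<mu>) = 1/2.\<close>
  define CB where "CB = R powr (2 + \<alpha>) / ((real N + \<alpha>) * (2 + \<alpha>)) + 1"
  have CB: "CB > 0" using N3 alpha by (simp add: CB_def add_nonneg_pos)
  define \<mu> where "\<mu> = 2 * CB * R / real N"
  have \<mu>: "\<mu> > 0" using CB R N0 by (simp add: \<mu>_def)
  have "\<exists>q\<in>{0..R}. \<forall>t\<in>{0..R}. \<bar>v1 t - v2 t\<bar> * exp (- \<mu> * t) \<le> \<bar>v1 q - v2 q\<bar> * exp (- \<mu> * q)"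
    using R by (intro continuous_attains_sup) (auto intro!: continuous_intros s1(1) s2(1))
  then obtain q where q: "q \<in> {0..R}"
    "\<And>t. t \<in> {0..R} \<Longrightarrow> \<bar>v1 t - v2 t\<bar> * exp (- \<mu> * t) \<le> \<bar>v1 q - v2 q\<bar> * exp (- \<mu> * q)" by blast
  define D where "D = \<bar>v1 q - v2 q\<bar> * exp (- \<mu> * q)"
  have D0: "D \<ge> 0" by (simp add: D_def)
  have vD: "\<bar>v1 t - v2 t\<bar> \<le> D * exp (\<mu> * t)" if "t \<in> {0..R}" for t
    using q(2)[OF that] by (simp add: D_def exp_minus field_simps)
  have lbd: "locally_bounded_borel (\<lambda>t. exp (v1 t) - exp (v2 t))" "locally_bounded_borel (\<lambda>t. w1 t - w2 t)"
    by (auto intro!: locally_bounded_borel_continuous continuous_intros s1 s2)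
  have wD: "\<bar>w1 t - w2 t\<bar> \<le> CB * D * exp (\<mu> * t)" if t: "t \<in> {0..R}" for t
  proof -
    have "w1 t - w2 t = opB (\<lambda>t. exp (v1 t) - exp (v2 t)) t"
      using s1(4)[of t] s2(4)[of t] B.rop_diff[OF s1(6) s2(6), of t] by simp
    then have "\<bar>w1 t - w2 t\<bar> = \<bar>opB (\<lambda>t. exp (v1 t) - exp (v2 t)) t\<bar>" by simp
    also have "\<dots> \<le> (D * exp (\<mu> * t)) * t powr (real N - 1 + \<alpha> + 3 - real N) / ((real N - 1 + \<alpha> + 1) * (real N - 1 + \<alpha> + 3 - real N))"
    proof (rule B.rop_abs_le[OF lbd(1)])
      fix s assume s: "0 \<le> s" "s \<le> t"
      have "\<bar>exp (v1 s) - exp (v2 s)\<bar> \<le> \<bar>v1 s - v2 s\<bar>"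
        by (rule abs_exp_diff_le[OF entire_sol_v_nonpos[OF 1] entire_sol_v_nonpos[OF 2]])
      also have "\<dots> \<le> D * exp (\<mu> * s)" using vD[of s] s t by simp
      also have "\<dots> \<le> D * exp (\<mu> * t)" using s \<mu> D0 by (intro mult_left_mono) auto
      finally show "\<bar>exp (v1 s) - exp (v2 s)\<bar> \<le> D * exp (\<mu> * t)" .
    qed (use t in auto)
    also have "\<dots> = (D * exp (\<mu> * t)) * (t powr (2 + \<alpha>) / ((real N + \<alpha>) * (2 + \<alpha>)))"
      by (simp add: algebra_simps)
    also have "\<dots> \<le> (D * exp (\<mu> * t)) * CB"
    proof (rule mult_left_mono)
      have "t powr (2 + \<alpha>) / ((real N + \<alpha>) * (2 + \<alpha>)) \<le> R powr (2 + \<alpha>) / ((real N + \<alpha>) * (2 + \<alpha>))"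
        using t alpha N3 by (intro divide_right_mono powr_mono2) auto
      then show "t powr (2 + \<alpha>) / ((real N + \<alpha>) * (2 + \<alpha>)) \<le> CB" by (simp add: CB_def)
    qed (use D0 in simp)
    finally show ?thesis by (simp add: mult_ac)
  qed
  have lbe: "locally_bounded_borel (\<lambda>t. c * exp (\<mu> * t))" for c
    by (intro locally_bounded_borel_continuous continuous_intros)
  have vq: "v1 q - v2 q = opA (\<lambda>t. w1 t - w2 t) q"
    using s1(3)[of q] s2(3)[of q] A.rop_diff[OF s1(5) s2(5), of q] by simp
  have "opA (\<lambda>t. w1 t - w2 t) q \<le> opA (\<lambda>t. CB * D * exp (\<mu> * t)) q"
    using wD q(1) by (intro A.rop_mono lbd lbe) (force simp: abs_le_iff)+
  moreover have "opA (\<lambda>t. (- CB * D) * exp (\<mu> * t)) q \<le> opA (\<lambda>t. w1 t - w2 t) q"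
    using wD q(1) by (intro A.rop_mono lbd lbe) (force simp: abs_le_iff)+
  moreover have "opA (\<lambda>t. (- CB * D) * exp (\<mu> * t)) q = - (CB * D * opA (\<lambda>t. exp (\<mu> * t)) q)"
    using A.rop_cmult[of "- CB * D" "\<lambda>t. exp (\<mu> * t)" q] by simp
  ultimately have "\<bar>v1 q - v2 q\<bar> \<le> CB * D * opA (\<lambda>t. exp (\<mu> * t)) q"
    using A.rop_cmult[of "CB * D" "\<lambda>t. exp (\<mu> * t)" q] unfolding vq by (simp add: abs_le_iff)
  also have "\<dots> \<le> CB * D * (R / (real N * \<mu>) * exp (\<mu> * q))"
    using opA_exp_le[OF \<mu>, of q R] q(1) CB D0 by (intro mult_left_mono) auto
  also have "\<dots> = D * exp (\<mu> * q) / 2" using N0 CB R by (simp add: \<mu>_def)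
  finally have "\<bar>v1 q - v2 q\<bar> \<le> D * exp (\<mu> * q) / 2" .
  moreover have "\<bar>v1 q - v2 q\<bar> = D * exp (\<mu> * q)" by (simp add: D_def exp_minus)
  ultimately have "D * exp (\<mu> * q) \<le> 0" by linarith
  then have "D \<le> 0" by (simp add: mult_le_0_iff not_le)
  then have "\<bar>v1 r - v2 r\<bar> \<le> 0" using vD[of r] r R D0 by simp
  then show ?thesis by simp
qed

text \<open>Comparison makes w increase along the sequence, and w < 0 bounds it from above
  independently of n. Dominated convergence then passes the integral system to the limit.\<close>

lemma entire_sol_limit:
  assumes sol: "\<And>n::nat. entire_sol N \<alpha> (b n) (v n) (w n)" and b: "\<And>n. b n < b (Suc n)" "b \<longlonglongrightarrow> \<beta>"
  shows "\<exists>v' w'. entire_sol N \<alpha> \<beta> v' w' \<and> (\<forall>r\<ge>0. (\<lambda>n. v n r) \<longlonglongrightarrow> v' r)"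
proof -
  note s = entire_solD[OF sol]
  have incb: "incseq b" using b(1) by (intro incseq_SucI less_imp_le)
  have neg: "w n r \<le> 0" for n r
  proof (cases "r \<ge> 0")
    case True then show ?thesis using entire_sol_w_neg[OF sol] less_imp_le by blast
  next
    case False
    then have "w n r = b n" using s(4)[of n r] by (simp add: B.rop_neg)
    then show ?thesis using entire_sol_w_neg[OF sol, of 0 n] s(8)[of n] by simp
  qed
  have ge: "b 0 \<le> w n r" for n r
    using entire_sol_w_ge[OF sol, of n r] incseqD[OF incb, of 0 n] by simp
  have inc: "incseq (\<lambda>n. w n r)" for r
  proof (rule incseq_SucI)
    fix n
    show "w n r \<le> w (Suc n) r"
    proof (cases "r \<ge> 0")
      case True
      then show ?thesis using entire_sol_comparison(1)[OF sol[of n] sol[of "Suc n"] b(1) True] b(1)[of n] by linarith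
    next
      case False
      then show ?thesis using s(4)[of n r] s(4)[of "Suc n" r] b(1)[of n] by (simp add: B.rop_neg)
    qed
  qed
  have conv: "convergent (\<lambda>n. w n r)" for r
    using incseq_convergent[OF inc, of r 0] neg by (metis convergentI)
  define W where "W r = lim (\<lambda>n. w n r)" for r
  have Wlim: "(\<lambda>n. w n r) \<longlonglongrightarrow> W r" for r using conv[of r] by (simp add: W_def convergent_LIMSEQ_iff)
  have bd: "\<bar>w n r\<bar> \<le> \<bar>b 0\<bar>" for n r using neg[of n r] ge[of n r] by simp
  have lbW: "locally_bounded_borel W"
    unfolding locally_bounded_borel_def
  proof (intro conjI allI)
    show "W \<in> borel_measurable borel"
      by (rule borel_measurable_LIMSEQ_real[OF Wlim]) (auto intro!: borel_measurable_continuous_onI s(2))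
    have "\<bar>W t\<bar> \<le> \<bar>b 0\<bar>" for t using bd by (intro LIMSEQ_le_const2[OF tendsto_rabs[OF Wlim]]) auto
    then show "\<exists>C. \<forall>t\<in>{0..R}. \<bar>W t\<bar> \<le> C" for R by blast
  qed
  define V where "V = opA W"
  have cV: "continuous_on UNIV V" unfolding V_def by (rule A.rop_continuous[OF lbW])
  have cE: "continuous_on UNIV (\<lambda>t. exp (V t))" by (intro continuous_intros cV)
  have Vlim: "(\<lambda>n. v n r) \<longlonglongrightarrow> V r" if "r \<ge> 0" for r
  proof -
    have "(\<lambda>n. opA (w n) r) \<longlonglongrightarrow> opA W r"
      using that bd by (intro A.rop_tendsto[where C = "\<bar>b 0\<bar>"] s(5) lbW Wlim) auto
    then show ?thesis unfolding V_def s(3)[symmetric] .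
  qed
  have Weq: "W r = \<beta> + opB (\<lambda>t. exp (V t)) r" for r
  proof -
    have "(\<lambda>n. b n + opB (\<lambda>t. exp (v n t)) r) \<longlonglongrightarrow> \<beta> + opB (\<lambda>t. exp (V t)) r"
    proof (intro tendsto_intros b(2))
      show "(\<lambda>n. opB (\<lambda>t. exp (v n t)) r) \<longlonglongrightarrow> opB (\<lambda>t. exp (V t)) r"
      proof (cases "r \<ge> 0")
        case True
        then show ?thesis
          using entire_sol_v_nonpos[OF sol]
          by (intro B.rop_tendsto[where C = 1] s(6) locally_bounded_borel_continuous[OF cE] tendsto_exp Vlim) auto
      qed (simp add: B.rop_neg)
    qed
    then show ?thesis using LIMSEQ_unique[OF Wlim] unfolding s(4)[symmetric] by blast
  qed
  have cW: "continuous_on UNIV W"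
  proof -
    have "continuous_on UNIV (\<lambda>r. \<beta> + opB (\<lambda>t. exp (V t)) r)"
      by (intro continuous_intros B.rop_continuous locally_bounded_borel_continuous[OF cE])
    then show ?thesis using Weq by (simp cong: continuous_on_cong)
  qed
  have "entire_sol N \<alpha> \<beta> V W" unfolding entire_sol_def using cV cW Weq V_def by auto
  then show ?thesis using Vlim by blast
qed

definition entire_parameters :: "real set" where "entire_parameters = {\<beta>. \<exists>v w. entire_sol N \<alpha> \<beta> v w}"

lemma beta0_eq: "beta0 N \<alpha> = Sup entire_parameters"
  by (simp add: beta0_def entire_parameters_def R_max_infinite_iff)

lemma entire_parameters_neg: "\<beta> \<in> entire_parameters \<Longrightarrow> \<beta> < 0"
  using entire_sol_w_neg[of \<beta> _ _ 0] entire_solD(8)[of \<beta>] by (force simp: entire_parameters_def)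

lemma entire_parameters_down: "\<beta>' \<in> entire_parameters \<Longrightarrow> \<beta> \<le> \<beta>' \<Longrightarrow> \<beta> \<in> entire_parameters"
proof -
  assume "\<beta>' \<in> entire_parameters" "\<beta> \<le> \<beta>'"
  then obtain v w where "entire_sol N \<alpha> \<beta>' v w" by (auto simp: entire_parameters_def)
  then have "\<exists>vb wb. supersol N \<alpha> \<beta> R vb wb" for R using supersol_of_entire_sol \<open>\<beta> \<le> \<beta>'\<close> by blast
  then obtain v' w' where "entire_sol N \<alpha> \<beta> v' w'" using minimal_entire_sol by metis
  then show ?thesis by (auto simp: entire_parameters_def)
qed

lemma gaussian_decay:
  assumes "c > 0"
  shows "\<exists>K. \<forall>t\<ge>1. t powr (real N - 1 + \<alpha>) * (t\<^sup>2 * exp (- c * t\<^sup>2)) \<le> K * t powr (- 2)"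
    "\<exists>K. \<forall>t\<ge>1. t powr (real N - 1 + \<alpha>) * exp (- c * t\<^sup>2) \<le> K * t powr (- 2)"
proof -
  define f where "f t = t powr (real N - 1 + \<alpha>) * (t\<^sup>2 * exp (- c * t\<^sup>2)) * t powr 2" for t :: real
  have "(f \<longlongrightarrow> 0) at_top" unfolding f_def using assms by real_asymp
  then have "\<forall>\<^sub>F t in at_top. f t < 1" by (rule order_tendstoD) simp
  then obtain T where T: "\<And>t. t \<ge> T \<Longrightarrow> f t < 1" by (auto simp: eventually_at_top_linorder)
  have "bounded (f ` {1..max 1 T})"
    unfolding f_def by (intro compact_imp_bounded compact_continuous_image) (auto intro!: continuous_intros)
  then obtain B where B: "\<And>t. t \<in> {1..max 1 T} \<Longrightarrow> \<bar>f t\<bar> \<le> B"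
    unfolding bounded_iff by (metis image_eqI real_norm_def)
  define K where "K = max 1 B"
  have *: "t powr (real N - 1 + \<alpha>) * (t\<^sup>2 * exp (- c * t\<^sup>2)) \<le> K * t powr (- 2)" if "t \<ge> 1" for t
  proof -
    have "f t \<le> K"
    proof (cases "t \<ge> T")
      case True
      then show ?thesis using T[of t] by (simp add: K_def)
    next
      case False
      then show ?thesis using B[of t] that by (simp add: K_def)
    qed
    then have "t powr (real N - 1 + \<alpha>) * (t\<^sup>2 * exp (- c * t\<^sup>2)) * t powr 2 \<le> K" by (simp only: f_def)
    then have "t powr (real N - 1 + \<alpha>) * (t\<^sup>2 * exp (- c * t\<^sup>2)) * t powr 2 * t powr (- 2) \<le> K * t powr (- 2)"
      by (intro mult_right_mono) auto
    moreover have "t powr 2 * t powr (- 2) = 1" using that unfolding powr_add[symmetric] by simp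
    ultimately show ?thesis by (simp only: mult.assoc mult_1_right)
  qed
  show "\<exists>K. \<forall>t\<ge>1. t powr (real N - 1 + \<alpha>) * (t\<^sup>2 * exp (- c * t\<^sup>2)) \<le> K * t powr (- 2)" using * by blast
  have "t powr (real N - 1 + \<alpha>) * exp (- c * t\<^sup>2) \<le> K * t powr (- 2)" if "t \<ge> 1" for t
  proof -
    have "t powr (real N - 1 + \<alpha>) * (1 * exp (- c * t\<^sup>2)) \<le> t powr (real N - 1 + \<alpha>) * (t\<^sup>2 * exp (- c * t\<^sup>2))"
      using that by (intro mult_left_mono mult_right_mono) auto
    then show ?thesis using *[OF that] by simp
  qed
  then show "\<exists>K. \<forall>t\<ge>1. t powr (real N - 1 + \<alpha>) * exp (- c * t\<^sup>2) \<le> K * t powr (- 2)" by blast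
qed

text \<open>An explicit supersolution: w = \<beta>/2 with v = \<beta> r^2 / (4N), for which the
  equation of v is an equality.\<close>

lemma entire_sol_very_negative:
  "\<exists>B0<0. \<forall>\<beta>\<le>B0. \<exists>v w. entire_sol N \<alpha> \<beta> v w \<and> (\<forall>r\<ge>0. v r \<le> \<beta> / (4 * real N) * r\<^sup>2)"
proof -
  obtain K where "\<And>t. t \<ge> 1 \<Longrightarrow> t powr (real N - 1 + \<alpha>) * exp (- 1 * t\<^sup>2) \<le> K * t powr (- 2)"
    using gaussian_decay(2)[of 1] by auto
  moreover have "continuous_on UNIV (\<lambda>t::real. exp (- 1 * t\<^sup>2))" by (intro continuous_intros)
  ultimately obtain C where C: "\<And>r. r \<ge> 0 \<Longrightarrow> opB (\<lambda>t. exp (- 1 * t\<^sup>2)) r \<le> C"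
    using B.rop_bounded[of "\<lambda>t. exp (- 1 * t\<^sup>2)" K] by (metis exp_ge_zero)
  \<comment> \<open>The term 4 N makes \<beta> / (4N) at most -1, so e^v is below the fixed
    Gaussian; the term 2 |C| lets \<beta>/2 absorb the integral bounded by \<open>C\<close>.\<close>
  define B0 where "B0 = - (4 * real N + 2 * \<bar>C\<bar>)"
  have N0: "real N > 0" using N3 by simp
  have "\<exists>v w. entire_sol N \<alpha> \<beta> v w \<and> (\<forall>r\<ge>0. v r \<le> \<beta> / (4 * real N) * r\<^sup>2)" if \<beta>: "\<beta> \<le> B0" for \<beta>
  proof -
    let ?v = "\<lambda>r. \<beta> / (4 * real N) * r\<^sup>2" and ?w = "\<lambda>_::real. \<beta> / 2"
    have b1: "\<beta> / (4 * real N) \<le> - 1" using \<beta> N0 by (simp add: B0_def field_simps)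
    have sup: "supersol N \<alpha> \<beta> R ?v ?w" for R
      unfolding supersol_def
    proof (intro conjI ballI)
      fix r assume r: "r \<in> {0..R}"
      show "opA ?w r \<le> ?v r" using r by (subst opA_const) auto
      have "opB (\<lambda>t. exp (?v t)) r \<le> opB (\<lambda>t. exp (- 1 * t\<^sup>2)) r"
      proof (intro B.rop_mono locally_bounded_borel_continuous)
        show "exp (?v t) \<le> exp (- 1 * t\<^sup>2)" for t
          using mult_right_mono[OF b1, of "t\<^sup>2"] by simp
      qed (intro continuous_intros)+
      also have "\<dots> \<le> C" using C r by simp
      finally show "\<beta> + opB (\<lambda>t. exp (?v t)) r \<le> ?w r" using \<beta> N0 by (simp add: B0_def)
    qed (use N0 in \<open>auto intro!: continuous_intros\<close>)
    have sup': "\<exists>vb wb. supersol N \<alpha> \<beta> R vb wb" for R using sup by blast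
    obtain v w where "entire_sol N \<alpha> \<beta> v w" "\<And>R vb wb r. supersol N \<alpha> \<beta> R vb wb \<Longrightarrow> 0 \<le> r \<Longrightarrow> r \<le> R \<Longrightarrow> v r \<le> vb r \<and> w r \<le> wb r"
      by (rule minimal_entire_sol[OF sup'], rule that) blast+
    then show ?thesis using sup by (meson order_refl)
  qed
  moreover have "B0 < 0" using N0 by (simp add: B0_def)
  ultimately show ?thesis by blast
qed

lemma entire_parameters_bdd: "bdd_above entire_parameters" and entire_parameters_nonempty: "entire_parameters \<noteq> {}"
  using entire_parameters_neg less_imp_le entire_sol_very_negative by (auto simp: bdd_above_def entire_parameters_def) blast+

text \<open>The set is closed downwards by supersolutions, and it contains its supremum by the limit
  of solutions with increasing parameters.\<close>

lemma entire_parameters_iff: "\<beta> \<in> entire_parameters \<longleftrightarrow> \<beta> \<le> beta0 N \<alpha>"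
proof
  show "\<beta> \<in> entire_parameters \<Longrightarrow> \<beta> \<le> beta0 N \<alpha>" unfolding beta0_eq by (rule cSup_upper[OF _ entire_parameters_bdd])
  have lt: "\<beta> \<in> entire_parameters" if "\<beta> < beta0 N \<alpha>" for \<beta>
    using less_cSupD[OF entire_parameters_nonempty that[unfolded beta0_eq]] entire_parameters_down less_imp_le by blast
  have "beta0 N \<alpha> \<in> entire_parameters"
  proof -
    define b where "b n = beta0 N \<alpha> - inverse (real (Suc n))" for n
    have "\<exists>v w. entire_sol N \<alpha> (b n) v w" for n using lt[of "b n"] by (simp add: b_def entire_parameters_def)
    then obtain v w where "\<And>n. entire_sol N \<alpha> (b n) (v n) (w n)" by metis
    moreover have "b n < b (Suc n)" for n by (simp add: b_def)
    moreover have "b \<longlonglongrightarrow> beta0 N \<alpha> - 0" unfolding b_def by (intro tendsto_intros LIMSEQ_inverse_real_of_nat)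
    ultimately show ?thesis using entire_sol_limit[of b v w "beta0 N \<alpha>"] by (auto simp: entire_parameters_def)
  qed
  then show "\<beta> \<le> beta0 N \<alpha> \<Longrightarrow> \<beta> \<in> entire_parameters" by (rule entire_parameters_down)
qed

text \<open>The perturbed pair w + \<epsilon> g, v + \<epsilon> opA g is a supersolution for \<beta>
  + \<epsilon>. It suffices that 1 + opB (a g) is at most g, where \<open>a\<close> dominates the
  linearised potential; g = exp (opB a) has this Gronwall property and is bounded because
  \<open>a\<close> decays like a Gaussian.\<close>

lemma entire_sol_open:
  assumes sol: "entire_sol N \<alpha> \<beta> v w" and c: "c > 0" "\<And>r. r \<ge> 0 \<Longrightarrow> w r \<le> - c"
  shows "\<exists>\<beta>'>\<beta>. \<beta>' \<in> entire_parameters"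
proof -
  note s = entire_solD[OF sol]
  have N0: "real N > 0" using N3 by simp
  \<comment> \<open>The factor t^2 / (2N) comes from opA g at most g t^2 / (2N). The Gaussian has
    half of the rate of e^v, the other half being left to the perturbation.\<close>
  define a where "a t = t\<^sup>2 * exp (- (c / (4 * real N)) * t\<^sup>2) / (2 * real N)" for t
  have ca: "continuous_on UNIV a" unfolding a_def using N0 by (intro continuous_intros) auto
  have a0: "a t \<ge> 0" for t using N0 by (simp add: a_def)
  note lba = locally_bounded_borel_continuous[OF ca]
  obtain K where K: "\<And>t. t \<ge> 1 \<Longrightarrow> t powr (real N - 1 + \<alpha>) * (t\<^sup>2 * exp (- (c / (4 * real N)) * t\<^sup>2)) \<le> K * t powr (- 2)"
    using gaussian_decay(1)[of "c / (4 * real N)"] c N0 by auto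
  have K': "t powr (real N - 1 + \<alpha>) * a t \<le> K / (2 * real N) * t powr (- 2)" if "t \<ge> 1" for t
    using divide_right_mono[OF K[OF that], of "2 * real N"] N0 by (simp add: a_def)
  obtain G0 where G0: "\<And>r. r \<ge> 0 \<Longrightarrow> opB a r \<le> G0"
    using B.rop_bounded[OF ca a0 K'] by blast
  define g where "g r = exp (opB a r)" for r
  define G where "G = exp G0"
  have cg: "continuous_on UNIV g" unfolding g_def by (intro continuous_intros B.rop_continuous lba)
  note lbg = locally_bounded_borel_continuous[OF cg]
  have gG: "g r \<le> G" if "r \<ge> 0" for r using G0[OF that] by (simp add: g_def G_def)
  have gmono: "g r \<le> g t" if "0 \<le> r" "r \<le> t" for r t
    unfolding g_def using B.rop_increasing[OF lba a0 that] by simp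
  have G1: "G > 0" by (simp add: G_def)
  \<comment> \<open>With this choice \<epsilon> opA g is at most c t^2 / (4N), half of the decay
    that w below -c provides.\<close>
  define \<epsilon> where "\<epsilon> = c / (2 * G)"
  have \<epsilon>: "\<epsilon> > 0" "\<epsilon> * G = c / 2" using c G1 by (auto simp: \<epsilon>_def)
  have opAg: "opA g t \<le> g t * t\<^sup>2 / (2 * real N)" "0 \<le> opA g t" if "t \<ge> 0" for t
  proof -
    have "opA g t \<le> opA (\<lambda>_. g t) t" using gmono by (intro A.rop_mono lbg) auto
    then show "opA g t \<le> g t * t\<^sup>2 / (2 * real N)" using that by (simp add: opA_const)
    show "0 \<le> opA g t" by (intro A.rop_nonneg lbg) (simp add: g_def)
  qed
  let ?w = "\<lambda>r. w r + \<epsilon> * g r" and ?v = "\<lambda>r. v r + \<epsilon> * opA g r"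
  have cag: "continuous_on UNIV (\<lambda>t. a t * g t)" by (intro continuous_intros ca cg)
  note lbag = locally_bounded_borel_continuous[OF cag]
  have cv: "continuous_on UNIV ?v" by (intro continuous_intros s(1) A.rop_continuous lbg)
  have cev: "continuous_on UNIV (\<lambda>t. exp (?v t))" by (intro continuous_intros cv)
  have key: "exp (?v t) \<le> exp (v t) + \<epsilon> * (a t * g t)" if t: "t \<ge> 0" for t
  proof -
    have "v t \<le> - c * t\<^sup>2 / (2 * real N)"
    proof -
      have "opA w t \<le> opA (\<lambda>_. - c) t" using c by (intro A.rop_mono s(5)) auto
      then show ?thesis using s(3)[of t] t by (simp add: opA_const)
    qed
    moreover have d: "\<epsilon> * opA g t \<le> \<epsilon> * (g t * t\<^sup>2 / (2 * real N))" using opAg[OF t] \<epsilon> by (intro mult_left_mono) auto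
    moreover have "\<epsilon> * (g t * t\<^sup>2 / (2 * real N)) \<le> c * t\<^sup>2 / (4 * real N)"
    proof -
      have "\<epsilon> * g t * (t\<^sup>2 / (2 * real N)) \<le> \<epsilon> * G * (t\<^sup>2 / (2 * real N))"
        using gG[OF t] \<epsilon>(1) N0 by (intro mult_right_mono mult_left_mono) auto
      then show ?thesis unfolding \<epsilon>(2) by simp
    qed
    moreover have "- c * t\<^sup>2 / (2 * real N) + c * t\<^sup>2 / (4 * real N) = - (c / (4 * real N)) * t\<^sup>2"
      using N0 by (simp add: field_simps)
    ultimately have "?v t \<le> - (c / (4 * real N)) * t\<^sup>2" by linarith
    then have e1: "exp (?v t) \<le> exp (- (c / (4 * real N)) * t\<^sup>2)" by simp
    have "exp (?v t) - exp (v t) = exp (?v t) * (1 - exp (- (\<epsilon> * opA g t)))"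
      by (simp add: exp_add exp_minus field_simps)
    also have "\<dots> \<le> exp (?v t) * (\<epsilon> * opA g t)"
      using exp_ge_add_one_self[of "- (\<epsilon> * opA g t)"] by (intro mult_left_mono) auto
    also have "\<dots> \<le> exp (- (c / (4 * real N)) * t\<^sup>2) * (\<epsilon> * (g t * t\<^sup>2 / (2 * real N)))"
      using e1 d opAg[OF t] \<epsilon> by (intro mult_mono) auto
    also have "\<dots> = \<epsilon> * (a t * g t)" by (simp add: a_def)
    finally show ?thesis by simp
  qed
  have ag: "1 + opB (\<lambda>t. a t * g t) r \<le> g r" if r: "r \<ge> 0" for r
  proof -
    let ?f = "\<lambda>r. g r - opB (\<lambda>t. a t * g t) r"
    have "?f 0 \<le> ?f r"
    proof (rule nondecreasing_of_derivative[OF r, where f' = "\<lambda>x. g x * (x powr (1 - real N) * radial_moment (real N - 1 + \<alpha>) a x) - x powr (1 - real N) * radial_moment (real N - 1 + \<alpha>) (\<lambda>t. a t * g t) x"])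
      show "continuous_on {0..r} ?f"
        by (intro continuous_intros continuous_on_subset[OF cg] continuous_on_subset[OF B.rop_continuous[OF lbag]]) auto
      fix x assume x: "0 < x" "x < r"
      show "(?f has_real_derivative g x * (x powr (1 - real N) * radial_moment (real N - 1 + \<alpha>) a x) - x powr (1 - real N) * radial_moment (real N - 1 + \<alpha>) (\<lambda>t. a t * g t) x) (at x)"
        unfolding g_def[abs_def]
        by (intro DERIV_diff DERIV_chain2[OF DERIV_exp] B.rop_has_derivative[OF lba x(1)] B.rop_has_derivative[OF lbag[unfolded g_def[abs_def]] x(1)])
      have "radial_moment (real N - 1 + \<alpha>) (\<lambda>t. a t * g t) x \<le> radial_moment (real N - 1 + \<alpha>) (\<lambda>t. g x * a t) x"
      proof (intro B.mom_mono lbag locally_bounded_borel_cmult lba)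
        show "a t * g t \<le> g x * a t" if "0 \<le> t" "t \<le> x" for t
          using mult_left_mono[OF gmono[OF that] a0[of t]] by (simp add: mult.commute)
      qed
      also have "\<dots> = g x * radial_moment (real N - 1 + \<alpha>) a x" by (rule B.mom_cmult)
      finally have "x powr (1 - real N) * radial_moment (real N - 1 + \<alpha>) (\<lambda>t. a t * g t) x \<le> x powr (1 - real N) * (g x * radial_moment (real N - 1 + \<alpha>) a x)"
        by (intro mult_left_mono) auto
      then show "0 \<le> g x * (x powr (1 - real N) * radial_moment (real N - 1 + \<alpha>) a x) - x powr (1 - real N) * radial_moment (real N - 1 + \<alpha>) (\<lambda>t. a t * g t) x"
        by (simp add: mult_ac)
    qed
    then show ?thesis by (simp add: g_def B.rop_neg)
  qed
  have "supersol N \<alpha> (\<beta> + \<epsilon>) R ?v ?w" for R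
    unfolding supersol_def
  proof (intro conjI ballI)
    show "continuous_on {0..R} ?v" using cv continuous_on_subset by blast
    show "continuous_on {0..R} ?w" by (intro continuous_intros s(2) continuous_on_subset[OF cg]) auto
    fix r assume r: "r \<in> {0..R}"
    show "opA ?w r \<le> ?v r"
      using A.rop_add[OF s(5) locally_bounded_borel_cmult[OF lbg], of \<epsilon> r] A.rop_cmult[of \<epsilon> g r] s(3)[of r] by simp
    have "opB (\<lambda>t. exp (?v t)) r \<le> opB (\<lambda>t. exp (v t) + \<epsilon> * (a t * g t)) r"
      using key by (intro B.rop_mono locally_bounded_borel_continuous cev) (auto intro!: continuous_intros s(1) ca cg)
    also have "\<dots> = opB (\<lambda>t. exp (v t)) r + \<epsilon> * opB (\<lambda>t. a t * g t) r"
      using B.rop_add[OF s(6) locally_bounded_borel_cmult[OF lbag], of \<epsilon> r] B.rop_cmult[of \<epsilon> "\<lambda>t. a t * g t" r] by simp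
    finally have "\<beta> + \<epsilon> + opB (\<lambda>t. exp (?v t)) r \<le> w r + \<epsilon> * (1 + opB (\<lambda>t. a t * g t) r)"
      using s(4)[of r] by (simp add: algebra_simps)
    also have "\<dots> \<le> ?w r" using ag[of r] r \<epsilon> by simp
    finally show "\<beta> + \<epsilon> + opB (\<lambda>t. exp (?v t)) r \<le> ?w r" .
  qed
  then obtain v' w' where "entire_sol N \<alpha> (\<beta> + \<epsilon>) v' w'" using minimal_entire_sol by metis
  then show ?thesis using \<epsilon> by (intro exI[of _ "\<beta> + \<epsilon>"]) (auto simp: entire_parameters_def)
qed

lemma beta0_w_sup:
  assumes sol: "entire_sol N \<alpha> (beta0 N \<alpha>) v w" and \<epsilon>: "\<epsilon> > 0"
  shows "\<exists>R\<ge>0. \<forall>r\<ge>R. - \<epsilon> < w r"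
proof -
  have "\<exists>R\<ge>0. w R > - \<epsilon>"
    using entire_sol_open[OF sol \<epsilon>] entire_parameters_iff by (meson not_le)
  then show ?thesis using w_mono[OF sol] by (meson less_le_trans)
qed

text \<open>The parameter gap persists for all r by comparison with the solution at the critical
  parameter, whose w is itself negative.\<close>

lemma entire_sol_w_le:
  assumes sol: "entire_sol N \<alpha> \<beta> v w" and lt: "\<beta> < beta0 N \<alpha>" and r: "r \<ge> 0"
  shows "w r \<le> \<beta> - beta0 N \<alpha>"
proof -
  obtain v' w' where s': "entire_sol N \<alpha> (beta0 N \<alpha>) v' w'" using entire_parameters_iff[of "beta0 N \<alpha>"] by (auto simp: entire_parameters_def)
  show ?thesis using entire_sol_comparison(1)[OF sol s' lt r] entire_sol_w_neg[OF s' r] by simp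
qed

end

section \<open>Emden-Fowler variables\<close>


lemma nondecreasing_tendsto_0_imp_nonpos:
  fixes f g :: "real \<Rightarrow> real"
  assumes "\<And>s t. s \<le> t \<Longrightarrow> f s \<le> f t" "\<And>t. t \<ge> t0 \<Longrightarrow> f t \<le> g t" "(g \<longlongrightarrow> 0) at_top"
  shows "f t \<le> 0"
proof (rule tendsto_lowerbound[OF assms(3)])
  show "\<forall>\<^sub>F s in at_top. f t \<le> g s"
    using eventually_ge_at_top[of "max t t0"] by eventually_elim (use assms order_trans in \<open>metis max.bounded_iff\<close>)
qed simp

lemma nonincreasing_tendsto_0_imp_nonpos:
  fixes f g :: "real \<Rightarrow> real"
  assumes "\<And>s t. s \<le> t \<Longrightarrow> f t \<le> f s" "\<And>t. t \<le> t0 \<Longrightarrow> f t \<le> g t" "(g \<longlongrightarrow> 0) at_bot"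
  shows "f t \<le> 0"
proof (rule tendsto_lowerbound[OF assms(3)])
  show "\<forall>\<^sub>F s in at_bot. f t \<le> g s"
    using eventually_le_at_bot[of "min t t0"] by eventually_elim (use assms order_trans in \<open>metis min.bounded_iff\<close>)
qed simp

lemma exp_powr: "exp (t::real) powr a = exp (a * t)"
  by (simp add: powr_def)

context radial_problem begin

text \<open>Emden--Fowler variables \<open>t = ln r\<close>: \<open>zt = v + (4 + \<alpha>) t\<close>, \<open>Yt = r v'\<close>, \<open>Qt = r\<^sup>2 w\<close>, \<open>St = r^3 w'\<close>.\<close>

definition zt :: "(real \<Rightarrow> real) \<Rightarrow> real \<Rightarrow> real" where "zt v t = v (exp t) + (4 + \<alpha>) * t"
definition Yt :: "(real \<Rightarrow> real) \<Rightarrow> real \<Rightarrow> real" where "Yt w t = exp ((2 - real N) * t) * momA w (exp t)"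
definition Qt :: "(real \<Rightarrow> real) \<Rightarrow> real \<Rightarrow> real" where "Qt w t = exp (2 * t) * w (exp t)"
definition St :: "(real \<Rightarrow> real) \<Rightarrow> real \<Rightarrow> real" where "St v t = exp ((4 - real N) * t) * momB v (exp t)"

context
  fixes \<beta> v w
  assumes sol: "entire_sol N \<alpha> \<beta> v w"
begin

text \<open>Chained, these four equations read D (D+N-2) (D-2) (D+N-4) z = e^z - lam. Writing them
  as a system keeps every intermediate quantity with a known sign.\<close>

lemma log_derivatives:
  "(zt v has_real_derivative Yt w t + (4 + \<alpha>)) (at t)"
  "(Yt w has_real_derivative - (real N - 2) * Yt w t + Qt w t) (at t)"
  "(Qt w has_real_derivative 2 * Qt w t + St v t) (at t)"
  "(St v has_real_derivative - (real N - 4) * St v t + exp (zt v t)) (at t)"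
proof -
  note d = entire_sol_derivatives[OF sol exp_gt_zero[of t]]
  have e: "(exp has_real_derivative exp t) (at t)" by (rule DERIV_exp)
  have ec: "((\<lambda>t. exp (c * t)) has_real_derivative c * exp (c * t)) (at t)" for c :: real
    by (auto intro!: derivative_eq_intros)
  show "(zt v has_real_derivative Yt w t + (4 + \<alpha>)) (at t)"
    unfolding zt_def[abs_def]
  proof (rule DERIV_cong[OF DERIV_add[OF DERIV_chain2[OF d(1) e] DERIV_cmult_Id]])
    have "exp ((1 - real N) * t) * exp t = exp ((2 - real N) * t)" unfolding exp_add[symmetric] by (simp add: algebra_simps)
    then show "exp t powr (1 - real N) * momA w (exp t) * exp t + (4 + \<alpha>) = Yt w t + (4 + \<alpha>)"
      by (simp add: exp_powr Yt_def mult_ac)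
  qed
  show "(Yt w has_real_derivative - (real N - 2) * Yt w t + Qt w t) (at t)"
    unfolding Yt_def[abs_def] Qt_def
  proof (rule DERIV_cong[OF DERIV_mult[OF ec DERIV_chain2[OF d(3) e]]])
    have "exp ((2 - real N) * t) * (exp ((real N - 1) * t) * exp t) = exp (2 * t)"
      unfolding exp_add[symmetric] by (simp add: algebra_simps)
    then show "(2 - real N) * exp ((2 - real N) * t) * momA w (exp t) + exp t powr (real N - 1) * w (exp t) * exp t * exp ((2 - real N) * t)
      = - (real N - 2) * (exp ((2 - real N) * t) * momA w (exp t)) + exp (2 * t) * w (exp t)"
      by (simp add: exp_powr algebra_simps)
  qed
  show "(Qt w has_real_derivative 2 * Qt w t + St v t) (at t)"
    unfolding Qt_def[abs_def] St_def
  proof (rule DERIV_cong[OF DERIV_mult[OF ec DERIV_chain2[OF d(2) e]]])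
    have "exp (2 * t) * (exp ((1 - real N) * t) * exp t) = exp ((4 - real N) * t)"
      unfolding exp_add[symmetric] by (simp add: algebra_simps)
    then show "2 * exp (2 * t) * w (exp t) + exp t powr (1 - real N) * momB v (exp t) * exp t * exp (2 * t)
      = 2 * (exp (2 * t) * w (exp t)) + exp ((4 - real N) * t) * momB v (exp t)"
      by (simp add: exp_powr mult_ac)
  qed
  show "(St v has_real_derivative - (real N - 4) * St v t + exp (zt v t)) (at t)"
    unfolding St_def[abs_def] zt_def
  proof (rule DERIV_cong[OF DERIV_mult[OF ec DERIV_chain2[OF d(4) e]]])
    have "exp ((4 - real N) * t) * (exp ((real N - 1 + \<alpha>) * t) * exp t) = exp ((4 + \<alpha>) * t)"
      unfolding exp_add[symmetric] by (simp add: algebra_simps)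
    then have "exp (v (exp t)) * (exp ((4 - real N) * t) * (exp ((real N - 1 + \<alpha>) * t) * exp t)) = exp (v (exp t) + (4 + \<alpha>) * t)"
      by (simp add: exp_add)
    then show "(4 - real N) * exp ((4 - real N) * t) * momB v (exp t) + exp t powr (real N - 1 + \<alpha>) * exp (v (exp t)) * exp t * exp ((4 - real N) * t)
      = - (real N - 4) * (exp ((4 - real N) * t) * momB v (exp t)) + exp (v (exp t) + (4 + \<alpha>) * t)"
      by (simp add: exp_powr algebra_simps)
  qed
qed

lemma N_real: "real N \<ge> 3" using N3 by simp

lemma Qt_bounds: "\<beta> * exp (2 * t) \<le> Qt w t" "Qt w t < 0"
  using entire_sol_w_ge[OF sol, of "exp t"] entire_sol_w_neg[OF sol, of "exp t"]
  by (auto simp: Qt_def mult.commute mult_less_0_iff)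

lemma momA_bounds:
  assumes "r \<ge> 0"
  shows "\<beta> * r powr real N / real N \<le> momA w r" "momA w r \<le> w r * r powr real N / real N"
proof -
  have "momA (\<lambda>_. \<beta>) r \<le> momA w r"
    using entire_sol_w_ge[OF sol] by (intro A.mom_mono entire_solD[OF sol]) auto
  then show "\<beta> * r powr real N / real N \<le> momA w r" using assms by (simp add: A.mom_const)
  have "momA w r \<le> momA (\<lambda>_. w r) r"
    using w_mono[OF sol] by (intro A.mom_mono entire_solD[OF sol]) auto
  then show "momA w r \<le> w r * r powr real N / real N" using assms by (simp add: A.mom_const)
qed

lemma Yt_bounds: "\<beta> * exp (2 * t) / real N \<le> Yt w t" "Yt w t \<le> Qt w t / real N" "Yt w t < 0"
proof -
  have e: "exp ((2 - real N) * t) * exp t powr real N = exp (2 * t)"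
    unfolding exp_powr exp_add[symmetric] by (simp add: algebra_simps)
  have "exp ((2 - real N) * t) * (\<beta> * exp t powr real N / real N) \<le> Yt w t"
    unfolding Yt_def by (intro mult_left_mono momA_bounds) auto
  then show "\<beta> * exp (2 * t) / real N \<le> Yt w t" unfolding e[symmetric] by (simp add: mult_ac)
  have "Yt w t \<le> exp ((2 - real N) * t) * (w (exp t) * exp t powr real N / real N)"
    unfolding Yt_def by (intro mult_left_mono momA_bounds) auto
  then show *: "Yt w t \<le> Qt w t / real N" unfolding Qt_def e[symmetric] by (simp add: mult_ac)
  have "Qt w t / real N < 0" using Qt_bounds(2)[of t] N_real by (simp add: divide_less_0_iff)
  then show "Yt w t < 0" using * by simp
qed

lemma v_antimono: "0 \<le> r \<Longrightarrow> r \<le> s \<Longrightarrow> v s \<le> v r"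
proof -
  assume r: "0 \<le> r" "r \<le> s"
  have "- v r \<le> - v s"
  proof (rule nondecreasing_of_derivative[OF r(2)])
    show "continuous_on {r..s} (\<lambda>r. - v r)" by (intro continuous_intros entire_solD(1)[OF sol])
    fix x assume x: "r < x" "x < s"
    show "((\<lambda>r. - v r) has_real_derivative - (x powr (1 - real N) * momA w x)) (at x)"
      using x r by (intro DERIV_minus entire_sol_derivatives(1)[OF sol]) auto
    have "momA w x \<le> w x * x powr real N / real N" using x r by (intro momA_bounds) auto
    moreover have "w x * x powr real N / real N \<le> 0"
      using entire_sol_w_neg[OF sol, of x] x r by (intro divide_nonpos_nonneg mult_nonpos_nonneg) auto
    ultimately have "momA w x \<le> 0" by simp
    then show "0 \<le> - (x powr (1 - real N) * momA w x)" by (simp add: mult_nonneg_nonpos)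
  qed
  then show ?thesis by simp
qed

lemma momB_mono: "0 < r \<Longrightarrow> r \<le> s \<Longrightarrow> momB v r \<le> momB v s"
proof -
  assume r: "0 < r" "r \<le> s"
  show "momB v r \<le> momB v s"
  proof (rule nondecreasing_of_derivative[OF r(2)])
    show "continuous_on {r..s} (momB v)"
      by (rule continuous_on_subset[OF B.mom_continuous[OF entire_solD(6)[OF sol], of s]]) (use r in auto)
    show "(momB v has_real_derivative x powr (real N - 1 + \<alpha>) * exp (v x)) (at x)" if "r < x" for x
      using that r by (intro entire_sol_derivatives(4)[OF sol]) auto
  qed auto
qed

text \<open>From r on, \<open>momB\<close> is at least its value at r, so w rises by at least the
  integral of that value times s^(1-N) from r to infinity. Since w never becomes positive, this rise
  bounds w(r) from above.\<close>

lemma w_le_momB: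
  assumes r: "r > 0"
  shows "w r + momB v r * r powr (2 - real N) / (real N - 2) \<le> 0"
proof -
  let ?f = "\<lambda>x. w x + momB v r * x powr (2 - real N) / (real N - 2)"
  have "?f r \<le> momB v r / (real N - 2) * x powr (2 - real N)" if x: "x \<ge> r" for x
  proof -
    have "?f r \<le> ?f x"
    proof (rule nondecreasing_of_derivative[OF x, where f' = "\<lambda>x. x powr (1 - real N) * (momB v x - momB v r)"])
      show "continuous_on {r..x} ?f" using r N_real by (intro continuous_intros entire_solD(2)[OF sol]) auto
      fix u assume u: "r < u" "u < x"
      then have u0: "u > 0" using r by simp
      have "((\<lambda>x. x powr (2 - real N)) has_real_derivative (2 - real N) * u powr (2 - real N - 1)) (at u)"
        by (rule has_real_derivative_powr[OF u0])
      from DERIV_add[OF entire_sol_derivatives(2)[OF sol u0] DERIV_cdivide[OF DERIV_cmult[OF this, of "momB v r"], of "real N - 2"]]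
      have "(?f has_real_derivative u powr (1 - real N) * momB v u + momB v r * ((2 - real N) * u powr (2 - real N - 1)) / (real N - 2)) (at u)" .
      moreover have "momB v r * ((2 - real N) * u powr (2 - real N - 1)) / (real N - 2) = - (momB v r * u powr (1 - real N))"
        using N_real by (simp add: field_simps)
      ultimately show "(?f has_real_derivative u powr (1 - real N) * (momB v u - momB v r)) (at u)"
        by (simp add: algebra_simps)
      show "0 \<le> u powr (1 - real N) * (momB v u - momB v r)" using momB_mono[OF r, of u] u by simp
    qed
    moreover have "w x < 0" using entire_sol_w_neg[OF sol, of x] x r by simp
    ultimately show ?thesis by simp
  qed
  moreover have "((\<lambda>x. momB v r / (real N - 2) * x powr (2 - real N)) \<longlongrightarrow> momB v r / (real N - 2) * 0) at_top"
    using N_real by (intro tendsto_intros tendsto_neg_powr filterlim_ident) auto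
  ultimately show ?thesis
    by (intro tendsto_lowerbound[where F = at_top and f = "\<lambda>x. momB v r / (real N - 2) * x powr (2 - real N)"])
      (auto intro!: eventually_mono[OF eventually_ge_at_top[of r]])
qed

lemma St_bounds: "0 < St v t" "St v t \<le> - (real N - 2) * Qt w t" "exp (zt v t) / (real N + \<alpha>) \<le> St v t"
proof -
  show "0 < St v t" unfolding St_def using momB_pos[OF sol, of "exp t"] by simp
  have "exp (2 * t) * (w (exp t) + momB v (exp t) * exp t powr (2 - real N) / (real N - 2)) \<le> 0"
    using w_le_momB[of "exp t"] by (simp add: mult_nonneg_nonpos)
  moreover have "exp (2 * t) * exp t powr (2 - real N) = exp ((4 - real N) * t)"
    unfolding exp_powr exp_add[symmetric] by (simp add: algebra_simps)
  then have "exp (2 * t) * (w (exp t) + momB v (exp t) * exp t powr (2 - real N) / (real N - 2)) = Qt w t + St v t / (real N - 2)"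
    by (simp add: Qt_def St_def algebra_simps)
  ultimately have "Qt w t + St v t / (real N - 2) \<le> 0" by simp
  then show "St v t \<le> - (real N - 2) * Qt w t" using N_real by (simp add: field_simps)
  have "radial_moment (real N - 1 + \<alpha>) (\<lambda>_. exp (v (exp t))) (exp t) \<le> momB v (exp t)"
    using v_antimono by (intro B.mom_mono entire_solD(6)[OF sol]) auto
  then have "exp (v (exp t)) * exp t powr (real N + \<alpha>) / (real N + \<alpha>) \<le> momB v (exp t)"
    using B.mom_const[of "exp t" "exp (v (exp t))"] by simp
  then have "exp ((4 - real N) * t) * (exp (v (exp t)) * exp t powr (real N + \<alpha>) / (real N + \<alpha>)) \<le> St v t"
    unfolding St_def by (intro mult_left_mono) auto
  moreover have "exp ((4 - real N) * t) * exp t powr (real N + \<alpha>) = exp ((4 + \<alpha>) * t)"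
    unfolding exp_powr exp_add[symmetric] by (simp add: algebra_simps)
  then have "exp ((4 - real N) * t) * (exp (v (exp t)) * exp t powr (real N + \<alpha>) / (real N + \<alpha>)) = exp (zt v t) / (real N + \<alpha>)"
    by (simp add: zt_def exp_add algebra_simps)
  ultimately show "exp (zt v t) / (real N + \<alpha>) \<le> St v t" by linarith
qed

lemma exp_zt: "r > 0 \<Longrightarrow> exp (zt v (ln r)) = r powr (4 + \<alpha>) * exp (v r)"
  by (simp add: zt_def exp_add powr_def)

lemma log_cont: "continuous_on U (zt v)" "continuous_on U (Yt w)" "continuous_on U (Qt w)" "continuous_on U (St v)"
  using log_derivatives by (auto intro!: continuous_at_imp_continuous_on DERIV_isCont)

lemma decay_of_slope:
  assumes "\<delta> > 0" "\<And>t. t \<ge> t1 \<Longrightarrow> Yt w t + (4 + \<alpha>) \<le> - \<delta>"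
  shows "\<exists>C R \<delta>. \<delta> > 0 \<and> (\<forall>r\<ge>R. r powr \<alpha> * exp (v r) \<le> C * r powr (- 4 - \<delta>))"
proof -
  define C where "C = exp (zt v t1 + \<delta> * t1)"
  have "r powr \<alpha> * exp (v r) \<le> C * r powr (- 4 - \<delta>)" if r: "r \<ge> exp t1" for r
  proof -
    have r0: "r > 0" using r less_le_trans[OF exp_gt_zero] by blast
    define t where "t = ln r"
    have t: "t \<ge> t1" "exp t = r" using r r0 by (auto simp: t_def ln_ge_iff)
    have "- zt v t1 + 0 * (t - t1)\<^sup>2 / 2 + \<delta> * (t - t1) \<le> - zt v t"
    proof (rule increment_ge_linear[OF t(1), where F' = "\<lambda>t. - (Yt w t + (4 + \<alpha>))"])
      show "continuous_on {t1..t} (\<lambda>t. - zt v t)" by (intro continuous_intros log_cont)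
      show "((\<lambda>t. - zt v t) has_real_derivative - (Yt w x + (4 + \<alpha>))) (at x)" for x
        by (intro DERIV_minus log_derivatives)
      show "0 * (x - t1) + \<delta> \<le> - (Yt w x + (4 + \<alpha>))" if "t1 < x" for x using assms(2)[of x] that by simp
    qed
    then have "zt v t \<le> (zt v t1 + \<delta> * t1) + - \<delta> * t" by (simp add: algebra_simps)
    then have "exp (zt v t) \<le> C * exp (- \<delta> * t)" unfolding C_def exp_add[symmetric] by simp
    then have "exp (zt v t) * exp (- 4 * t) \<le> C * exp (- \<delta> * t) * exp (- 4 * t)" by (intro mult_right_mono) auto
    moreover have "exp (zt v t) * exp (- 4 * t) = r powr \<alpha> * exp (v r)"
      unfolding t(2)[symmetric] exp_powr zt_def exp_add[symmetric] by (simp add: algebra_simps)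
    moreover have "C * exp (- \<delta> * t) * exp (- 4 * t) = C * r powr (- 4 - \<delta>)"
      unfolding t(2)[symmetric] exp_powr mult.assoc exp_add[symmetric] by (simp add: algebra_simps)
    ultimately show ?thesis by linarith
  qed
  then show ?thesis using assms(1) by blast
qed

text \<open>Ties the slope of z to S: growth of S forces z to decrease.\<close>

lemma Yt_le_St: "Yt w t \<le> - St v t / (real N * (real N - 2))"
proof -
  have "Qt w t \<le> - St v t / (real N - 2)" using St_bounds(2)[of t] N_real by (simp add: field_simps)
  then have "Qt w t / real N \<le> - St v t / (real N - 2) / real N" using N_real by (intro divide_right_mono) auto
  then show ?thesis using Yt_bounds(2)[of t] by (simp add: mult.commute)
qed

section \<open>Decay in dimensions 3 and 4, and bounds on the potential\<close>

text \<open>The coefficient -(N-4) equals 1, so S grows at least like e^t and drives the slope of z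
  to minus infinity.\<close>

lemma decay_dimension_3:
  assumes "N = 3"
  shows "\<exists>C R \<delta>. \<delta> > 0 \<and> (\<forall>r\<ge>R. r powr \<alpha> * exp (v r) \<le> C * r powr (- 4 - \<delta>))"
proof -
  have S: "St v 0 * exp t \<le> St v t" if "t \<ge> 0" for t
  proof -
    have "exp (- 0) * St v 0 \<le> exp (- t) * St v t"
    proof (rule nondecreasing_of_derivative[OF that, where f' = "\<lambda>t. exp (- t) * exp (zt v t)"])
      show "continuous_on {0..t} (\<lambda>t. exp (- t) * St v t)" by (intro continuous_intros log_cont)
      fix x
      have "((\<lambda>t. exp (- t)) has_real_derivative - exp (- x)) (at x)" by (auto intro!: derivative_eq_intros)
      from DERIV_mult[OF this log_derivatives(4)]
      show "((\<lambda>t. exp (- t) * St v t) has_real_derivative exp (- x) * exp (zt v x)) (at x)"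
        by (rule DERIV_cong) (use assms in \<open>simp add: algebra_simps\<close>)
    qed auto
    then show ?thesis by (simp add: exp_minus field_simps)
  qed
  define s0 where "s0 = St v 0"
  have "s0 > 0" using St_bounds(1) by (simp add: s0_def)
  then have "filterlim (\<lambda>t::real. s0 / 3 * exp t) at_top at_top" by real_asymp
  then have "\<forall>\<^sub>F t in at_top. St v 0 / 3 * exp t > 5 + \<alpha>"
    unfolding filterlim_at_top_dense s0_def by blast
  then obtain t1 where t1: "\<And>t. t \<ge> t1 \<Longrightarrow> St v 0 / 3 * exp t > 5 + \<alpha>" by (auto simp: eventually_at_top_linorder)
  show ?thesis
  proof (rule decay_of_slope[of 1 "max 0 t1"])
    fix t assume "t \<ge> max 0 t1"
    then show "Yt w t + (4 + \<alpha>) \<le> - 1" using S[of t] t1[of t] Yt_le_St[of t] assms by simp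
  qed simp
qed

text \<open>Here S has no linear growth term of its own. The slope of z is nonincreasing; if it
  never became negative, z would stay above z(0), S would grow linearly, and S would make the slope
  negative after all.\<close>

lemma decay_dimension_4:
  assumes "N = 4"
  shows "\<exists>C R \<delta>. \<delta> > 0 \<and> (\<forall>r\<ge>R. r powr \<alpha> * exp (v r) \<le> C * r powr (- 4 - \<delta>))"
proof -
  have N4: "real N = 4" using assms by simp
  \<comment> \<open>\<open>E\<close> is Y'. Its forcing 2 Q + S is nonpositive by the bound on S, so
    e^(2t) E is nonincreasing; it tends to at most 0 as t goes to minus infinity, hence E is
    nonpositive.\<close>
  define E where "E t = - 2 * Yt w t + Qt w t" for t
  have dE: "(E has_real_derivative - 2 * E t + (2 * Qt w t + St v t)) (at t)" for t
    unfolding E_def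
    by (rule DERIV_cong[OF DERIV_add[OF DERIV_cmult[OF log_derivatives(2)] log_derivatives(3)]]) (simp add: N4)
  have E0: "E t \<le> 0" for t
  proof -
    have "exp (2 * t) * E t \<le> 0"
    proof (rule nonincreasing_tendsto_0_imp_nonpos[where f = "\<lambda>t. exp (2 * t) * E t" and t = t and t0 = 0 and g = "\<lambda>t. exp (2 * t) * (- 2 * \<beta> / 4 * exp (2 * t))"])
      show "exp (2 * t) * E t \<le> exp (2 * s) * E s" if "s \<le> t" for s t
      proof -
        have "- (exp (2 * s) * E s) \<le> - (exp (2 * t) * E t)"
        proof (rule nondecreasing_of_derivative[OF that, where f' = "\<lambda>t. - (exp (2 * t) * (2 * Qt w t + St v t))"])
          show "continuous_on {s..t} (\<lambda>t. - (exp (2 * t) * E t))"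
            unfolding E_def by (intro continuous_intros log_cont)
          fix x
          have "((\<lambda>t. exp (2 * t)) has_real_derivative 2 * exp (2 * x)) (at x)" by (auto intro!: derivative_eq_intros)
          from DERIV_minus[OF DERIV_mult[OF this dE]]
          show "((\<lambda>t. - (exp (2 * t) * E t)) has_real_derivative - (exp (2 * x) * (2 * Qt w x + St v x))) (at x)"
            by (rule DERIV_cong) (simp add: algebra_simps)
          show "0 \<le> - (exp (2 * x) * (2 * Qt w x + St v x))"
            using St_bounds(2)[of x] N4 by (simp add: mult_nonneg_nonpos)
        qed
        then show ?thesis by simp
      qed
      show "exp (2 * t) * E t \<le> exp (2 * t) * (- 2 * \<beta> / 4 * exp (2 * t))" for t
      proof (rule mult_left_mono)
        have "\<beta> * exp (2 * t) / 4 \<le> Yt w t" using Yt_bounds(1)[of t] unfolding N4 .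
        then show "E t \<le> - 2 * \<beta> / 4 * exp (2 * t)"
          unfolding E_def using Qt_bounds(2)[of t] by simp
      qed simp
      show "((\<lambda>t. exp (2 * t) * (- 2 * \<beta> / 4 * exp (2 * t))) \<longlongrightarrow> 0) at_bot" by real_asymp
    qed
    then show ?thesis by (simp add: mult_le_0_iff not_le)
  qed
  have Ymono: "Yt w t \<le> Yt w s" if "s \<le> t" for s t
  proof -
    have "- Yt w s \<le> - Yt w t"
    proof (rule nondecreasing_of_derivative[OF that, where f' = "\<lambda>t. - E t"])
      show "continuous_on {s..t} (\<lambda>t. - Yt w t)" by (intro continuous_intros log_cont)
      show "((\<lambda>t. - Yt w t) has_real_derivative - E x) (at x)" for x
        using DERIV_minus[OF log_derivatives(2)[of x]] by (simp add: E_def N4)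
    qed (use E0 in auto)
    then show ?thesis by simp
  qed
  show ?thesis
  proof (cases "\<exists>t1. Yt w t1 + (4 + \<alpha>) < 0")
    case True
    then obtain t1 where "Yt w t1 + (4 + \<alpha>) < 0" by blast
    then show ?thesis using Ymono[of t1] by (intro decay_of_slope[of "- (Yt w t1 + (4 + \<alpha>))" t1]) auto
  next
    case False
    then have z': "0 \<le> Yt w t + (4 + \<alpha>)" for t by (simp add: not_less)
    have z0: "zt v 0 \<le> zt v t" if "t \<ge> 0" for t
      by (rule nondecreasing_of_derivative[OF that log_cont(1) log_derivatives(1)]) (use z' in auto)
    have S: "exp (zt v 0) * t \<le> St v t" if "t \<ge> 0" for t
    proof -
      have "St v 0 + 0 * (t - 0)\<^sup>2 / 2 + exp (zt v 0) * (t - 0) \<le> St v t"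
        by (rule increment_ge_linear[OF that log_cont(4) log_derivatives(4)]) (use z0 N4 in auto)
      then show ?thesis using St_bounds(1)[of 0] by simp
    qed
    \<comment> \<open>At this time S is at least 8 (5+\<alpha>), and Y is at most -S/8.\<close>
    define t where "t = 8 * (5 + \<alpha>) / exp (zt v 0)"
    have t: "t \<ge> 0" "exp (zt v 0) * t = 8 * (5 + \<alpha>)" using alpha by (auto simp: t_def)
    have "Yt w t + (4 + \<alpha>) < 0" using Yt_le_St[of t] S[OF t(1)] t(2) N4 by simp
    then show ?thesis using z'[of t] by simp
  qed
qed

text \<open>The bounds on S, Q and Y combine to r v' at most -\<kappa> r^(4+\<alpha>) e^v. Hence the
  derivative of e^(-v) is at least \<kappa> r^(3+\<alpha>), and integration from 0 gives the
  estimate.\<close>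

lemma potential_bound:
  assumes r: "r \<ge> 0"
  shows "r powr (4 + \<alpha>) * exp (v r) \<le> (4 + \<alpha>) * (real N * (real N - 2) * (real N + \<alpha>))"
proof -
  define \<kappa> where "\<kappa> = 1 / (real N * (real N - 2) * (real N + \<alpha>))"
  have pos: "real N * (real N - 2) * (real N + \<alpha>) > 0" using N_real alpha by (intro mult_pos_pos) auto
  have \<kappa>: "\<kappa> > 0" using pos by (simp add: \<kappa>_def)
  have a4: "4 + \<alpha> > 0" using alpha by simp
  have Yk: "\<kappa> * exp (zt v t) \<le> - Yt w t" for t
  proof -
    have "exp (zt v t) / (real N + \<alpha>) / (real N * (real N - 2)) \<le> St v t / (real N * (real N - 2))"
      using St_bounds(3)[of t] N_real by (intro divide_right_mono) auto
    then show ?thesis using Yt_le_St[of t] by (simp add: \<kappa>_def mult_ac)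
  qed
  let ?f = "\<lambda>r. exp (- v r) - \<kappa> / (4 + \<alpha>) * r powr (4 + \<alpha>)"
  have "?f 0 \<le> ?f r"
  proof (rule nondecreasing_of_derivative[OF r, where f' = "\<lambda>x. exp (- v x) * - (x powr (1 - real N) * momA w x) - \<kappa> / (4 + \<alpha>) * ((4 + \<alpha>) * x powr (4 + \<alpha> - 1))"])
    show "continuous_on {0..r} ?f"
      using a4 by (intro continuous_intros entire_solD(1)[OF sol] continuous_on_powr') auto
    fix x assume x: "0 < x" "x < r"
    show "(?f has_real_derivative exp (- v x) * - (x powr (1 - real N) * momA w x) - \<kappa> / (4 + \<alpha>) * ((4 + \<alpha>) * x powr (4 + \<alpha> - 1))) (at x)"
      by (intro DERIV_diff DERIV_chain2[OF DERIV_exp] DERIV_minus entire_sol_derivatives(1)[OF sol x(1)] DERIV_cmult has_real_derivative_powr x(1))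
    have Yx: "Yt w (ln x) = x * (x powr (1 - real N) * momA w x)"
    proof -
      have "exp ((2 - real N) * ln x) = x * x powr (1 - real N)"
        using x powr_add[of x 1 "1 - real N"] by (simp add: powr_def)
      then show ?thesis using x by (simp add: Yt_def)
    qed
    have "\<kappa> * (x powr (4 + \<alpha>) * exp (v x)) \<le> - (x * (x powr (1 - real N) * momA w x))"
      using Yk[of "ln x"] exp_zt[OF x(1)] Yx by simp
    then have "exp (- v x) / x * (\<kappa> * (x powr (4 + \<alpha>) * exp (v x))) \<le> exp (- v x) / x * - (x * (x powr (1 - real N) * momA w x))"
      using x by (intro mult_left_mono) auto
    moreover have "exp (- v x) / x * (\<kappa> * (x powr (4 + \<alpha>) * exp (v x))) = \<kappa> * x powr (4 + \<alpha> - 1)"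
    proof -
      have "exp (- v x) * exp (v x) = 1" by (simp add: exp_minus)
      moreover have "x powr (4 + \<alpha>) / x = x powr (4 + \<alpha> - 1)" using x powr_diff[of x "4 + \<alpha>" 1] by simp
      moreover have "exp (- v x) / x * (\<kappa> * (x powr (4 + \<alpha>) * exp (v x))) = \<kappa> * (x powr (4 + \<alpha>) / x) * (exp (- v x) * exp (v x))" by simp
      ultimately show ?thesis by simp
    qed
    moreover have "exp (- v x) / x * - (x * (x powr (1 - real N) * momA w x)) = exp (- v x) * - (x powr (1 - real N) * momA w x)"
      using x by simp
    moreover have "\<kappa> / (4 + \<alpha>) * ((4 + \<alpha>) * x powr (4 + \<alpha> - 1)) = \<kappa> * x powr (4 + \<alpha> - 1)" using a4 by simp
    ultimately show "0 \<le> exp (- v x) * - (x powr (1 - real N) * momA w x) - \<kappa> / (4 + \<alpha>) * ((4 + \<alpha>) * x powr (4 + \<alpha> - 1))" by simp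
  qed
  then have "\<kappa> / (4 + \<alpha>) * r powr (4 + \<alpha>) \<le> exp (- v r)"
    using a4 entire_solD(7)[OF sol] by simp
  then have "\<kappa> / (4 + \<alpha>) * r powr (4 + \<alpha>) * exp (v r) \<le> exp (- v r) * exp (v r)" by (intro mult_right_mono) auto
  then have "\<kappa> / (4 + \<alpha>) * (r powr (4 + \<alpha>) * exp (v r)) \<le> 1" by (simp add: exp_minus mult.assoc)
  then have "r powr (4 + \<alpha>) * exp (v r) \<le> (4 + \<alpha>) / \<kappa>" using \<kappa> a4 by (simp add: field_simps)
  then show ?thesis by (simp add: \<kappa>_def)
qed

text \<open>For y = z - ln lam the equation factors as (D+m-b) (D+m+b) (D+m+a) (D+m-a) y = lam (e^y
  - 1 - y), whose right side is nonnegative. Only the factor with b > m is unstable and is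
  integrated from plus infinity; this flips the sign to nonpositive. The other three have negative
  rates and are integrated from minus infinity, keeping it.\<close>

lemma potential_le_singular:
  assumes N5: "N \<ge> 5" and lam: "lam = 2 * (4 + \<alpha>) * (real N - 2) * (real N - 4)"
    and le: "lam \<le> (real N * (real N - 4) / 4)\<^sup>2"
  shows "exp (zt v t) \<le> lam"
proof -
  have Nr: "real N \<ge> 5" using N5 by simp
  have lam0: "lam > 0" using Nr alpha unfolding lam by (intro mult_pos_pos) auto
  define m where "m = (real N - 4) / 2"
  have m: "m > 0" "real N = 2 * m + 4" using Nr by (auto simp: m_def field_simps)
  have lam_m: "lam = 8 * (4 + \<alpha>) * (m + 1) * m" unfolding lam m(2) by (simp add: algebra_simps)
  define sg where "sg = m\<^sup>2 + (m + 2)\<^sup>2"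
  define cc where "cc = m * (m + 2)"
  have cc: "(real N * (real N - 4) / 4)\<^sup>2 = cc\<^sup>2"
  proof -
    have "real N * (real N - 4) / 4 = cc" unfolding cc_def m(2) by (simp add: field_simps)
    then show ?thesis by simp
  qed
  have disc: "sg\<^sup>2 - 4 * (cc\<^sup>2 - lam) = ((m + 2)\<^sup>2 - m\<^sup>2)\<^sup>2 + 4 * lam"
    unfolding sg_def cc_def by (simp add: power2_eq_square algebra_simps)
  define rt where "rt = sqrt (sg\<^sup>2 - 4 * (cc\<^sup>2 - lam))"
  have rt2: "rt\<^sup>2 = sg\<^sup>2 - 4 * (cc\<^sup>2 - lam)" unfolding rt_def disc using lam0 by simp
  have rt0: "rt \<ge> 0" unfolding rt_def disc using lam0 by simp
  have rt_gt: "rt > (m + 2)\<^sup>2 - m\<^sup>2"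
    unfolding rt_def disc using lam0 by (intro real_less_rsqrt) simp
  have rt_le: "rt \<le> sg"
    unfolding rt_def using le cc by (intro real_le_lsqrt) (auto simp: sg_def)
  \<comment> \<open>\<open>a\<^sup>2\<close> and \<open>b\<^sup>2\<close> are the roots of P - lam
    as a quadratic in s^2. The hypothesis on lam makes \<open>a\<close> real; lam > 0 pushes the
    roots apart, so that a < m and b > m + 2.\<close>
  define a where "a = sqrt ((sg - rt) / 2)"
  define b where "b = sqrt ((sg + rt) / 2)"
  have a2: "a\<^sup>2 = (sg - rt) / 2" and b2: "b\<^sup>2 = (sg + rt) / 2"
    using rt_le rt0 by (auto simp: a_def b_def sg_def)
  have a0: "a \<ge> 0" and b0: "b \<ge> 0" using rt_le rt0 by (auto simp: a_def b_def sg_def)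
  have am: "a < m"
  proof -
    have "a\<^sup>2 < m\<^sup>2" unfolding a2 using rt_gt by (simp add: sg_def)
    then show ?thesis using m by (simp add: power2_less_imp_less)
  qed
  have bm: "b > m + 2"
  proof -
    have "(m + 2)\<^sup>2 < b\<^sup>2" unfolding b2 using rt_gt by (simp add: sg_def)
    then show ?thesis using b0 by (rule power2_less_imp_less)
  qed
  have sum_ab: "a\<^sup>2 + b\<^sup>2 = sg" unfolding a2 b2 by (simp add: field_simps)
  have prod_ab: "a\<^sup>2 * b\<^sup>2 = cc\<^sup>2 - lam"
  proof -
    have "a\<^sup>2 * b\<^sup>2 = (sg\<^sup>2 - rt\<^sup>2) / 4" unfolding a2 b2 by (simp add: power2_eq_square algebra_simps)
    then show ?thesis unfolding rt2 by simp
  qed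
  define A where "A = 4 + \<alpha>"
  have A0: "A > 0" using alpha by (simp add: A_def)
  define y where "y t = zt v t - ln lam" for t
  \<comment> \<open>\<open>X1\<close>, \<open>X2\<close>, \<open>X3\<close> are (D+m-a) y, (D+m+a)
    X1 and (D+m+b) X2, spelled out through the first-order system.\<close>
  define X1 where "X1 t = Yt w t + A + (m - a) * y t" for t
  define X2 where "X2 t = Qt w t - 2 * Yt w t + 2 * m * A + (m\<^sup>2 - a\<^sup>2) * y t" for t
  define X3 where "X3 t = St v t + 2 * (real N - 2) * Yt w t + (m\<^sup>2 - a\<^sup>2) * (Yt w t + A) + (m + b) * X2 t" for t
  have dy: "(y has_real_derivative Yt w t + A) (at t)" for t
    unfolding y_def A_def by (rule DERIV_cong[OF DERIV_diff[OF log_derivatives(1) DERIV_const]]) simp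
  have dX1: "(X1 has_real_derivative X2 t - (m + a) * X1 t) (at t)" for t
    unfolding X1_def
    by (rule DERIV_cong[OF DERIV_add[OF DERIV_add[OF log_derivatives(2) DERIV_const] DERIV_cmult[OF dy]]])
      (simp add: X2_def m(2) power2_eq_square algebra_simps)
  have dX2: "(X2 has_real_derivative X3 t - (m + b) * X2 t) (at t)" for t
    unfolding X2_def
    by (rule DERIV_cong[OF DERIV_add[OF DERIV_add[OF DERIV_diff[OF log_derivatives(3) DERIV_cmult[OF log_derivatives(2)]] DERIV_const] DERIV_cmult[OF dy]]])
      (simp add: X3_def X2_def m(2) algebra_simps)
  have ez: "exp (zt v t) = lam * exp (y t)" for t
    using lam0 by (simp add: y_def exp_diff)
  have dX3: "(X3 has_real_derivative (b - m) * X3 t + lam * (exp (y t) - 1 - y t)) (at t)" for t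
  proof -
    have "(X3 has_real_derivative (- (real N - 4) * St v t + exp (zt v t)) + 2 * (real N - 2) * (- (real N - 2) * Yt w t + Qt w t)
      + (m\<^sup>2 - a\<^sup>2) * (- (real N - 2) * Yt w t + Qt w t) + (m + b) * (X3 t - (m + b) * X2 t)) (at t)"
      unfolding X3_def
      by (rule DERIV_cong[OF DERIV_add[OF DERIV_add[OF DERIV_add[OF log_derivatives(4) DERIV_cmult[OF log_derivatives(2)]]
        DERIV_cmult[OF DERIV_add[OF log_derivatives(2) DERIV_const]]] DERIV_cmult[OF dX2]]]) (simp add: X3_def)
    moreover have "(- (real N - 4) * St v t + exp (zt v t)) + 2 * (real N - 2) * (- (real N - 2) * Yt w t + Qt w t)
      + (m\<^sup>2 - a\<^sup>2) * (- (real N - 2) * Yt w t + Qt w t) + (m + b) * (X3 t - (m + b) * X2 t)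
      = (b - m) * X3 t + lam * (exp (y t) - 1 - y t)"
    proof -
      define S Y Q Z where "S = St v t" and "Y = Yt w t" and "Q = Qt w t" and "Z = y t"
      have h1: "b\<^sup>2 = m\<^sup>2 + (m + 2)\<^sup>2 - a\<^sup>2" using sum_ab by (simp add: sg_def)
      have h2: "a\<^sup>2 * b\<^sup>2 = (m * (m + 2))\<^sup>2 - 8 * A * (m + 1) * m" using prod_ab by (simp add: cc_def lam_m A_def)
      have l: "lam = 8 * A * (m + 1) * m" by (simp add: lam_m A_def)
      have "- (2 * m) * S + 2 * (2 * m + 2) * (- (2 * m + 2) * Y + Q) + (m\<^sup>2 - a\<^sup>2) * (- (2 * m + 2) * Y + Q)
        + (m + b) * ((S + 2 * (2 * m + 2) * Y + (m\<^sup>2 - a\<^sup>2) * (Y + A) + (m + b) * (Q - 2 * Y + 2 * m * A + (m\<^sup>2 - a\<^sup>2) * Z))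
          - (m + b) * (Q - 2 * Y + 2 * m * A + (m\<^sup>2 - a\<^sup>2) * Z))
        = (b - m) * (S + 2 * (2 * m + 2) * Y + (m\<^sup>2 - a\<^sup>2) * (Y + A) + (m + b) * (Q - 2 * Y + 2 * m * A + (m\<^sup>2 - a\<^sup>2) * Z))
          - 8 * A * (m + 1) * m * (1 + Z)"
        using h1 h2 by algebra
      then show ?thesis
        unfolding ez X3_def X2_def S_def[symmetric] Y_def[symmetric] Q_def[symmetric] Z_def[symmetric] l m(2)
        by (simp add: algebra_simps)
    qed
    ultimately show ?thesis by simp
  qed
  have vle: "v (exp t) \<le> 0" for t by (rule entire_sol_v_nonpos[OF sol])
  have y_le: "y t \<le> A * t + \<bar>ln lam\<bar>" for t using vle[of t] by (simp add: y_def zt_def A_def)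
  have contX: "continuous_on U y" "continuous_on U X1" "continuous_on U X2" "continuous_on U X3" for U
    using dy dX1 dX2 dX3 by (auto intro!: continuous_at_imp_continuous_on DERIV_isCont)
  have dexp: "((\<lambda>t. exp (c * t)) has_real_derivative c * exp (c * x)) (at x)" for c x :: real
    by (auto intro!: derivative_eq_intros)
  have Y2: "- Yt w t \<le> - \<beta> * exp (2 * t)" for t
  proof -
    have b0: "\<beta> < 0" using Qt_bounds[of t] by (smt (verit) exp_gt_zero mult_nonneg_nonneg)
    have "- Yt w t \<le> - \<beta> * exp (2 * t) / real N" using Yt_bounds(1)[of t] by simp
    also have "\<dots> \<le> - \<beta> * exp (2 * t) / 1" using b0 Nr by (intro divide_left_mono) (auto intro!: mult_nonpos_nonneg)
    finally show ?thesis by simp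
  qed
  have ma: "m\<^sup>2 - a\<^sup>2 > 0" using am a0 by (simp add: power_strict_mono)
  have X2_le: "X2 t \<le> - 2 * \<beta> * exp (2 * t) + 2 * m * A + (m\<^sup>2 - a\<^sup>2) * (A * t + \<bar>ln lam\<bar>)" for t
    unfolding X2_def using Qt_bounds(2)[of t] Y2[of t] mult_left_mono[OF y_le[of t] less_imp_le[OF ma]] by simp
  have X3_le: "X3 t \<le> - (real N - 2) * \<beta> * exp (2 * t) + (m\<^sup>2 - a\<^sup>2) * A + (m + b) * (- 2 * \<beta> * exp (2 * t) + 2 * m * A + (m\<^sup>2 - a\<^sup>2) * (A * t + \<bar>ln lam\<bar>))" for t
  proof -
    have "St v t \<le> - (real N - 2) * (\<beta> * exp (2 * t))"
    proof -
      have "(real N - 2) * (\<beta> * exp (2 * t)) \<le> (real N - 2) * Qt w t" using Qt_bounds(1)[of t] Nr by (intro mult_left_mono) auto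
      then show ?thesis using St_bounds(2)[of t] by linarith
    qed
    moreover have "2 * (real N - 2) * Yt w t \<le> 0" using Yt_bounds(3)[of t] Nr by (intro mult_nonneg_nonpos) auto
    moreover have "(m\<^sup>2 - a\<^sup>2) * (Yt w t + A) \<le> (m\<^sup>2 - a\<^sup>2) * A" using Yt_bounds(3)[of t] ma by (intro mult_left_mono) auto
    moreover have "(m + b) * X2 t \<le> (m + b) * (- 2 * \<beta> * exp (2 * t) + 2 * m * A + (m\<^sup>2 - a\<^sup>2) * (A * t + \<bar>ln lam\<bar>))"
      using X2_le[of t] m b0 by (intro mult_left_mono) auto
    ultimately show ?thesis unfolding X3_def by (simp add: mult.assoc)
  qed
  \<comment> \<open>X3 is at most of order e^(2t), and b - m > 2. So e^((m-b)t) X3, which is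
    nondecreasing, has a majorant tending to 0 at plus infinity.\<close>
  have X3_nonpos: "X3 t \<le> 0" for t
  proof -
    define g where "g t = exp ((m - b) * t) * (- (real N - 2) * \<beta> * exp (2 * t) + (m\<^sup>2 - a\<^sup>2) * A + (m + b) * (- 2 * \<beta> * exp (2 * t) + 2 * m * A + (m\<^sup>2 - a\<^sup>2) * (A * t + \<bar>ln lam\<bar>)))" for t
    have "exp ((m - b) * t) * X3 t \<le> 0"
    proof (rule nondecreasing_tendsto_0_imp_nonpos[where f = "\<lambda>t. exp ((m - b) * t) * X3 t" and t = t and t0 = 0 and g = g])
      show "exp ((m - b) * s) * X3 s \<le> exp ((m - b) * t) * X3 t" if "s \<le> t" for s t
      proof (rule nondecreasing_of_derivative[OF that, where f' = "\<lambda>t. exp ((m - b) * t) * (lam * (exp (y t) - 1 - y t))"])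
        show "continuous_on {s..t} (\<lambda>t. exp ((m - b) * t) * X3 t)" by (intro continuous_intros contX)
        show "((\<lambda>t. exp ((m - b) * t) * X3 t) has_real_derivative exp ((m - b) * x) * (lam * (exp (y x) - 1 - y x))) (at x)" for x
          by (rule DERIV_cong[OF DERIV_mult[OF dexp dX3]]) (simp add: algebra_simps)
        show "0 \<le> exp ((m - b) * x) * (lam * (exp (y x) - 1 - y x))" for x
        proof -
          have "0 \<le> exp (y x) - 1 - y x" using exp_ge_add_one_self[of "y x"] by linarith
          then show ?thesis using lam0 by (intro mult_nonneg_nonneg) auto
        qed
      qed
      show "exp ((m - b) * t) * X3 t \<le> g t" for t
        unfolding g_def using X3_le[of t] by (intro mult_left_mono) auto
      show "(g \<longlongrightarrow> 0) at_top"
      proof -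
        define \<mu> where "\<mu> = b - m"
        define k1 where "k1 = - (real N - 2) * \<beta> - 2 * \<beta> * (m + b)"
        define k2 where "k2 = (m\<^sup>2 - a\<^sup>2) * A + (m + b) * (2 * m * A + (m\<^sup>2 - a\<^sup>2) * \<bar>ln lam\<bar>)"
        define k3 where "k3 = (m + b) * ((m\<^sup>2 - a\<^sup>2) * A)"
        have mu: "\<mu> > 2" using bm by (simp add: \<mu>_def)
        have "g = (\<lambda>t. exp (- \<mu> * t) * (k1 * exp (2 * t) + k2 + k3 * t))"
          unfolding g_def k1_def k2_def k3_def \<mu>_def by (auto simp: fun_eq_iff algebra_simps)
        moreover have "((\<lambda>t::real. exp (- \<mu> * t) * (k1 * exp (2 * t) + k2 + k3 * t)) \<longlongrightarrow> 0) at_top"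
        proof -
          have "((\<lambda>t::real. exp (- \<mu> * t) * exp (2 * t)) \<longlongrightarrow> 0) at_top" using mu by real_asymp
          moreover have "((\<lambda>t::real. exp (- \<mu> * t)) \<longlongrightarrow> 0) at_top" using mu by real_asymp
          moreover have "((\<lambda>t::real. exp (- \<mu> * t) * t) \<longlongrightarrow> 0) at_top" using mu by real_asymp
          ultimately have "((\<lambda>t::real. k1 * (exp (- \<mu> * t) * exp (2 * t)) + k2 * exp (- \<mu> * t) + k3 * (exp (- \<mu> * t) * t)) \<longlongrightarrow> k1 * 0 + k2 * 0 + k3 * 0) at_top"
            by (intro tendsto_intros)
          then show ?thesis by (simp add: algebra_simps)
        qed
        ultimately show ?thesis by simp
      qed
    qed
    then show ?thesis by (simp add: mult_le_0_iff not_le)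
  qed
  \<comment> \<open>The common argument for the stable factors: e^(p t) X is nonincreasing, and an
    upper bound on X for negative t makes its limit at minus infinity nonpositive.\<close>
  have descend: "X t \<le> 0" if dX: "\<And>t. (X has_real_derivative X' t - p * X t) (at t)" and X': "\<And>t. X' t \<le> 0" and p: "p > 0"
    and bd: "\<And>t. t \<le> 0 \<Longrightarrow> X t \<le> C" for X X' p C t
  proof -
    have "exp (p * t) * X t \<le> 0"
    proof (rule nonincreasing_tendsto_0_imp_nonpos[where f = "\<lambda>t. exp (p * t) * X t" and t = t and t0 = 0 and g = "\<lambda>t. exp (p * t) * C"])
      show "exp (p * t) * X t \<le> exp (p * s) * X s" if "s \<le> t" for s t
      proof -
        have "- (exp (p * s) * X s) \<le> - (exp (p * t) * X t)"
        proof (rule nondecreasing_of_derivative[OF that, where f' = "\<lambda>t. - (exp (p * t) * X' t)"])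
          show "continuous_on {s..t} (\<lambda>t. - (exp (p * t) * X t))"
            by (intro continuous_intros continuous_at_imp_continuous_on ballI DERIV_isCont[OF dX])
          show "((\<lambda>t. - (exp (p * t) * X t)) has_real_derivative - (exp (p * x) * X' x)) (at x)" for x
            by (rule DERIV_cong[OF DERIV_minus[OF DERIV_mult[OF dexp dX]]]) (simp add: algebra_simps)
          show "0 \<le> - (exp (p * x) * X' x)" for x using X'[of x] by (simp add: mult_nonneg_nonpos)
        qed
        then show ?thesis by simp
      qed
      show "exp (p * t) * X t \<le> exp (p * t) * C" if "t \<le> 0" for t using bd[OF that] by (intro mult_left_mono) auto
      show "((\<lambda>t. exp (p * t) * C) \<longlongrightarrow> 0) at_bot" using p by real_asymp
    qed
    then show ?thesis by (simp add: mult_le_0_iff not_le)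
  qed
  have y_bd: "y t \<le> \<bar>ln lam\<bar>" if "t \<le> 0" for t
    using y_le[of t] that A0 mult_nonneg_nonpos[of A t] by simp
  have X2_nonpos: "X2 t \<le> 0" for t
  proof (rule descend[OF dX2 X3_nonpos])
    show "m + b > 0" using m b0 by simp
    fix t :: real assume t: "t \<le> 0"
    have b0: "\<beta> < 0" using Qt_bounds[of t] by (smt (verit) exp_gt_zero mult_nonneg_nonneg)
    have "- 2 * \<beta> * exp (2 * t) \<le> - 2 * \<beta> * 1" using b0 t by (intro mult_left_mono) auto
    moreover have "(m\<^sup>2 - a\<^sup>2) * y t \<le> (m\<^sup>2 - a\<^sup>2) * \<bar>ln lam\<bar>" using y_bd[OF t] ma by (intro mult_left_mono) auto
    ultimately show "X2 t \<le> - 2 * \<beta> + 2 * m * A + (m\<^sup>2 - a\<^sup>2) * \<bar>ln lam\<bar>"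
      unfolding X2_def using Qt_bounds(2)[of t] Y2[of t] by simp
  qed
  have X1_nonpos: "X1 t \<le> 0" for t
  proof (rule descend[OF dX1 X2_nonpos])
    show "m + a > 0" using m a0 by simp
    fix t :: real assume t: "t \<le> 0"
    have "(m - a) * y t \<le> (m - a) * \<bar>ln lam\<bar>" using y_bd[OF t] am by (intro mult_left_mono) auto
    then show "X1 t \<le> A + (m - a) * \<bar>ln lam\<bar>" unfolding X1_def using Yt_bounds(3)[of t] by simp
  qed
  have "y t \<le> 0"
  proof (rule descend[where X = y and X' = X1 and p = "m - a" and C = "\<bar>ln lam\<bar>" and t = t, OF _ X1_nonpos])
    show "(y has_real_derivative X1 t - (m - a) * y t) (at t)" for t
      by (rule DERIV_cong[OF dy]) (simp add: X1_def)
    show "m - a > 0" using am by simp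
    show "y t \<le> \<bar>ln lam\<bar>" if "t \<le> 0" for t by (rule y_bd[OF that])
  qed
  then have "exp (y t) \<le> 1" by simp
  then show ?thesis unfolding ez using lam0 by simp
qed

end

end

section \<open>Stability of the radial solutions\<close>


context radial_problem begin

lemma decay_subcritical:
  assumes sol: "entire_sol N \<alpha> \<beta> v w" and lt: "\<beta> < beta0 N \<alpha>"
  shows "\<exists>C R \<delta>. \<delta> > 0 \<and> (\<forall>r\<ge>R. r powr \<alpha> * exp (v r) \<le> C * r powr (- 4 - \<delta>))"
proof -
  define k where "k = (beta0 N \<alpha> - \<beta>) / (2 * real N)"
  have k: "k > 0" using lt N3 by (simp add: k_def)
  have v: "v r \<le> - k * r\<^sup>2" if r: "r \<ge> 0" for r
  proof -
    have "opA w r \<le> opA (\<lambda>_. \<beta> - beta0 N \<alpha>) r"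
      using entire_sol_w_le[OF sol lt] by (intro A.rop_mono entire_solD[OF sol]) auto
    also have "\<dots> = - k * r\<^sup>2" using r N3 by (simp add: opA_const k_def field_simps)
    finally show ?thesis using entire_solD(3)[OF sol, of r] by simp
  qed
  have "((\<lambda>r::real. r powr \<alpha> * exp (- k * r\<^sup>2) * r powr 5) \<longlongrightarrow> 0) at_top" using k by real_asymp
  then have "\<forall>\<^sub>F r::real in at_top. r powr \<alpha> * exp (- k * r\<^sup>2) * r powr 5 < 1" by (rule order_tendstoD) simp
  then obtain R where R: "\<And>r. r \<ge> R \<Longrightarrow> r powr \<alpha> * exp (- k * r\<^sup>2) * r powr 5 < 1" by (auto simp: eventually_at_top_linorder)
  have "r powr \<alpha> * exp (v r) \<le> 1 * r powr (- 4 - 1)" if "r \<ge> max 1 R" for r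
  proof -
    have r: "r \<ge> 1" "r \<ge> R" using that by auto
    have "r powr \<alpha> * exp (v r) \<le> r powr \<alpha> * exp (- k * r\<^sup>2)"
      using v[of r] r by (intro mult_left_mono) auto
    also have "\<dots> = (r powr \<alpha> * exp (- k * r\<^sup>2) * r powr 5) * r powr (- 5)"
    proof -
      have "r powr 5 * r powr (- 5) = 1" using r unfolding powr_add[symmetric] by simp
      then show ?thesis by (simp only: mult.assoc mult_1_right)
    qed
    also have "\<dots> \<le> 1 * r powr (- 5)" using R[OF r(2)] by (intro mult_right_mono) auto
    finally show ?thesis by simp
  qed
  then show ?thesis by (intro exI[of _ 1] exI[of _ "max 1 R"]) auto
qed

text \<open>The combination \<open>S + (N-4) Q - 2 (N-4) Y - 2 (N-4) (N-2) z\<close> has derivative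
  \<open>e\<^sup>z - lam\<close>; at \<open>\<beta>\<^sub>0\<close> it stays bounded below, so the mean of \<open>e\<^sup>z\<close> is at least \<open>lam\<close>.\<close>

lemma critical_mean_lower_bound:
  assumes sol: "entire_sol N \<alpha> (beta0 N \<alpha>) v w" and N5: "N \<ge> 5"
    and lam: "lam = 2 * (4 + \<alpha>) * (real N - 2) * (real N - 4)"
  shows "\<exists>G Bd. \<forall>r\<ge>1. (G has_real_derivative (r powr (4 + \<alpha>) * exp (v r) - lam) / r) (at r) \<and> Bd \<le> G r"
proof -
  have Nr: "real N \<ge> 5" using N5 by simp
  note d = log_derivatives[OF sol]
  define E where "E = (4 + \<alpha>) * (real N * (real N - 2) * (real N + \<alpha>))"
  have E0: "E > 0" unfolding E_def using Nr alpha by (intro mult_pos_pos) auto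
  have mB: "momB v r \<le> E / (real N - 4) * r powr (real N - 4)" if r: "r \<ge> 0" for r
  proof -
    let ?f = "\<lambda>r. E / (real N - 4) * r powr (real N - 4) - momB v r"
    have "?f 0 \<le> ?f r"
    proof (rule nondecreasing_of_derivative[OF r, where f' = "\<lambda>x. E / (real N - 4) * ((real N - 4) * x powr (real N - 4 - 1)) - x powr (real N - 1 + \<alpha>) * exp (v x)"])
      show "continuous_on {0..r} ?f"
        using Nr by (intro continuous_intros continuous_on_powr' B.mom_continuous entire_solD(6)[OF sol]) auto
      fix x assume x: "0 < x" "x < r"
      show "(?f has_real_derivative E / (real N - 4) * ((real N - 4) * x powr (real N - 4 - 1)) - x powr (real N - 1 + \<alpha>) * exp (v x)) (at x)"
        by (intro DERIV_diff DERIV_cmult has_real_derivative_powr entire_sol_derivatives(4)[OF sol] x(1))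
      have "x powr (real N - 1 + \<alpha>) * exp (v x) = x powr (real N - 4 - 1) * (x powr (4 + \<alpha>) * exp (v x))"
      proof -
        have "x powr (real N - 4 - 1) * x powr (4 + \<alpha>) = x powr (real N - 1 + \<alpha>)"
          unfolding powr_add[symmetric] by (simp add: algebra_simps)
        then show ?thesis by (simp only: mult.assoc[symmetric])
      qed
      also have "\<dots> \<le> x powr (real N - 4 - 1) * E"
        unfolding E_def using x by (intro mult_left_mono potential_bound[OF sol]) auto
      finally show "0 \<le> E / (real N - 4) * ((real N - 4) * x powr (real N - 4 - 1)) - x powr (real N - 1 + \<alpha>) * exp (v x)"
        using Nr by (simp add: mult.commute)
    qed
    moreover have "?f 0 = 0" using Nr by (simp add: radial_moment_def)
    ultimately show ?thesis by simp
  qed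
  define C where "C = E / (real N - 4)"
  have C0: "C > 0" using E0 Nr by (simp add: C_def)
  have S_le: "St v t \<le> C" for t
  proof -
    have "St v t \<le> exp ((4 - real N) * t) * (C * exp t powr (real N - 4))"
      unfolding St_def C_def using mB[of "exp t"] by (intro mult_left_mono) auto
    also have "\<dots> = C"
    proof -
      have "exp ((4 - real N) * t) * exp t powr (real N - 4) = 1"
        unfolding exp_powr exp_add[symmetric] by (simp add: algebra_simps)
      then show ?thesis by (metis mult.commute mult.assoc mult_1_right)
    qed
    finally show ?thesis .
  qed
  \<comment> \<open>Here criticality enters. w + (C/2) e^(-2t) is nonincreasing in t because S is at
    most C; were it negative somewhere, w would stay below a negative constant, which is excluded at
    the critical parameter.\<close>
  have Q_ge: "- C / 2 \<le> Qt w t" for t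
  proof -
    let ?f = "\<lambda>t. exp (- 2 * t) * Qt w t + C / 2 * exp (- 2 * t)"
    have fQ: "exp (- 2 * t) * Qt w t = w (exp t)" for t
      unfolding Qt_def mult.assoc[symmetric] exp_add[symmetric] by simp
    have mono: "?f s \<le> ?f t" if "t \<le> s" for s t
    proof -
      have "- ?f t \<le> - ?f s"
      proof (rule nondecreasing_of_derivative[OF that, where f' = "\<lambda>x. exp (- 2 * x) * (C - St v x)"])
        show "continuous_on {t..s} (\<lambda>t. - ?f t)" by (intro continuous_intros log_cont[OF sol])
        fix x
        have e: "((\<lambda>t. exp (- 2 * t)) has_real_derivative - 2 * exp (- 2 * x)) (at x)" by (auto intro!: derivative_eq_intros)
        show "((\<lambda>t. - ?f t) has_real_derivative exp (- 2 * x) * (C - St v x)) (at x)"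
          by (rule DERIV_cong[OF DERIV_minus[OF DERIV_add[OF DERIV_mult[OF e d(3)] DERIV_cmult[OF e]]]]) (simp add: algebra_simps)
        show "0 \<le> exp (- 2 * x) * (C - St v x)" using S_le[of x] by simp
      qed
      then show ?thesis by simp
    qed
    have f0: "0 \<le> ?f t" for t
    proof (rule ccontr)
      assume "\<not> 0 \<le> ?f t"
      then have "- ?f t > 0" by simp
      from beta0_w_sup[OF sol this] obtain R where R: "R \<ge> 0" "\<And>r. r \<ge> R \<Longrightarrow> ?f t < w r"
        unfolding minus_minus by blast
      define s where "s = max t (ln (R + 1))"
      have "exp s \<ge> R + 1" using R(1) unfolding s_def by (metis add_nonneg_pos exp_le_cancel_iff exp_ln max.cobounded2 zero_less_one)
      then have "?f t < w (exp s)" using R(2)[of "exp s"] by simp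
      moreover have "w (exp s) \<le> ?f s" unfolding fQ using C0 by simp
      moreover have "?f s \<le> ?f t" by (rule mono) (simp add: s_def)
      ultimately show False by linarith
    qed
    have "0 \<le> exp (- 2 * t) * (Qt w t + C / 2)" using f0[of t] by (simp add: algebra_simps)
    then have "0 \<le> Qt w t + C / 2" by (simp add: zero_le_mult_iff)
    then show ?thesis by simp
  qed
  define g where "g t = St v t + (real N - 4) * Qt w t - 2 * (real N - 4) * Yt w t - 2 * (real N - 4) * (real N - 2) * zt v t" for t
  have dg: "(g has_real_derivative exp (zt v t) - lam) (at t)" for t
    unfolding g_def
    by (rule DERIV_cong[OF DERIV_diff[OF DERIV_diff[OF DERIV_add[OF d(4) DERIV_cmult[OF d(3)]] DERIV_cmult[OF d(2)]] DERIV_cmult[OF d(1)]]])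
      (simp add: lam algebra_simps)
  have z_le: "zt v (ln r) \<le> ln E" if r: "r > 0" for r
  proof -
    have "exp (zt v (ln r)) \<le> E" unfolding exp_zt[OF sol r] E_def using r by (intro potential_bound[OF sol]) auto
    then show ?thesis using E0 by (simp add: ln_ge_iff)
  qed
  \<comment> \<open>S is positive and Y negative, so these terms only help; z is bounded above by
    the potential bound, and Q below by criticality.\<close>
  define Bd where "Bd = (real N - 4) * (- C / 2) - 2 * (real N - 4) * (real N - 2) * ln E"
  have "((\<lambda>r. g (ln r)) has_real_derivative (r powr (4 + \<alpha>) * exp (v r) - lam) / r) (at r) \<and> Bd \<le> g (ln r)" if "r \<ge> 1" for r
  proof
    have r: "r > 0" using that by simp
    show "((\<lambda>r. g (ln r)) has_real_derivative (r powr (4 + \<alpha>) * exp (v r) - lam) / r) (at r)"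
      by (rule DERIV_cong[OF DERIV_chain2[OF dg DERIV_ln[OF r]]]) (simp add: exp_zt[OF sol r] divide_inverse)
    have "(real N - 4) * (- C / 2) \<le> (real N - 4) * Qt w (ln r)" using Q_ge Nr by (intro mult_left_mono) auto
    moreover have "2 * (real N - 4) * Yt w (ln r) \<le> 0" using Yt_bounds(3)[OF sol, of "ln r"] Nr by (intro mult_nonneg_nonpos) auto
    moreover have "2 * (real N - 4) * (real N - 2) * zt v (ln r) \<le> 2 * (real N - 4) * (real N - 2) * ln E"
      using z_le[OF r] Nr by (intro mult_left_mono) auto
    moreover have "0 < St v (ln r)" by (rule St_bounds(1)[OF sol])
    ultimately show "Bd \<le> g (ln r)" unfolding g_def Bd_def by linarith
  qed
  then show ?thesis by blast
qed

end

section \<open>The dimension threshold\<close>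

text \<open>After division by (x-4)/16 the difference of the two sides is P(x) = x^2 (x-4) - k
  (x-2). Since x^2 (x-4) / (x-2) increases on [5, infinity), P changes sign there exactly
  once.\<close>

lemma N_alpha_threshold:
  fixes \<alpha> :: real and N :: nat
  assumes "\<alpha> > - 2"
  defines "c \<equiv> real N * (real N - 4) / 4" and "lam \<equiv> 2 * (4 + \<alpha>) * (real N - 2) * (real N - 4)"
  shows "N_alpha \<alpha> > 5" "5 \<le> N \<Longrightarrow> real N < N_alpha \<alpha> \<Longrightarrow> c\<^sup>2 < lam" "N_alpha \<alpha> \<le> real N \<Longrightarrow> lam \<le> c\<^sup>2"
proof -
  define k where "k = 32 * (4 + \<alpha>)"
  have k: "k > 64" using assms(1) by (simp add: k_def)
  define P where "P x = x\<^sup>2 * (x - 4) - k * (x - 2)" for x :: real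
  have fac: "x\<^sup>2 * (x - 4)\<^sup>2 / 16 - 2 * (4 + \<alpha>) * (x - 2) * (x - 4) = (x - 4) / 16 * P x" for x :: real
    by (simp add: P_def k_def power2_eq_square field_simps)
  have eq: "x\<^sup>2 * (x - 4)\<^sup>2 / 16 = 2 * (4 + \<alpha>) * (x - 2) * (x - 4) \<longleftrightarrow> P x = 0" if "x > 5" for x :: real
    using fac[of x] that by auto
  \<comment> \<open>The monotonicity of x^2 (x-4) / (x-2) in cross-multiplied form.\<close>
  have up: "P y > 0" if "P x \<ge> 0" "5 \<le> x" "x < y" for x y :: real
  proof -
    have 1: "(x - 4) * (y - 2) < (y - 4) * (x - 2)" using that by (simp add: algebra_simps)
    have "x\<^sup>2 * ((x - 4) * (y - 2)) \<le> y\<^sup>2 * ((x - 4) * (y - 2))"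
      using that by (intro mult_right_mono power_mono) auto
    also have "\<dots> < y\<^sup>2 * ((y - 4) * (x - 2))" using 1 that by (intro mult_strict_left_mono) auto
    finally have 2: "x\<^sup>2 * (x - 4) * (y - 2) < y\<^sup>2 * (y - 4) * (x - 2)" by (simp add: mult.assoc)
    have "k * (x - 2) * (y - 2) \<le> x\<^sup>2 * (x - 4) * (y - 2)" using that by (intro mult_right_mono) (auto simp: P_def)
    with 2 have "k * (y - 2) * (x - 2) < y\<^sup>2 * (y - 4) * (x - 2)" by (simp add: mult_ac)
    then show ?thesis using that by (simp add: P_def)
  qed
  have P5: "P 5 < 0" using k by (simp add: P_def)
  have "\<exists>x. 5 \<le> x \<and> x \<le> k + 5 \<and> P x = 0"
  proof (rule IVT')
    have "k * (k + 3) \<le> (k + 5)\<^sup>2 * (k + 1)"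
    proof -
      have "k * (k + 3) \<le> (k + 5) * (k + 5)" using k by (intro mult_mono) auto
      also have "\<dots> \<le> (k + 5)\<^sup>2 * (k + 1)" using k by (simp add: power2_eq_square)
      finally show ?thesis .
    qed
    then show "0 \<le> P (k + 5)" by (simp add: P_def add.commute)
    show "continuous_on {5..k + 5} P" unfolding P_def by (intro continuous_intros)
  qed (use P5 k in auto)
  then obtain \<rho> where \<rho>: "5 \<le> \<rho>" "P \<rho> = 0" by blast
  have \<rho>5: "\<rho> > 5" using \<rho> P5 by (cases "\<rho> = 5") auto
  have N\<rho>: "N_alpha \<alpha> = \<rho>"
    unfolding N_alpha_def
  proof (rule the_equality)
    show "5 < \<rho> \<and> \<rho>\<^sup>2 * (\<rho> - 4)\<^sup>2 / 16 = 2 * (4 + \<alpha>) * (\<rho> - 2) * (\<rho> - 4)" using \<rho>5 \<rho> eq by blast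
    fix x assume "5 < x \<and> x\<^sup>2 * (x - 4)\<^sup>2 / 16 = 2 * (4 + \<alpha>) * (x - 2) * (x - 4)"
    then have "5 < x" "P x = 0" using eq by auto
    then show "x = \<rho>" using up[of x \<rho>] up[of \<rho> x] \<rho> \<rho>5 by (cases x \<rho> rule: linorder_cases) auto
  qed
  show "N_alpha \<alpha> > 5" using N\<rho> \<rho>5 by simp
  have cl: "c\<^sup>2 - lam = (real N - 4) / 16 * P (real N)"
    unfolding fac[symmetric] c_def lam_def by (simp add: power_mult_distrib power_divide)
  show "c\<^sup>2 < lam" if "5 \<le> N" "real N < N_alpha \<alpha>"
  proof -
    have "\<not> 0 \<le> P (real N)" using up[of "real N" \<rho>] \<rho>(2) that N\<rho> by auto
    then have "(real N - 4) / 16 * P (real N) < 0" using that(1) by (intro mult_pos_neg) auto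
    then show ?thesis using cl by simp
  qed
  show "lam \<le> c\<^sup>2" if "N_alpha \<alpha> \<le> real N"
  proof -
    have "0 \<le> P (real N)" using up[of \<rho> "real N"] \<rho> that N\<rho> by (cases "\<rho> = real N") auto
    then have "0 \<le> (real N - 4) / 16 * P (real N)" using that N\<rho> \<rho>5 by (intro mult_nonneg_nonneg) auto
    then show ?thesis using cl by simp
  qed
qed

section \<open>Dependence of stability on the profile and the parameter\<close>

lemma integrable_potential:
  fixes \<phi> :: "'a::euclidean_space \<Rightarrow> real"
  assumes \<phi>: "C2c \<phi> UNIV" and \<alpha>: "\<alpha> + real DIM('a) - 1 \<ge> 0" and v: "continuous_on UNIV v" "\<And>r. v r \<le> 0"
  shows "integrable lborel (\<lambda>x. norm x powr \<alpha> * exp (v (norm x)) * (\<phi> x)\<^sup>2)"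
proof -
  have C2: "C2 \<phi>" "compact (closure {x. \<phi> x \<noteq> 0})" using \<phi> by (auto simp: C2c_def)
  have c\<phi>: "continuous_on UNIV \<phi>"
    using C2(1) unfolding C2_def
    by (meson continuous_at_imp_continuous_on has_derivative_continuous)
  obtain R where R: "\<And>x. x \<in> closure {x. \<phi> x \<noteq> 0} \<Longrightarrow> norm x \<le> R"
    using compact_imp_bounded[OF C2(2)] by (auto simp: bounded_iff)
  have z: "\<phi> x = 0" if "norm x > R" for x
    using R[of x] that closure_subset[of "{x. \<phi> x \<noteq> 0}"] by force
  have "bounded (\<phi> ` closure {x. \<phi> x \<noteq> 0})"
    using C2(2) continuous_on_subset[OF c\<phi>] by (intro compact_imp_bounded compact_continuous_image) auto
  then obtain B where B: "B > 0" "\<And>x. x \<in> closure {x. \<phi> x \<noteq> 0} \<Longrightarrow> \<bar>\<phi> x\<bar> \<le> B"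
    unfolding bounded_pos by (metis image_eqI real_norm_def)
  have bd: "\<bar>\<phi> x\<bar> \<le> B" for x
    using B(2)[of x] closure_subset[of "{x. \<phi> x \<noteq> 0}"] B(1) by (cases "\<phi> x = 0") auto
  have "integrable lborel (\<lambda>x. norm x powr \<alpha> * (exp (v (norm x)) * (\<phi> x)\<^sup>2))"
  proof (rule integrable_weight_compact_support[OF \<alpha>, where B = "1 * B\<^sup>2" and R = R])
    have "continuous_on UNIV (\<lambda>x::'a. v (norm x))"
      by (rule continuous_on_compose2[OF v(1)]) (auto intro!: continuous_intros)
    then have "continuous_on UNIV (\<lambda>x. exp (v (norm x)) * (\<phi> x)\<^sup>2)" by (intro continuous_intros c\<phi>)
    then show "(\<lambda>x. exp (v (norm x)) * (\<phi> x)\<^sup>2) \<in> borel_measurable borel" by (rule borel_measurable_continuous_onI)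
    show "\<bar>exp (v (norm x)) * (\<phi> x)\<^sup>2\<bar> \<le> 1 * B\<^sup>2" for x
    proof -
      have "(\<phi> x)\<^sup>2 \<le> B\<^sup>2" using bd[of x] B(1) by (simp add: abs_le_square_iff[symmetric])
      then show ?thesis unfolding abs_mult using v(2)[of "norm x"] by (intro mult_mono) auto
    qed
    show "exp (v (norm x)) * (\<phi> x)\<^sup>2 = 0" if "norm x > R" for x using z[OF that] by simp
  qed
  then show ?thesis by (simp add: mult.assoc)
qed

text \<open>A smaller profile has a smaller potential. Integrability for the larger profile matters,
  since otherwise its Bochner integral would be 0 and the comparison could fail.\<close>

lemma stable_sol_mono:
  assumes \<alpha>: "\<alpha> + real DIM('a::euclidean_space) - 1 \<ge> 0" and v: "continuous_on UNIV v2" "\<And>r. v2 r \<le> 0"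
    and le: "\<And>r. r \<ge> 0 \<Longrightarrow> v1 r \<le> v2 r" and st: "stable_sol \<alpha> (\<lambda>x::'a. v2 (norm x))"
  shows "stable_sol \<alpha> (\<lambda>x::'a. v1 (norm x))"
  unfolding stable_sol_def stable_on_iff
proof (intro allI impI)
  fix \<phi> :: "'a \<Rightarrow> real" assume \<phi>: "C2c \<phi> UNIV"
  have "(LINT x|lborel. norm x powr \<alpha> * exp (v1 (norm x)) * (\<phi> x)\<^sup>2) \<le> (LINT x|lborel. norm x powr \<alpha> * exp (v2 (norm x)) * (\<phi> x)\<^sup>2)"
    by (rule integral_mono'[OF integrable_potential[OF \<phi> \<alpha> v]]) (auto intro!: mult_right_mono mult_left_mono le)
  also have "\<dots> \<le> (LINT x|lborel. (laplacian \<phi> x)\<^sup>2)"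
    using st \<phi> unfolding stable_sol_def stable_on_iff by blast
  finally show "(LINT x|lborel. norm x powr \<alpha> * exp (v1 (norm x)) * (\<phi> x)\<^sup>2) \<le> (LINT x|lborel. (laplacian \<phi> x)\<^sup>2)" .
qed

text \<open>Nonpositive profiles are dominated by the profile 0, so the potential terms converge for
  each fixed test function.\<close>

lemma stable_sol_limit:
  assumes \<alpha>: "\<alpha> + real DIM('a::euclidean_space) - 1 \<ge> 0"
    and v: "\<And>n. continuous_on UNIV (v n)" "\<And>n r. v n r \<le> 0" and V: "continuous_on UNIV V" "\<And>r. V r \<le> 0"
    and lim: "\<And>r. r \<ge> 0 \<Longrightarrow> (\<lambda>n. v n r) \<longlonglongrightarrow> V r"
    and st: "\<And>n. stable_sol \<alpha> (\<lambda>x::'a. v n (norm x))"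
  shows "stable_sol \<alpha> (\<lambda>x::'a. V (norm x))"
  unfolding stable_sol_def stable_on_iff
proof (intro allI impI)
  fix \<phi> :: "'a \<Rightarrow> real" assume \<phi>: "C2c \<phi> UNIV"
  have "(\<lambda>n. LINT x|lborel. norm x powr \<alpha> * exp (v n (norm x)) * (\<phi> x)\<^sup>2) \<longlonglongrightarrow> (LINT x|lborel. norm x powr \<alpha> * exp (V (norm x)) * (\<phi> x)\<^sup>2)"
  proof (rule integral_dominated_convergence[where w = "\<lambda>x. norm x powr \<alpha> * exp (0::real) * (\<phi> x)\<^sup>2"])
    show "integrable lborel (\<lambda>x. norm x powr \<alpha> * exp (0::real) * (\<phi> x)\<^sup>2)"
      using integrable_potential[OF \<phi> \<alpha>, of "\<lambda>_. 0"] by simp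
    show "(\<lambda>x. norm x powr \<alpha> * exp (V (norm x)) * (\<phi> x)\<^sup>2) \<in> borel_measurable lborel"
      using integrable_potential[OF \<phi> \<alpha> V] by (rule borel_measurable_integrable)
    show "(\<lambda>x. norm x powr \<alpha> * exp (v n (norm x)) * (\<phi> x)\<^sup>2) \<in> borel_measurable lborel" for n
      using integrable_potential[OF \<phi> \<alpha> v] by (rule borel_measurable_integrable)
    show "AE x in lborel. (\<lambda>n. norm x powr \<alpha> * exp (v n (norm x)) * (\<phi> x)\<^sup>2) \<longlonglongrightarrow> norm x powr \<alpha> * exp (V (norm x)) * (\<phi> x)\<^sup>2"
      by (intro AE_I2 tendsto_intros lim) simp
    show "AE x in lborel. norm (norm x powr \<alpha> * exp (v n (norm x)) * (\<phi> x)\<^sup>2) \<le> norm x powr \<alpha> * exp (0::real) * (\<phi> x)\<^sup>2" for n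
      using v(2) by (auto simp: abs_mult intro!: AE_I2 mult_right_mono mult_left_le)
  qed
  then show "(LINT x|lborel. norm x powr \<alpha> * exp (V (norm x)) * (\<phi> x)\<^sup>2) \<le> (LINT x|lborel. (laplacian \<phi> x)\<^sup>2)"
    using st \<phi> unfolding stable_sol_def stable_on_iff by (intro LIMSEQ_le_const2) auto
qed

lemma stable_sol_of_potential_bound:
  assumes N: "DIM('a::euclidean_space) \<ge> 4"
    and bd: "\<And>r. r > 0 \<Longrightarrow> r powr (4 + \<alpha>) * exp (v r) \<le> (real DIM('a) * (real DIM('a) - 4) / 4)\<^sup>2"
  shows "stable_sol \<alpha> (\<lambda>x::'a. v (norm x))"
proof (rule stable_sol_of_rellich_bound[OF N refl])
  fix x :: 'a assume "x \<noteq> 0"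
  then have r: "norm x > 0" by simp
  have "norm x powr (4 + \<alpha>) = norm x ^ 4 * norm x powr \<alpha>" using r by (simp add: powr_add)
  then show "norm x powr \<alpha> * exp (v (norm x)) \<le> (real DIM('a) * (real DIM('a) - 4) / 4)\<^sup>2 / norm x ^ 4"
    using bd[OF r] r by (simp add: pos_le_divide_eq mult_ac)
qed

text \<open>The profile in \<open>u_beta\<close> is an arbitrary choice among solutions; uniqueness
  on nonnegative radii identifies it with any given entire solution.\<close>

lemma u_beta_eq:
  assumes rp: "radial_problem DIM('a::euclidean_space) \<alpha>" and sol: "entire_sol DIM('a) \<alpha> \<beta> v w"
  shows "(u_beta \<alpha> \<beta> :: 'a \<Rightarrow> real) = (\<lambda>x. v (norm x))"
proof -
  interpret radial_problem "DIM('a)" \<alpha> by (rule rp)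
  have "\<exists>w. radial_sol DIM('a) \<alpha> \<beta> {0..} (u_prof DIM('a) \<alpha> \<beta>) w"
    unfolding u_prof_def by (rule someI[of _ v]) (use radial_sol_of_entire_sol(1)[OF sol] in blast)
  then obtain w' where "radial_sol DIM('a) \<alpha> \<beta> {0..} (u_prof DIM('a) \<alpha> \<beta>) w'" by blast
  from entire_sol_unique[OF entire_sol_of_radial_sol[OF this] sol]
  show ?thesis by (auto simp: u_beta_def fun_eq_iff)
qed

lemma (in radial_problem) very_negative_potential_bound:
  assumes "K > 0"
  shows "\<exists>\<beta> v w. entire_sol N \<alpha> \<beta> v w \<and> (\<forall>r>0. r powr (4 + \<alpha>) * exp (v r) \<le> K)"
proof -
  have A: "4 + \<alpha> > 0" using alpha by simp
  have N0: "real N > 0" using N3 by simp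
  \<comment> \<open>Chosen so that ln (k r^2) at most k r^2 - 1 becomes (4+\<alpha>) ln r at most
    (4+\<alpha>)/2 k r^2 + ln K; the Gaussian bound on v then cancels the quadratic term.\<close>
  define k where "k = exp (- 1 - 2 * ln K / (4 + \<alpha>))"
  obtain B0 where B0: "\<And>\<beta>. \<beta> \<le> B0 \<Longrightarrow> \<exists>v w. entire_sol N \<alpha> \<beta> v w \<and> (\<forall>r\<ge>0. v r \<le> \<beta> / (4 * real N) * r\<^sup>2)"
    using entire_sol_very_negative by blast
  define \<beta> where "\<beta> = min B0 (- (4 * real N) * ((4 + \<alpha>) / 2 * k))"
  obtain v w where s: "entire_sol N \<alpha> \<beta> v w" "\<And>r. r \<ge> 0 \<Longrightarrow> v r \<le> \<beta> / (4 * real N) * r\<^sup>2"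
    using B0[of \<beta>] by (auto simp: \<beta>_def)
  have \<beta>: "\<beta> / (4 * real N) \<le> - ((4 + \<alpha>) / 2 * k)"
  proof -
    have "\<beta> \<le> - (4 * real N) * ((4 + \<alpha>) / 2 * k)" by (simp add: \<beta>_def)
    then have "\<beta> / (4 * real N) \<le> - (4 * real N) * ((4 + \<alpha>) / 2 * k) / (4 * real N)"
      using N0 by (intro divide_right_mono) auto
    then show ?thesis using N0 by (simp add: mult.commute)
  qed
  have "r powr (4 + \<alpha>) * exp (v r) \<le> K" if r: "r > 0" for r
  proof -
    have "ln (k * r\<^sup>2) \<le> k * r\<^sup>2 - 1" using r by (intro ln_le_minus_one) (simp add: k_def)
    moreover have "ln (k * r\<^sup>2) = (- 1 - 2 * ln K / (4 + \<alpha>)) + 2 * ln r"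
      using r by (simp add: k_def ln_mult ln_realpow)
    ultimately have "2 * ln r \<le> k * r\<^sup>2 + 2 * ln K / (4 + \<alpha>)" by simp
    then have "(4 + \<alpha>) / 2 * (2 * ln r) \<le> (4 + \<alpha>) / 2 * (k * r\<^sup>2 + 2 * ln K / (4 + \<alpha>))"
      using A by (intro mult_left_mono) auto
    moreover have "(4 + \<alpha>) / 2 * (k * r\<^sup>2 + 2 * ln K / (4 + \<alpha>)) = (4 + \<alpha>) / 2 * k * r\<^sup>2 + ln K"
      unfolding distrib_left using A by simp
    moreover have "(4 + \<alpha>) / 2 * (2 * ln r) = (4 + \<alpha>) * ln r" by simp
    ultimately have "(4 + \<alpha>) * ln r \<le> (4 + \<alpha>) / 2 * k * r\<^sup>2 + ln K" by linarith
    moreover have "v r \<le> - ((4 + \<alpha>) / 2 * k) * r\<^sup>2"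
      using s(2)[of r] mult_right_mono[OF \<beta>, of "r\<^sup>2"] r by simp
    ultimately have "(4 + \<alpha>) * ln r + v r \<le> ln K" by simp
    then have "exp ((4 + \<alpha>) * ln r + v r) \<le> exp (ln K)" by (simp only: exp_le_cancel_iff)
    then show ?thesis using r assms by (simp add: exp_add powr_def)
  qed
  then show ?thesis using s(1) by blast
qed

theorem theorem1p4:
  fixes \<alpha> :: real
  assumes N3: "DIM('a::euclidean_space) \<ge> 3"
    and alpha: "\<alpha> > -2"
  shows
    "(DIM('a) = 3 \<or> DIM('a) = 4 \<longrightarrow>
        (\<forall>\<beta>\<le>beta0 DIM('a) \<alpha>.
           \<not> stable_sol \<alpha> (u_beta \<alpha> \<beta> :: 'a \<Rightarrow> real) \<and>
           stable_at_infinity \<alpha> (u_beta \<alpha> \<beta> :: 'a \<Rightarrow> real)))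
     \<and>
     (5 \<le> DIM('a) \<and> real DIM('a) < N_alpha \<alpha> \<longrightarrow>
        (\<forall>\<beta><beta0 DIM('a) \<alpha>. stable_at_infinity \<alpha> (u_beta \<alpha> \<beta> :: 'a \<Rightarrow> real)) \<and>
        (\<forall>K::'a set. compact K \<longrightarrow>
           \<not> stable_on \<alpha> (u_beta \<alpha> (beta0 DIM('a) \<alpha>)) (UNIV - K)) \<and>
        (\<exists>\<beta>1 < beta0 DIM('a) \<alpha>. \<forall>\<beta>\<le>beta0 DIM('a) \<alpha>.
           stable_sol \<alpha> (u_beta \<alpha> \<beta> :: 'a \<Rightarrow> real) \<longleftrightarrow> \<beta> \<le> \<beta>1))
     \<and>
     (real DIM('a) \<ge> N_alpha \<alpha> \<longrightarrow>
        (\<forall>\<beta>\<le>beta0 DIM('a) \<alpha>. stable_sol \<alpha> (u_beta \<alpha> \<beta> :: 'a \<Rightarrow> real)))"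
proof -
  have rp: "radial_problem DIM('a) \<alpha>" using N3 alpha by unfold_locales auto
  interpret radial_problem "DIM('a)" \<alpha> by (rule rp)
  let ?n = "DIM('a)" and ?b0 = "beta0 DIM('a) \<alpha>"
  have n3: "real ?n \<ge> 3" using N3 by simp
  have \<alpha>n: "\<alpha> + real ?n - 1 \<ge> 0" using n3 alpha by linarith
  have sol_ex: "\<exists>v w. entire_sol ?n \<alpha> \<beta> v w \<and> (u_beta \<alpha> \<beta> :: 'a \<Rightarrow> real) = (\<lambda>x. v (norm x))" if "\<beta> \<le> ?b0" for \<beta>
    using that entire_parameters_iff[of \<beta>] u_beta_eq[OF rp] by (auto simp: entire_parameters_def)
  have at_inf: "stable_at_infinity \<alpha> (\<lambda>x::'a. v (norm x))"
    if dec: "\<exists>C R \<delta>. \<delta> > 0 \<and> (\<forall>r\<ge>R. r powr \<alpha> * exp (v r) \<le> C * r powr (- 4 - \<delta>))" for v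
  proof -
    obtain C R \<delta> where "\<delta> > 0" "\<And>r. r \<ge> R \<Longrightarrow> r powr \<alpha> * exp (v r) \<le> C * r powr (- 4 - \<delta>)" using dec by blast
    then show ?thesis by (intro stable_at_infinity_of_decay[of \<delta> R]) auto
  qed
  have cont: "continuous_on UNIV v" "v r \<le> 0" if "entire_sol ?n \<alpha> \<beta> v w" for \<beta> v w r
    using entire_solD(1)[OF that] entire_sol_v_nonpos[OF that] by auto
  define c where "c = real ?n * (real ?n - 4) / 4"
  define lam where "lam = 2 * (4 + \<alpha>) * (real ?n - 2) * (real ?n - 4)"
  note thr = N_alpha_threshold(1)[OF alpha] N_alpha_threshold(2,3)[OF alpha, of ?n, folded c_def lam_def]
  have i: "\<not> stable_sol \<alpha> (u_beta \<alpha> \<beta> :: 'a \<Rightarrow> real) \<and> stable_at_infinity \<alpha> (u_beta \<alpha> \<beta> :: 'a \<Rightarrow> real)"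
    if n: "?n = 3 \<or> ?n = 4" and \<beta>: "\<beta> \<le> ?b0" for \<beta>
  proof -
    obtain v w where s: "entire_sol ?n \<alpha> \<beta> v w" and u: "(u_beta \<alpha> \<beta> :: 'a \<Rightarrow> real) = (\<lambda>x. v (norm x))"
      using sol_ex[OF \<beta>] by blast
    show ?thesis
      unfolding u using unstable_low_dimension[OF n alpha cont[OF s]] at_inf
        decay_dimension_3[OF s] decay_dimension_4[OF s] n by blast
  qed
  have ii_a: "stable_at_infinity \<alpha> (u_beta \<alpha> \<beta> :: 'a \<Rightarrow> real)" if \<beta>: "\<beta> < ?b0" for \<beta>
  proof -
    obtain v w where s: "entire_sol ?n \<alpha> \<beta> v w" and u: "(u_beta \<alpha> \<beta> :: 'a \<Rightarrow> real) = (\<lambda>x. v (norm x))"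
      using sol_ex[of \<beta>] \<beta> by auto
    show ?thesis unfolding u by (rule at_inf[OF decay_subcritical[OF s \<beta>]])
  qed
  have ii_b: "\<not> stable_on \<alpha> (u_beta \<alpha> ?b0) (UNIV - K)"
    if n: "5 \<le> ?n" "real ?n < N_alpha \<alpha>" and K: "compact K" for K :: "'a set"
  proof -
    obtain v w where s: "entire_sol ?n \<alpha> ?b0 v w" and u: "(u_beta \<alpha> ?b0 :: 'a \<Rightarrow> real) = (\<lambda>x. v (norm x))"
      using sol_ex[of ?b0] by auto
    obtain G Bd where G: "\<And>r. r \<ge> 1 \<Longrightarrow> (G has_real_derivative (r powr (4 + \<alpha>) * exp (v r) - lam) / r) (at r)"
      "\<And>r. r \<ge> 1 \<Longrightarrow> Bd \<le> G r"
      using critical_mean_lower_bound[OF s n(1) lam_def] by blast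
    show ?thesis
      unfolding u by (rule unstable_exterior[OF \<alpha>n cont[OF s] c_def thr(2)[OF n] zero_less_one G K])
  qed
  have ii_c: "\<exists>\<beta>1 < ?b0. \<forall>\<beta>\<le>?b0. stable_sol \<alpha> (u_beta \<alpha> \<beta> :: 'a \<Rightarrow> real) \<longleftrightarrow> \<beta> \<le> \<beta>1"
    if n: "5 \<le> ?n" "real ?n < N_alpha \<alpha>"
  proof -
    \<comment> \<open>The set of stable parameters (the name does not refer to the logarithmic
      variable). It is nonempty, closed downwards and contains its supremum, so it is a half line;
      instability at the critical parameter makes its end point strictly smaller.\<close>
    define St where "St = {\<beta>. \<beta> \<le> ?b0 \<and> stable_sol \<alpha> (u_beta \<alpha> \<beta> :: 'a \<Rightarrow> real)}"
    have down: "\<beta> \<in> St" if bb: "\<beta>' \<in> St" "\<beta> \<le> \<beta>'" for \<beta> \<beta>'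
    proof (cases "\<beta> = \<beta>'")
      case False
      then have lt: "\<beta> < \<beta>'" using bb by simp
      obtain v w where s: "entire_sol ?n \<alpha> \<beta> v w" and u: "(u_beta \<alpha> \<beta> :: 'a \<Rightarrow> real) = (\<lambda>x. v (norm x))"
        using sol_ex[of \<beta>] bb by (auto simp: St_def)
      obtain v' w' where s': "entire_sol ?n \<alpha> \<beta>' v' w'" and u': "(u_beta \<alpha> \<beta>' :: 'a \<Rightarrow> real) = (\<lambda>x. v' (norm x))"
        using sol_ex[of \<beta>'] bb by (auto simp: St_def)
      have "stable_sol \<alpha> (\<lambda>x::'a. v (norm x))"
        using bb(1) by (intro stable_sol_mono[OF \<alpha>n cont[OF s'] entire_sol_comparison(2)[OF s s' lt]]) (auto simp: St_def u')
      then show ?thesis using bb lt by (auto simp: St_def u)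
    qed (use bb in simp)
    have c0: "c\<^sup>2 > 0" using n(1) by (simp add: c_def)
    \<comment> \<open>A very negative parameter pushes e^z below the Rellich constant everywhere,
      which gives a first stable solution.\<close>
    obtain \<beta>s vs ws where s: "entire_sol ?n \<alpha> \<beta>s vs ws" "\<And>r. r > 0 \<Longrightarrow> r powr (4 + \<alpha>) * exp (vs r) \<le> c\<^sup>2"
      using very_negative_potential_bound[OF c0] by blast
    have ne: "\<beta>s \<in> St"
    proof -
      have "\<beta>s \<le> ?b0" using s(1) entire_parameters_iff[of \<beta>s] by (auto simp: entire_parameters_def)
      moreover have "stable_sol \<alpha> (\<lambda>x::'a. vs (norm x))"
        using n(1) s(2) unfolding c_def by (intro stable_sol_of_potential_bound) auto
      ultimately show ?thesis using u_beta_eq[OF rp s(1)] by (simp add: St_def)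
    qed
    have bdd: "bdd_above St" by (auto simp: St_def intro!: bdd_aboveI)
    define \<beta>1 where "\<beta>1 = Sup St"
    have le1: "\<beta> \<le> \<beta>1" if "\<beta> \<in> St" for \<beta> unfolding \<beta>1_def using that bdd by (rule cSup_upper)
    have b1: "\<beta>1 \<le> ?b0" unfolding \<beta>1_def using ne by (intro cSup_least) (auto simp: St_def)
    \<comment> \<open>Left continuity: solutions at parameters increasing to the supremum converge
      pointwise, and stability survives the limit.\<close>
    have mem: "\<beta>1 \<in> St"
    proof -
      define b where "b m = \<beta>1 - inverse (real (Suc m))" for m
      have bSt: "b m \<in> St" for m
      proof -
        have "b m < Sup St" by (simp add: b_def \<beta>1_def)
        then obtain \<beta>' where "\<beta>' \<in> St" "b m < \<beta>'" using less_cSupD[of St] ne by blast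
        then show ?thesis using down less_imp_le by blast
      qed
      have "\<exists>v w. entire_sol ?n \<alpha> (b m) v w \<and> (u_beta \<alpha> (b m) :: 'a \<Rightarrow> real) = (\<lambda>x. v (norm x))" for m
        using sol_ex[of "b m"] bSt[of m] by (simp add: St_def)
      then obtain v w where vw: "\<And>m. entire_sol ?n \<alpha> (b m) (v m) (w m)"
        "\<And>m. (u_beta \<alpha> (b m) :: 'a \<Rightarrow> real) = (\<lambda>x. v m (norm x))" by metis
      have binc: "b m < b (Suc m)" for m by (simp add: b_def)
      have "b \<longlonglongrightarrow> \<beta>1 - 0" unfolding b_def by (intro tendsto_intros LIMSEQ_inverse_real_of_nat)
      then have blim: "b \<longlonglongrightarrow> \<beta>1" by simp
      obtain V W where V: "entire_sol ?n \<alpha> \<beta>1 V W" "\<And>r. r \<ge> 0 \<Longrightarrow> (\<lambda>m. v m r) \<longlonglongrightarrow> V r"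
        using entire_sol_limit[OF vw(1) binc blim] by blast
      have stm: "stable_sol \<alpha> (\<lambda>x::'a. v m (norm x))" for m
        using bSt[of m] vw(2)[of m] by (simp add: St_def)
      have "stable_sol \<alpha> (\<lambda>x::'a. V (norm x))"
        by (rule stable_sol_limit[where v = v, OF \<alpha>n cont(1)[OF vw(1)] cont(2)[OF vw(1)] cont[OF V(1)] V(2) stm])
      then show ?thesis using b1 u_beta_eq[OF rp V(1)] by (simp add: St_def)
    qed
    \<comment> \<open>Instability outside every compact set, applied to the empty set.\<close>
    have "\<not> stable_sol \<alpha> (u_beta \<alpha> ?b0 :: 'a \<Rightarrow> real)"
      using ii_b[OF n compact_empty] by (simp add: stable_sol_def)
    then have "\<beta>1 \<noteq> ?b0" using mem by (auto simp: St_def)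
    then have "\<beta>1 < ?b0" using b1 by simp
    moreover have "stable_sol \<alpha> (u_beta \<alpha> \<beta> :: 'a \<Rightarrow> real) \<longleftrightarrow> \<beta> \<le> \<beta>1" if "\<beta> \<le> ?b0" for \<beta>
      using le1[of \<beta>] down[OF mem, of \<beta>] that by (auto simp: St_def)
    ultimately show ?thesis by blast
  qed
  have iii: "stable_sol \<alpha> (u_beta \<alpha> \<beta> :: 'a \<Rightarrow> real)" if n: "real ?n \<ge> N_alpha \<alpha>" and \<beta>: "\<beta> \<le> ?b0" for \<beta>
  proof -
    obtain v w where s: "entire_sol ?n \<alpha> \<beta> v w" and u: "(u_beta \<alpha> \<beta> :: 'a \<Rightarrow> real) = (\<lambda>x. v (norm x))"
      using sol_ex[OF \<beta>] by blast
    have n5: "5 \<le> ?n" using n thr(1) by linarith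
    have "r powr (4 + \<alpha>) * exp (v r) \<le> (real ?n * (real ?n - 4) / 4)\<^sup>2" if r: "r > 0" for r
    proof -
      have "exp (zt v (ln r)) \<le> lam"
        using thr(3)[OF n] by (intro potential_le_singular[OF s n5 lam_def]) (simp add: c_def)
      then show ?thesis using thr(3)[OF n] unfolding exp_zt[OF s r] c_def by linarith
    qed
    then show ?thesis unfolding u using n5 by (intro stable_sol_of_potential_bound) auto
  qed
  show ?thesis using i ii_a ii_b ii_c iii by blast
qed

end
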